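(* Let $m>n\ge2$ be integers and let $\Lambda\subseteq\{0,\ldots,m-1\}\times\{0,\ldots,n-1\}$ be nonempty. Then for each $z=(u,v)\in\mathbb{Z}^2$ the mass dimension of $\mathcal{O}^+_\Lambda(z)$ exists, and $$\dim_{\mathrm M}\mathcal{O}^+_\Lambda(z)=\log_m\Big(\frac{\#\Lambda}{\eta(u)}\Big)+\log_n\eta(u),$$ $$\dim_{\mathrm{Be}}\mathcal{O}^+_\Lambda(z)=\log_m\Big(\frac{\#\Lambda}{N_{\max}}\Big)+\log_nN_{\max},$$ $$\delta(\mathcal{O}^+_\Lambda(z))=\min\Big\{\log_m\Big(\frac{\#\Lambda}{\eta(u)}\Big),\log_mN_\Lambda\Big\}+\log_n\eta(u),$$ $$\dim_{\mathrm{DP}}\mathcal{O}^+_\Lambda(z)=\max\Big\{\log_m\Big(\frac{\#\Lambda}{\eta(u)}\Big),\log_mN_\Lambda\Big\}+\log_n\eta(u),$$ $$\dim_{\mathrm A}\mathcal{O}^+_\Lambda(z)=\log_mN_\Lambda+\log_nN_{\max},$$ $$\dim_{\mathrm{LH}}\mathcal{O}^+_\Lambda(z)=\dim_{\mathrm{DH}}\mathcal{O}^+_\Lambda(z)=\min_{0\le\lambda\le1}\log_m\bigg(\sum_{i:N_i>0}\Big(\frac{N_i}{\eta(u)}\Big)^\lambda\bigg)+\log_n\eta(u).$$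
   Context: **Orbit.** For $z=(u,v)\in\mathbb{Z}^2$ and $k\ge1$ let $$\Lambda_k(z)=\Big\{\Big(m^ku+\sum_{\ell=0}^{k-1}i_\ell m^\ell,\ n^kv+\sum_{\ell=0}^{k-1}j_\ell n^\ell\Big):(i_\ell,j_\ell)\in\Lambda\text{ for }0\le\ell<k\Big\},\qquad \mathcal{O}^+_\Lambda(z)=\bigcup_{k\ge1}\Lambda_k(z).$$ **Column data.** For $i\in\{0,\ldots,m-1\}$: $N_i=\#\{j:(i,j)\in\Lambda\}$, $N_\Lambda=\#\{i:N_i>0\}$, $N_{\max}=\max_{0\le i\le m-1}N_i$. For $u\in\mathbb{Z}$: $\eta(0)=\max\{1,N_0\}$, $\eta(-1)=\max\{1,N_{m-1}\}$, and $\eta(u)=1$ for $u\notin\{0,-1\}$. **Dimensions of $A\subseteq\mathbb{Z}^2$.** Mass: $\dim_{\mathrm{LM}}A$ and $\dim_{\mathrm{UM}}A$ are the $\liminf$ and $\limsup$ as $h\to+\infty$ of $\log\#(A\cap[-h,h]^2)/\log h$; if they agree, the common value is $\dim_{\mathrm M}A$. Beurling: $\dim_{\mathrm{Be}}A=\limsup_{h\to+\infty}\sup_{w\in\mathbb{R}^2}\dfrac{\log\#(A\cap(w+[-h,h]^2))}{\log h}$. Cubes: for $x\in\mathbb{Z}^2$ and $r\ge1$, $C(x,r)=\{y\in\mathbb{Z}^2:x_i\le y_i<x_i+r,\ i=1,2\}$ and $V(x,r)=\{y\in\mathbb{Z}^2:x_i-r/2\le y_i<x_i+r/2,\ i=1,2\}$;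 $\mathscr{C}=\{C(x,r):x\in\mathbb{Z}^2,\ r\in\mathbb{Z}_{>0}\}$. For a finite set $E\subset\mathbb{Z}^2$, $d(E)=\min\{r\in\mathbb{Z}_{>0}:E\subseteq C(x,r)\text{ for some }x\in\mathbb{Z}^2\}$. Put $V_k^{(2)}=V(0,2^k)$ for $k\ge 0$, $S_1^{(2)}=V_1^{(2)}$, $S_k^{(2)}=V_k^{(2)}\setminus V_{k-1}^{(2)}$ for $k\ge2$. For $F\subset\mathbb{Z}^2$ finite and nonempty and $\alpha>0$, $$\nu_\alpha(A,F)=\min\Big\{\sum_i\Big(\frac{d(U_i)}{d(F)}\Big)^\alpha:U_i\in\mathscr{C},\ A\cap F\subseteq\bigcup_iU_i\Big\}.$$ Discrete Hausdorff: $\dim_{\mathrm{DH}}A=\inf\{\alpha>0:\sum_{k\ge1}\nu_\alpha(A,S_k^{(2)})<\infty\}$. Lower discrete Hausdorff: $\dim_{\mathrm{LH}}A=\inf\{\alpha>0:\lim_{k\to\infty}\nu_\alpha(A,S_k^{(2)})=0\}$. For $r\ge1$, $N_r(A)$ is the minimum number of axis-parallel squares of side length $r$ needed to cover $A$, and $P_r(A)$ is the maximum cardinality of a family of pairwise disjoint axis-parallel squares of side length $r$ centered at points of $A$. (Scales $r$ may be taken real, in which case maxima/minima over $r$ mean suprema/infima, or integer; this does not affect the dimensions.) Discrete packing: $\dim_{\mathrm{DP}}A=\inf\{\alpha\ge0:\lim_{k\to\infty}\max_{1\le r\le2^{k(1-\varepsilon)}}(r/2^k)^\alpha P_r(A\cap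 S_k^{(2)})=0\text{ for each }\varepsilon\in(0,1)\}$. Lower entropy index: $\delta(A)=\inf\{\alpha\ge0:\lim_{k\to\infty}\min_{1\le r\le2^{k(1-\varepsilon)}}(r/2^k)^\alpha P_r(A\cap S_k^{(2)})=0\text{ for some }\varepsilon\in(0,1)\}$. Assouad (large-scale): $\dim_{\mathrm A}A=\inf\{\alpha\ge0:\exists C>0\text{ with }N_r(A\cap B(x,R))\le C(R/r)^\alpha\text{ for all }x\in A,\ 1\le r<R\}$, where $B(x,R)$ is the Euclidean ball. *)

theory Defs
  imports "HOL-Analysis.Analysis"
begin

text \<open>Subsets of the integer lattice are sets of type \<^typ>\<open>(int \<times> int) set\<close>; balls and squares
  live in the plane \<^typ>\<open>real \<times> real\<close>, whose metric is the Euclidean one. All dimensions take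
  values in \<^typ>\<open>ereal\<close>, so that no infimum of an empty set and no unbounded supremum is silently
  given an arbitrary real value.\<close>

definition real_pt :: "int \<times> int \<Rightarrow> real \<times> real" where
  "real_pt y = (real_of_int (fst y), real_of_int (snd y))"

definition box_around :: "real \<times> real \<Rightarrow> real \<Rightarrow> (real \<times> real) set" where
  "box_around w h = {fst w - h .. fst w + h} \<times> {snd w - h .. snd w + h}"

section \<open>Orbits and column data\<close>

definition level_set :: "nat \<Rightarrow> nat \<Rightarrow> (nat \<times> nat) set \<Rightarrow> int \<times> int \<Rightarrow> nat \<Rightarrow> (int \<times> int) set" where
  "level_set m n \<Lambda> z k =
     {(int m ^ k * fst z + (\<Sum>l<k. int (fst (d l)) * int m ^ l),
       int n ^ k * snd z + (\<Sum>l<k. int (snd (d l)) * int n ^ l)) | d :: nat \<Rightarrow> nat \<times> nat.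
      \<forall>l<k. d l \<in> \<Lambda>}"

definition pos_orbit :: "nat \<Rightarrow> nat \<Rightarrow> (nat \<times> nat) set \<Rightarrow> int \<times> int \<Rightarrow> (int \<times> int) set" where
  "pos_orbit m n \<Lambda> z = (\<Union>k\<in>{1..}. level_set m n \<Lambda> z k)"

definition col_count :: "(nat \<times> nat) set \<Rightarrow> nat \<Rightarrow> nat" where
  "col_count \<Lambda> i = card {j. (i, j) \<in> \<Lambda>}"

definition nonempty_cols :: "nat \<Rightarrow> (nat \<times> nat) set \<Rightarrow> nat set" where
  "nonempty_cols m \<Lambda> = {i. i < m \<and> col_count \<Lambda> i > 0}"

definition num_cols :: "nat \<Rightarrow> (nat \<times> nat) set \<Rightarrow> nat" where
  "num_cols m \<Lambda> = card (nonempty_cols m \<Lambda>)"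

definition max_col :: "nat \<Rightarrow> (nat \<times> nat) set \<Rightarrow> nat" where
  "max_col m \<Lambda> = Max (col_count \<Lambda> ` {0..<m})"

definition eta :: "nat \<Rightarrow> (nat \<times> nat) set \<Rightarrow> int \<Rightarrow> nat" where
  "eta m \<Lambda> u =
     (if u = 0 then max 1 (col_count \<Lambda> 0)
      else if u = -1 then max 1 (col_count \<Lambda> (m - 1))
      else 1)"

section \<open>Mass and Beurling dimensions\<close>

text \<open>The logarithm of a cardinality, with the convention that the logarithm of zero is
  \<open>-\<infinity>\<close> (whereas \<^term>\<open>ln (0::real) = 0\<close> holds in the library).\<close>

definition log_card :: "'a set \<Rightarrow> ereal" where
  "log_card S = (if card S = 0 then -\<infinity> else ereal (ln (real (card S))))"

definition lower_mass_dim :: "(int \<times> int) set \<Rightarrow> ereal" where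
  "lower_mass_dim A =
     Liminf at_top (\<lambda>h::real. log_card {y \<in> A. real_pt y \<in> box_around (0, 0) h} / ereal (ln h))"

definition upper_mass_dim :: "(int \<times> int) set \<Rightarrow> ereal" where
  "upper_mass_dim A =
     Limsup at_top (\<lambda>h::real. log_card {y \<in> A. real_pt y \<in> box_around (0, 0) h} / ereal (ln h))"

definition mass_dim_exists :: "(int \<times> int) set \<Rightarrow> bool" where
  "mass_dim_exists A \<longleftrightarrow> lower_mass_dim A = upper_mass_dim A"

text \<open>Meaningful only if \<^const>\<open>mass_dim_exists\<close> holds.\<close>

definition mass_dim :: "(int \<times> int) set \<Rightarrow> ereal" where
  "mass_dim A = (THE d. lower_mass_dim A = d \<and> upper_mass_dim A = d)"

definition beurling_dim :: "(int \<times> int) set \<Rightarrow> ereal" where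
  "beurling_dim A =
     Limsup at_top (\<lambda>h::real. SUP w. log_card {y \<in> A. real_pt y \<in> box_around w h} / ereal (ln h))"

section \<open>Discrete Hausdorff dimensions\<close>

definition cube :: "int \<times> int \<Rightarrow> nat \<Rightarrow> (int \<times> int) set" where
  "cube x r = {y. fst x \<le> fst y \<and> fst y < fst x + int r \<and> snd x \<le> snd y \<and> snd y < snd x + int r}"

definition centred_cube :: "int \<times> int \<Rightarrow> real \<Rightarrow> (int \<times> int) set" where
  "centred_cube x r =
     {y. real_of_int (fst x) - r / 2 \<le> real_of_int (fst y)
       \<and> real_of_int (fst y) < real_of_int (fst x) + r / 2
       \<and> real_of_int (snd x) - r / 2 \<le> real_of_int (snd y)
       \<and> real_of_int (snd y) < real_of_int (snd x) + r / 2}"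

definition cubes :: "(int \<times> int) set set" where
  "cubes = {cube x r | x r. r > 0}"

definition cube_diam :: "(int \<times> int) set \<Rightarrow> nat" where
  "cube_diam E = (LEAST r. r > 0 \<and> (\<exists>x. E \<subseteq> cube x r))"

definition dyadic_cube :: "nat \<Rightarrow> (int \<times> int) set" where
  "dyadic_cube k = centred_cube (0, 0) (2 ^ k)"

text \<open>The shells are indexed by \<open>k \<ge> 1\<close>; the value at \<open>k = 0\<close> is irrelevant.\<close>

definition shell :: "nat \<Rightarrow> (int \<times> int) set" where
  "shell k = (if k = 1 then dyadic_cube 1 else dyadic_cube k - dyadic_cube (k - 1))"

text \<open>Covers may be taken finite and without repetitions, as \<open>A \<inter> F\<close> is finite and every cube
  contributes at least \<open>cube_diam F powr (- \<alpha>)\<close> to the sum. For the same reason only finitely many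
  values lie below any given bound, so the infimum is a minimum.\<close>

definition nu :: "real \<Rightarrow> (int \<times> int) set \<Rightarrow> (int \<times> int) set \<Rightarrow> real" where
  "nu \<alpha> A F =
     Inf {(\<Sum>U\<in>\<U>. (real (cube_diam U) / real (cube_diam F)) powr \<alpha>) | \<U>.
          finite \<U> \<and> \<U> \<subseteq> cubes \<and> A \<inter> F \<subseteq> \<Union>\<U>}"

definition discrete_hausdorff_dim :: "(int \<times> int) set \<Rightarrow> ereal" where
  "discrete_hausdorff_dim A =
     Inf (ereal ` {\<alpha>. \<alpha> > 0 \<and> summable (\<lambda>k. nu \<alpha> A (shell (Suc k)))})"

definition lower_discrete_hausdorff_dim :: "(int \<times> int) set \<Rightarrow> ereal" where
  "lower_discrete_hausdorff_dim A =
     Inf (ereal ` {\<alpha>. \<alpha> > 0 \<and> (\<lambda>k. nu \<alpha> A (shell k)) \<longlonglongrightarrow> 0})"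

section \<open>Covering and packing numbers\<close>

text \<open>Squares are closed squares in the plane: \<open>box_around w (r / 2)\<close> has centre \<open>w\<close> and side
  length \<open>r\<close>. Both numbers are meant for bounded (hence finite) sets and \<open>r \<ge> 1\<close>.\<close>

definition covering_number :: "real \<Rightarrow> (int \<times> int) set \<Rightarrow> nat" where
  "covering_number r A =
     (LEAST N. \<exists>W :: (real \<times> real) set. finite W \<and> card W = N \<and>
        real_pt ` A \<subseteq> (\<Union>w\<in>W. box_around w (r / 2)))"

definition packing_number :: "real \<Rightarrow> (int \<times> int) set \<Rightarrow> nat" where
  "packing_number r A =
     Max {card X | X. X \<subseteq> A \<and> disjoint_family_on (\<lambda>x. box_around (real_pt x) (r / 2)) X}"

text \<open>Scales \<open>r\<close> are real, so maxima and minima over \<open>r\<close> become suprema and infima.\<close>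

definition discrete_packing_dim :: "(int \<times> int) set \<Rightarrow> ereal" where
  "discrete_packing_dim A =
     Inf (ereal ` {\<alpha>. \<alpha> \<ge> 0 \<and> (\<forall>\<epsilon>\<in>{0<..<1}.
       (\<lambda>k::nat. SUP r\<in>{1 .. 2 powr (real k * (1 - \<epsilon>))}.
          (r / 2 ^ k) powr \<alpha> * real (packing_number r (A \<inter> shell k))) \<longlonglongrightarrow> 0)})"

definition lower_entropy_index :: "(int \<times> int) set \<Rightarrow> ereal" where
  "lower_entropy_index A =
     Inf (ereal ` {\<alpha>. \<alpha> \<ge> 0 \<and> (\<exists>\<epsilon>\<in>{0<..<1}.
       (\<lambda>k::nat. INF r\<in>{1 .. 2 powr (real k * (1 - \<epsilon>))}.
          (r / 2 ^ k) powr \<alpha> * real (packing_number r (A \<inter> shell k))) \<longlonglongrightarrow> 0)})"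

definition assouad_dim :: "(int \<times> int) set \<Rightarrow> ereal" where
  "assouad_dim A =
     Inf (ereal ` {\<alpha>. \<alpha> \<ge> 0 \<and> (\<exists>C>0. \<forall>x\<in>A. \<forall>r R :: real. 1 \<le> r \<and> r < R \<longrightarrow>
       real (covering_number r {y \<in> A. real_pt y \<in> ball (real_pt x) R}) \<le> C * (R / r) powr \<alpha>)})"

end

theory Submission
  imports Defs "HOL-Real_Asymp.Real_Asymp"
begin

text \<open>Write \<open>T (x, y) = (x div m, y div n)\<close>. A point lies on level \<open>k\<close> of the orbit of \<open>z\<close> iff its \<open>k\<close>-th
  \<open>T\<close>-iterate is \<open>z\<close> and its first \<open>k\<close> pairs of digits belong to \<open>\<Lambda>\<close>. All quantities are estimated by
  counting cells \<open>(x div m^a, y div n^b)\<close> with \<open>m^a \<approx> n^b \<approx> r\<close> inside a box of side \<open>R \<approx> m^K \<approx> n^L\<close>.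
  Since \<open>a \<le> b\<close>, a cell sees only the first digit at the positions in \<open>[a, b)\<close> and both digits from
  \<open>b\<close> on, while at the positions in \<open>[K, L)\<close> the box prescribes the first digit. Far from the origin
  that digit may select the fullest column, near the origin it is the fixed digit of \<open>u\<close>, whence
  the roles of \<open>N\<^sub>m\<^sub>a\<^sub>x\<close> and \<open>\<eta>(u)\<close>. The logarithm of the number of cells is, up to \<open>O(1)\<close>, a combination
  with nonnegative coefficients of two exponents, attained at \<open>r = 1\<close> and at \<open>n^K \<approx> r\<close>; this gives
  the minimum and the maximum in the packing statements.

  For the discrete Hausdorff dimension put \<open>M\<^sub>i = N\<^sub>i / \<eta>(u)\<close> and \<open>Z(t) = \<Sum>\<^sub>i M\<^sub>i powr t\<close>. Any \<open>t\<close> in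
  \<open>[0, 1]\<close> gives an upper bound, as in McMullen's argument: every point lies in a cell, of one of
  boundedly many scales, whose mass under the product measure with column weights \<open>M\<^sub>i powr t / Z(t)\<close>
  is large. For the lower bound \<open>t\<close> is a minimizer of \<open>Z\<close>; the sign of \<open>Z'(t)\<close> and a Chernoff bound
  show that the same measure is small on the cells of typical points, at all scales at once.\<close>


section \<open>Expansions in a fixed base\<close>

text \<open>Three obstacles shape the details. The orbit is a union over infinitely many levels;
  near the origin this costs a factor logarithmic in R, but the Assouad dimension asks for a bound
  in R / r alone, so levels below the cell scale must be grouped by the cell in which they end up.

  Secondly, the points given by all words of one length fill a range of sizes that a power of 2,
  hence a shell boundary, may cut. The lower bounds for the shells therefore start from a descendant
  of z, chosen anew for each length, whose words stay in one shell. The construction uses two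
  elements of \<Lambda> and reaches infinitely many shells, which is enough to refute convergence to
  0; for a single digit pair the exponents in question vanish.

  Thirdly, which coordinate decides the shell depends on \<open>eta\<close>. If it is 1, the words
  stop at L = K and the second coordinate, of size n^K, is negligible. Otherwise u is 0 or -1, the
  first digits beyond K repeat u, and the length L is dictated by the second coordinate.\<close>

definition dig :: "nat \<Rightarrow> nat \<Rightarrow> int \<Rightarrow> nat" where
  "dig b l x = nat (x div int b ^ l mod int b)"

definition expand :: "nat \<Rightarrow> nat \<Rightarrow> int \<Rightarrow> (nat \<Rightarrow> nat) \<Rightarrow> int" where
  "expand b k u f = int b ^ k * u + (\<Sum>l<k. int (f l) * int b ^ l)"

lemma dig_less: "0 < b \<Longrightarrow> dig b l x < b"
  by (simp add: dig_def nat_less_iff)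

lemma int_dig: "0 < b \<Longrightarrow> int (dig b l x) = x div int b ^ l mod int b"
  by (simp add: dig_def)

lemma div_power_add: "(x::int) div int b ^ (i + j) = x div int b ^ i div int b ^ j"
  by (simp add: power_add zdiv_zmult2_eq)

lemma dig_div_power: "dig b l (x div int b ^ i) = dig b (i + l) x"
  by (simp add: dig_def div_power_add)

lemma div_power_Suc_dig:
  "0 < b \<Longrightarrow> x div int b ^ l = int b * (x div int b ^ Suc l) + int (dig b l x)"
  using div_power_add[of x b l 1] by (simp add: int_dig mult.commute)

lemma div_eq_if_dig_eq:
  assumes "0 < b" "a \<le> c" "x div int b ^ c = y div int b ^ c"
    "\<And>l. a \<le> l \<Longrightarrow> l < c \<Longrightarrow> dig b l x = dig b l y"
  shows "x div int b ^ a = y div int b ^ a"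
  using assms(2,3,4)
proof (induction rule: inc_induct)
  case base
  then show ?case by simp
next
  case (step l)
  then have "x div int b ^ Suc l = y div int b ^ Suc l" "dig b l x = dig b l y" by auto
  then show ?case using div_power_Suc_dig[OF assms(1)] by metis
qed

lemma dig_eq_if_div_eq:
  assumes "x div int b ^ a = y div int b ^ a" "a \<le> l"
  shows "dig b l x = dig b l y"
  using dig_div_power[of b "l - a" x a] dig_div_power[of b "l - a" y a] assms by simp

lemma expand_0 [simp]: "expand b 0 u f = u"
  by (simp add: expand_def)

lemma expand_Suc: "expand b (Suc k) u f = expand b k (int b * u + int (f k)) f"
  by (simp add: expand_def algebra_simps)

lemma expand_div:
  assumes "\<And>l. l < k \<Longrightarrow> f l < b"
  shows "expand b k u f div int b ^ k = u"
  using assms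
proof (induction k arbitrary: u)
  case (Suc k)
  then have "expand b (Suc k) u f div int b ^ k = int b * u + int (f k)"
    by (simp add: expand_Suc)
  moreover have "(int b * u + int (f k)) div int b = u"
    using Suc.prems[of k] by auto
  ultimately show ?case
    using div_power_add[of _ b k 1] by simp
qed simp

lemma expand_dig:
  assumes "\<And>l. l < k \<Longrightarrow> f l < b" "l < k"
  shows "dig b l (expand b k u f) = f l"
  using assms
proof (induction k arbitrary: u)
  case (Suc k)
  show ?case
  proof (cases "l = k")
    case True
    have "dig b k (expand b (Suc k) u f) = dig b 0 (int b * u + int (f k))"
      using expand_div[of k f b] Suc.prems dig_div_power[of b 0 _ k]
      by (metis add.right_neutral expand_Suc less_Suc_eq)
    then show ?thesis using Suc.prems(1)[of k] True by (simp add: dig_def)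
  next
    case False
    then show ?thesis using Suc by (simp add: expand_Suc)
  qed
qed simp

lemma expand_dig_self: "0 < b \<Longrightarrow> expand b k (x div int b ^ k) (\<lambda>l. dig b l x) = x"
proof (induction k)
  case (Suc k)
  then show ?case using div_power_Suc_dig[of b x k] by (simp add: expand_Suc)
qed simp

lemma expand_cong: "(\<And>l. l < k \<Longrightarrow> f l = g l) \<Longrightarrow> expand b k u f = expand b k u g"
  by (simp add: expand_def)

text \<open>Floor division fixes 0 and, by rounding down, also -1. Hence the digits of every integer
  are eventually 0 or eventually \<open>b - 1\<close>, and these two fixed points are the
  exceptional values of \<open>u\<close> in \<open>eta\<close>.\<close>

lemma div_power_stable:
  assumes "0 < b" "(x::int) div int b ^ i \<in> {-1, 0}"
  shows "x div int b ^ (i + j) = x div int b ^ i"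
proof -
  have *: "(- 1::int) div int b ^ j = -1"
    using assms(1) by (intro div_eq_minus1) simp
  show ?thesis
    using assms(2) by (auto simp: div_power_add *)
qed

text \<open>The distance to the pair \<open>-1, 0\<close> commutes with division, which makes the dyadic shells
  symmetric under \<open>x \<mapsto> -1 - x\<close>.\<close>

definition nrm :: "int \<Rightarrow> int" where "nrm x = max x (- x - 1)"

lemma nrm_nonneg [simp]: "0 \<le> nrm x"
  by (simp add: nrm_def)

lemma nrm_eq_0_iff: "nrm x = 0 \<longleftrightarrow> x \<in> {-1, 0}"
  by (auto simp: nrm_def)

text \<open>The reflection x -> -1 - x turns the residue s into b - 1 - s and so commutes with floor
  division. This leaves the nonnegative half, where \<open>nrm\<close> is the identity.\<close>

lemma nrm_div:
  assumes "0 < (b::int)"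
  shows "nrm (x div b) = nrm x div b"
proof (cases "0 \<le> x")
  case True
  then have "0 \<le> x div b" using assms by (simp add: pos_imp_zdiv_nonneg_iff)
  then show ?thesis using True by (simp add: nrm_def max_def)
next
  case False
  have "(- x - 1) div b = - (x div b) - 1"
  proof -
    have "x = b * (x div b) + x mod b" by simp
    then have "- x - 1 = b * (- (x div b) - 1) + (b - 1 - x mod b)" by (simp add: algebra_simps)
    moreover have "0 \<le> b - 1 - x mod b" "b - 1 - x mod b < b"
      using pos_mod_bound[OF assms, of x] pos_mod_sign[OF assms, of x] by linarith+
    ultimately show ?thesis
      by (metis div_pos_pos_trivial add.commute add_0 assms div_mult_self2 less_irrefl)
  qed
  moreover have "x div b < 0" using False assms by (simp add: pos_imp_zdiv_neg_iff)
  ultimately show ?thesis using False by (simp add: nrm_def max_def)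
qed

lemma nrm_less_iff: "nrm x < c \<longleftrightarrow> - c \<le> x \<and> x < c"
  by (auto simp: nrm_def)

lemma nrm_div_eq_0_iff: "0 < (b::int) \<Longrightarrow> x div b \<in> {-1, 0} \<longleftrightarrow> nrm x < b"
  using nrm_div[of b x] nrm_eq_0_iff[of "x div b"]
  by (metis nrm_nonneg div_pos_pos_trivial int_div_less_self order_less_le zdiv_eq_0_iff not_less)

lemma div_bounds:
  assumes "0 < (B::int)" "x div B = c"
  shows "B * c \<le> x" "x < B * (c + 1)"
proof -
  have "x = B * c + x mod B" using assms(2) by auto
  moreover have "0 \<le> x mod B" "x mod B < B" using assms(1) by simp_all
  ultimately show "B * c \<le> x" "x < B * (c + 1)" by (auto simp: algebra_simps)
qed

text \<open>The cubes are half open, [-2^k, 2^k) in each coordinate, and \<open>nrm\<close>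
  describes them without boundary terms, unlike the absolute value. The side length 2^(k+1) accounts
  for the shift of the index.\<close>

lemma mem_dyadic_cube_iff:
  "p \<in> dyadic_cube (Suc k) \<longleftrightarrow> nrm (fst p) < 2 ^ k \<and> nrm (snd p) < 2 ^ k"
proof -
  have *: "(- (2 ^ k) \<le> real_of_int z) = (- (2 ^ k) \<le> z)" "(real_of_int z < 2 ^ k) = (z < 2 ^ k)" for z
    using of_int_le_iff[of "- (2 ^ k)" z, where 'a = real]
      of_int_less_iff[of z "2 ^ k", where 'a = real] by simp_all
  show ?thesis
    by (auto simp: dyadic_cube_def centred_cube_def nrm_less_iff *)
qed

lemma mem_shell_iff:
  "p \<in> shell (Suc (Suc k)) \<longleftrightarrow> nrm (fst p) < 2 ^ Suc k \<and> nrm (snd p) < 2 ^ Suc k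
     \<and> (2 ^ k \<le> nrm (fst p) \<or> 2 ^ k \<le> nrm (snd p))"
  unfolding shell_def using mem_dyadic_cube_iff[of p "Suc k"] mem_dyadic_cube_iff[of p k]
  by auto

lemma shell_subset_dyadic_cube: "shell k \<subseteq> dyadic_cube k"
  by (auto simp: shell_def)

section \<open>Digits of orbit points\<close>

locale carpet =
  fixes m n :: nat and \<Lambda> :: "(nat \<times> nat) set"
  assumes two_le_n: "2 \<le> n" and n_less_m: "n < m"
    and digits_subset: "\<Lambda> \<subseteq> {0..<m} \<times> {0..<n}" and digits_nonempty: "\<Lambda> \<noteq> {}"
begin

definition digits :: "int \<times> int \<Rightarrow> nat \<Rightarrow> nat \<times> nat" where
  "digits p l = (dig m l (fst p), dig n l (snd p))"

definition cell :: "nat \<Rightarrow> nat \<Rightarrow> int \<times> int \<Rightarrow> int \<times> int" where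
  "cell a b p = (fst p div int m ^ a, snd p div int n ^ b)"

abbreviation level :: "int \<times> int \<Rightarrow> nat \<Rightarrow> (int \<times> int) set" where
  "level \<equiv> level_set m n \<Lambda>"

abbreviation orbit :: "int \<times> int \<Rightarrow> (int \<times> int) set" where
  "orbit \<equiv> pos_orbit m n \<Lambda>"

abbreviation cols :: "nat set" where "cols \<equiv> nonempty_cols m \<Lambda>"

abbreviation column :: "nat \<Rightarrow> (nat \<times> nat) set" where "column i \<equiv> {c \<in> \<Lambda>. fst c = i}"

lemma m_pos: "0 < m" and n_pos: "0 < n" and two_le_m: "2 \<le> m"
  using two_le_n n_less_m by auto

lemma finite_digits: "finite \<Lambda>"
  using digits_subset finite_subset by fastforce

lemma digits_less: "(i, j) \<in> \<Lambda> \<Longrightarrow> i < m" "(i, j) \<in> \<Lambda> \<Longrightarrow> j < n"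
  "c \<in> \<Lambda> \<Longrightarrow> fst c < m" "c \<in> \<Lambda> \<Longrightarrow> snd c < n"
  using digits_subset by auto

lemma finite_column: "finite {j. (i, j) \<in> \<Lambda>}"
  by (rule finite_subset[of _ "snd ` \<Lambda>"]) (force simp: finite_digits)+

lemma col_count_pos_iff: "0 < col_count \<Lambda> i \<longleftrightarrow> (\<exists>j. (i, j) \<in> \<Lambda>)"
  using finite_column by (auto simp: col_count_def card_gt_0_iff)

lemma cols_eq: "cols = fst ` \<Lambda>"
  by (force simp: nonempty_cols_def col_count_pos_iff dest: digits_less)

lemma finite_cols: "finite cols"
  by (simp add: cols_eq finite_digits)

lemma column_eq: "column i = Pair i ` {j. (i, j) \<in> \<Lambda>}"
  by auto

lemma card_column: "card (column i) = col_count \<Lambda> i"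
  unfolding column_eq col_count_def by (simp add: card_image inj_on_def)

lemma sum_digits_by_column:
  "(\<Sum>c\<in>\<Lambda>. f (fst c)) = (\<Sum>i\<in>cols. real (col_count \<Lambda> i) * f i)"
proof -
  have "(\<Sum>c\<in>\<Lambda>. f (fst c)) = (\<Sum>i\<in>cols. \<Sum>c\<in>column i. f (fst c))"
    unfolding cols_eq by (rule sum.image_gen[OF finite_digits])
  also have "\<dots> = (\<Sum>i\<in>cols. real (card (column i)) * f i)"
    by (intro sum.cong refl) simp
  finally show ?thesis by (simp only: card_column)
qed

lemma level_iff: "p \<in> level z k \<longleftrightarrow> cell k k p = z \<and> (\<forall>l<k. digits p l \<in> \<Lambda>)"
proof
  assume "p \<in> level z k"
  then obtain d where d: "\<forall>l<k. d l \<in> \<Lambda>"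
    and p: "p = (expand m k (fst z) (\<lambda>l. fst (d l)), expand n k (snd z) (\<lambda>l. snd (d l)))"
    by (auto simp: level_set_def expand_def)
  have "fst (d l) < m" "snd (d l) < n" if "l < k" for l
    using d that digits_less by blast+
  then show "cell k k p = z \<and> (\<forall>l<k. digits p l \<in> \<Lambda>)"
    using d by (simp add: cell_def digits_def p expand_div expand_dig)
next
  assume *: "cell k k p = z \<and> (\<forall>l<k. digits p l \<in> \<Lambda>)"
  then have "p = (expand m k (fst z) (\<lambda>l. fst (digits p l)), expand n k (snd z) (\<lambda>l. snd (digits p l)))"
    using expand_dig_self[OF m_pos, of k "fst p"] expand_dig_self[OF n_pos, of k "snd p"]
    by (auto simp: cell_def digits_def)
  then show "p \<in> level z k"
    using * unfolding level_set_def expand_def by blast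
qed

lemma mem_orbit_iff: "p \<in> orbit z \<longleftrightarrow> (\<exists>k\<ge>1. p \<in> level z k)"
  by (auto simp: pos_orbit_def)

lemma cell_add: "cell (a + i) (b + j) p = cell i j (cell a b p)"
  by (simp add: cell_def div_power_add)

lemma digits_cell: "digits (cell i i p) l = digits p (i + l)"
  by (simp add: digits_def cell_def dig_div_power)

text \<open>Concatenation of digit words. It permits replacing the starting point by one of its
  descendants, which is how words are later moved into a single shell.\<close>

lemma level_trans:
  assumes "p \<in> level q k" "q \<in> level z j"
  shows "p \<in> level z (k + j)"
  unfolding level_iff
proof (intro conjI allI impI)
  show "cell (k + j) (k + j) p = z" using assms by (simp add: level_iff cell_add)
next
  fix l assume l: "l < k + j"
  show "digits p l \<in> \<Lambda>"
  proof (cases "l < k")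
    case False
    then have "digits p l = digits q (l - k)"
      using assms(1) digits_cell[of k p "l - k"] by (auto simp: level_iff)
    then show ?thesis using assms(2) l False by (simp add: level_iff)
  qed (use assms(1) in \<open>simp add: level_iff\<close>)
qed

lemma eta_eq_1: "u \<notin> {-1, 0} \<Longrightarrow> eta m \<Lambda> u = 1"
  by (auto simp: eta_def)

text \<open>The digits of 0 are all 0 and those of -1 all m - 1. So \<open>eta\<close> counts the
  second digits that go with the recurring first digit of \<open>u\<close>; the maximum with 1
  covers an empty column.\<close>

lemma eta_fixed: "u \<in> {-1, 0} \<Longrightarrow> eta m \<Lambda> u = max 1 (col_count \<Lambda> (dig m l u))"
proof -
  have "(- 1::int) div int m ^ l = -1"
    using m_pos by (intro div_eq_minus1) simp
  moreover have "(- 1::int) mod int m = int m - 1"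
    using two_le_m by (simp add: zmod_minus1)
  ultimately show "u \<in> {-1, 0} \<Longrightarrow> eta m \<Lambda> u = max 1 (col_count \<Lambda> (dig m l u))"
    using two_le_m by (auto simp: eta_def dig_def nat_diff_distrib)
qed

lemma eta_ge_1: "1 \<le> eta m \<Lambda> u"
  by (simp add: eta_def)

end

section \<open>Counting cells\<close>

lemma card_image_le_if_determined:
  assumes "finite (f ` S)" "\<And>p q. p \<in> S \<Longrightarrow> q \<in> S \<Longrightarrow> f p = f q \<Longrightarrow> g p = g q"
  shows "finite (g ` S)" "card (g ` S) \<le> card (f ` S)"
proof -
  have "g p = (g \<circ> inv_into S f) (f p)" if "p \<in> S" for p
    using that assms(2)[of p "inv_into S f (f p)"]
    by (simp add: f_inv_into_f inv_into_into)
  then have *: "g ` S = (g \<circ> inv_into S f) ` (f ` S)"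
    unfolding image_image by (intro image_cong) auto
  show "finite (g ` S)" "card (g ` S) \<le> card (f ` S)"
    unfolding * using assms(1) card_image_le by blast+
qed

lemma card_image_UN_le:
  assumes "finite I" "S \<subseteq> (\<Union>i\<in>I. T i)" "\<And>i. i \<in> I \<Longrightarrow> finite (f ` T i)"
    "\<And>i. i \<in> I \<Longrightarrow> real (card (f ` T i)) \<le> B"
  shows "finite (f ` S)" "real (card (f ` S)) \<le> real (card I) * B"
proof -
  have sub: "f ` S \<subseteq> (\<Union>i\<in>I. f ` T i)" using assms(2) by blast
  have fin: "finite (\<Union>i\<in>I. f ` T i)" using assms(1,3) by blast
  show "finite (f ` S)" using finite_subset[OF sub fin] .
  have "card (f ` S) \<le> (\<Sum>i\<in>I. card (f ` T i))"
    using card_mono[OF fin sub] card_UN_le[OF assms(1), of "\<lambda>i. f ` T i"] by linarith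
  then have "real (card (f ` S)) \<le> (\<Sum>i\<in>I. real (card (f ` T i)))"
    unfolding of_nat_sum[symmetric] of_nat_le_iff .
  also have "\<dots> \<le> (\<Sum>i\<in>I. B)" by (intro sum_mono assms(4))
  finally show "real (card (f ` S)) \<le> real (card I) * B" by simp
qed

text \<open>The number of cells at scale \<open>(a, b)\<close> in a cell at scale \<open>(K, L)\<close>: there are \<open>A\<close> choices at
  the positions where only the first digit is seen, \<open>B\<close> where both digits are seen, and \<open>H\<close> where
  the first digit is prescribed and the second one is seen.\<close>

definition cprod :: "real \<Rightarrow> real \<Rightarrow> real \<Rightarrow> nat \<Rightarrow> nat \<Rightarrow> nat \<Rightarrow> nat \<Rightarrow> real" where
  "cprod A B H a b K L = A ^ (min b K - a) * B ^ (K - b) * H ^ (L - max b K)"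

lemma cprod_ge_1: "1 \<le> A \<Longrightarrow> 1 \<le> B \<Longrightarrow> 1 \<le> H \<Longrightarrow> 1 \<le> cprod A B H a b K L"
  unfolding cprod_def by (simp add: one_le_power mult_ge1_I)

text \<open>\<open>cprod\<close> split into single positions, so that sums over digit words, which
  factorise over positions, can be compared with it.\<close>

definition cfactor :: "real \<Rightarrow> real \<Rightarrow> real \<Rightarrow> nat \<Rightarrow> nat \<Rightarrow> nat \<Rightarrow> nat \<Rightarrow> real" where
  "cfactor A B H a b K l =
     (if l < K then if l < a then 1 else if l < b then A else B else if l < b then 1 else H)"

lemma prod_if_mem:
  assumes "finite I" "J \<subseteq> I"
  shows "(\<Prod>l\<in>I. if l \<in> J then c else (1::real)) = c ^ card J"
proof -
  have "(\<Prod>l\<in>I. if l \<in> J then c else (1::real)) = (\<Prod>l\<in>J. c)"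
    by (rule prod.mono_neutral_cong_right[OF assms]) auto
  then show ?thesis by simp
qed

lemma prod_cfactor:
  assumes "a \<le> b" "K \<le> L"
  shows "(\<Prod>l<L. cfactor A B H a b K l) = cprod A B H a b K L"
proof -
  have "(\<Prod>l<L. cfactor A B H a b K l) =
      (\<Prod>l<L. (if l \<in> {a..<min b K} then A else 1) * (if l \<in> {b..<K} then B else 1)
        * (if l \<in> {max b K..<L} then H else 1))"
    using assms by (intro prod.cong refl) (auto simp: cfactor_def)
  also have "\<dots> = cprod A B H a b K L"
    unfolding prod.distrib cprod_def
    using assms prod_if_mem[of "{..<L}" "{a..<min b K}" A] prod_if_mem[of "{..<L}" "{b..<K}" B]
      prod_if_mem[of "{..<L}" "{max b K..<L}" H]
    by (simp add: subset_iff)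
  finally show ?thesis .
qed

text \<open>A point of level \<open>k < L\<close> has fewer free positions; as every factor is at
  least 1, the count for \<open>L\<close> serves all levels at once.\<close>

lemma prod_cfactor_le:
  assumes "a \<le> b" "K \<le> L" "k \<le> L" "1 \<le> A" "1 \<le> B" "1 \<le> H"
  shows "(\<Prod>l<k. cfactor A B H a b K l) \<le> cprod A B H a b K L"
proof -
  have "(\<Prod>l<k. cfactor A B H a b K l) \<le> (\<Prod>l<L. cfactor A B H a b K l)"
    using assms by (intro prod_mono2) (auto simp: cfactor_def)
  then show ?thesis using prod_cfactor assms by simp
qed

context carpet
begin

text \<open>The entries of the code of \<open>p\<close> that are not determined by its cell at scale \<open>(a, b)\<close> are
  erased. At positions \<open>l \<ge> K\<close> the first digits are considered as known.\<close>

definition code :: "nat \<Rightarrow> nat \<Rightarrow> nat \<Rightarrow> int \<times> int \<Rightarrow> nat \<Rightarrow> nat \<times> nat" where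
  "code a b K p l =
     (if l < K then if l < a then (0, 0) else if l < b then (dig m l (fst p), 0) else digits p l
      else if l < b then (0, 0) else (0, dig n l (snd p)))"

text \<open>\<open>f\<close> supplies the first digits that the outer cell prescribes at the
  positions from \<open>K\<close> on.\<close>

definition code_set :: "nat \<Rightarrow> nat \<Rightarrow> nat \<Rightarrow> (nat \<Rightarrow> nat) \<Rightarrow> nat \<Rightarrow> (nat \<times> nat) set" where
  "code_set a b K f l =
     (if l < K then if l < a then {(0, 0)} else if l < b then (\<lambda>i. (i, 0)) ` cols else \<Lambda>
      else if l < b then {(0, 0)} else Pair 0 ` {j. (f l, j) \<in> \<Lambda>})"

lemma finite_code_set: "finite (code_set a b K f l)"
  by (simp add: code_set_def finite_cols finite_digits finite_column)

lemma code_mem_code_set: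
  assumes "digits p l \<in> \<Lambda>" "K \<le> l \<Longrightarrow> f l = dig m l (fst p)"
  shows "code a b K p l \<in> code_set a b K f l"
  using assms by (force simp: code_def code_set_def digits_def cols_eq)

text \<open>The code restores the first digits at [a, min K k) and the second digits at [b, k). What
  remains is that the quotients just above these ranges agree; the maxima take care of levels
  \<open>k\<close> below the cell scale, where a range is empty.\<close>

lemma cell_eq_if_code_eq:
  assumes ab: "a \<le> b" "a \<le> K"
    and X: "fst p div int m ^ max a (min K k) = fst q div int m ^ max a (min K k)"
    and Y: "snd p div int n ^ max b k = snd q div int n ^ max b k"
    and eq: "\<And>l. l < k \<Longrightarrow> code a b K p l = code a b K q l"
  shows "cell a b p = cell a b q"
proof -
  have "dig m l (fst p) = dig m l (fst q)" if "a \<le> l" "l < max a (min K k)" for l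
  proof -
    have "l < K" "l < k" using that by auto
    then show ?thesis using eq[of l] that by (simp add: code_def digits_def split: if_splits)
  qed
  then have "fst p div int m ^ a = fst q div int m ^ a"
    using div_eq_if_dig_eq[OF m_pos _ X] by simp
  moreover have "dig n l (snd p) = dig n l (snd q)" if "b \<le> l" "l < max b k" for l
  proof -
    have "l < k" "b \<le> l" using that by auto
    then show ?thesis using eq[of l] ab by (auto simp: code_def digits_def split: if_splits)
  qed
  then have "snd p div int n ^ b = snd q div int n ^ b"
    using div_eq_if_dig_eq[OF n_pos _ Y] by simp
  ultimately show ?thesis by (simp add: cell_def)
qed

lemma code_eq_if_cell_eq:
  assumes "a \<le> b" "cell a b p = cell a b q"
  shows "code a b K p l = code a b K q l"
proof -
  have "dig m l (fst p) = dig m l (fst q)" if "a \<le> l" for l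
    using assms that dig_eq_if_div_eq[of "fst p" m a] by (simp add: cell_def)
  moreover have "dig n l (snd p) = dig n l (snd q)" if "b \<le> l" for l
    using assms that dig_eq_if_div_eq[of "snd p" n b] by (simp add: cell_def)
  ultimately show ?thesis using assms(1) by (simp add: code_def digits_def)
qed

text \<open>A Markov inequality. The code determines the cell, the total weight of all codes
  factorises over the positions, and every code of a point of \<open>S\<close> weighs at least
  \<theta>. Unit weights give plain counting; other weights single out the cells of large mass for
  the Hausdorff upper bound.\<close>

lemma weighted_count:
  assumes ab: "a \<le> b" "a \<le> K"
    and dS: "\<And>p l. p \<in> S \<Longrightarrow> l < k \<Longrightarrow> digits p l \<in> \<Lambda>"
    and X: "\<And>p. p \<in> S \<Longrightarrow> fst p div int m ^ max a (min K k) = X"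
    and Y: "\<And>p. p \<in> S \<Longrightarrow> snd p div int n ^ max b k = Y"
    and w: "\<And>l c. 0 \<le> (w l c :: real)" and \<theta>: "0 \<le> \<theta>"
    and wS: "\<And>p. p \<in> S \<Longrightarrow> \<theta> \<le> (\<Prod>l<k. w l (code a b K p l))"
  shows "finite (cell a b ` S)"
    "\<theta> * card (cell a b ` S) \<le> (\<Prod>l<k. \<Sum>c\<in>code_set a b K (\<lambda>l. dig m (l - K) X) l. w l c)"
proof -
  let ?F = "\<lambda>p. restrict (code a b K p) {..<k}"
  let ?P = "PiE {..<k} (code_set a b K (\<lambda>l. dig m (l - K) X))"
  have "code a b K p l \<in> code_set a b K (\<lambda>l. dig m (l - K) X) l" if "p \<in> S" "l < k" for p l
  proof (rule code_mem_code_set)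
    assume "K \<le> l"
    then have "max a (min K k) = K" using that(2) ab by linarith
    then have "X = fst p div int m ^ K" using X[OF that(1)] by simp
    then show "dig m (l - K) X = dig m l (fst p)"
      using dig_div_power[of m "l - K" "fst p" K] \<open>K \<le> l\<close> by simp
  qed (rule dS[OF that])
  then have sub: "?F ` S \<subseteq> ?P" by (intro image_subsetI) (simp add: restrict_PiE_iff)
  have finP: "finite ?P" by (intro finite_PiE) (auto simp: finite_code_set)
  have finF: "finite (?F ` S)" using finite_subset[OF sub finP] .
  have det: "cell a b p = cell a b q" if "p \<in> S" "q \<in> S" "?F p = ?F q" for p q
  proof (rule cell_eq_if_code_eq[OF ab])
    show "fst p div int m ^ max a (min K k) = fst q div int m ^ max a (min K k)"
      by (simp only: X[OF that(1)] X[OF that(2)])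
    show "snd p div int n ^ max b k = snd q div int n ^ max b k"
      by (simp only: Y[OF that(1)] Y[OF that(2)])
    show "code a b K p l = code a b K q l" if "l < k" for l
      using fun_cong[OF \<open>?F p = ?F q\<close>, of l] that by simp
  qed
  note det' = card_image_le_if_determined[of ?F S "cell a b", OF finF det]
  show "finite (cell a b ` S)" by (rule det'(1))
  have "\<theta> * card (cell a b ` S) \<le> \<theta> * card (?F ` S)"
    by (intro mult_left_mono of_nat_mono det'(2) \<theta>)
  also have "\<dots> = (\<Sum>f\<in>?F ` S. \<theta>)" by simp
  also have "\<dots> \<le> (\<Sum>f\<in>?F ` S. \<Prod>l<k. w l (f l))"
  proof (rule sum_mono)
    fix f assume "f \<in> ?F ` S"
    then obtain p where p: "p \<in> S" "f = ?F p" by blast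
    have "(\<Prod>l<k. w l (f l)) = (\<Prod>l<k. w l (code a b K p l))"
      unfolding p(2) by (rule prod.cong) auto
    then show "\<theta> \<le> (\<Prod>l<k. w l (f l))" using wS[OF p(1)] by simp
  qed
  also have "\<dots> \<le> (\<Sum>f\<in>?P. \<Prod>l<k. w l (f l))"
    by (rule sum_mono2[OF finP sub]) (simp add: prod_nonneg w)
  also have "\<dots> = (\<Prod>l<k. \<Sum>c\<in>code_set a b K (\<lambda>l. dig m (l - K) X) l. w l c)"
    by (subst prod_sum_PiE) (auto simp: finite_code_set)
  finally show "\<theta> * card (cell a b ` S) \<le>
      (\<Prod>l<k. \<Sum>c\<in>code_set a b K (\<lambda>l. dig m (l - K) X) l. w l c)" .
qed

text \<open>A digit weighs \<open>\<phi>\<close> at the positions where only its first entry is seen, and \<open>\<psi>\<close> where both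
  entries are seen.\<close>

definition colw :: "(nat \<Rightarrow> real) \<Rightarrow> (nat \<Rightarrow> real) \<Rightarrow> nat \<Rightarrow> nat \<Rightarrow> nat \<Rightarrow> nat \<Rightarrow> nat \<times> nat \<Rightarrow> real" where
  "colw \<phi> \<psi> a b K l c = (if l < K \<and> a \<le> l then if l < b then \<phi> (fst c) else \<psi> (fst c) else 1)"

lemma sum_colw:
  assumes "K \<le> l \<Longrightarrow> b \<le> l \<Longrightarrow> f l = i"
  shows "(\<Sum>c\<in>code_set a b K f l. colw \<phi> \<psi> a b K l c) =
    cfactor (\<Sum>i\<in>cols. \<phi> i) (\<Sum>c\<in>\<Lambda>. \<psi> (fst c)) (col_count \<Lambda> i) a b K l"
proof -
  have "(\<Sum>c\<in>(\<lambda>i. (i, 0::nat)) ` cols. \<phi> (fst c)) = (\<Sum>i\<in>cols. \<phi> i)"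
    by (subst sum.reindex) (auto simp: inj_on_def)
  moreover have "card (Pair (0::nat) ` {j. (i, j) \<in> \<Lambda>}) = col_count \<Lambda> i" for i
    unfolding col_count_def by (rule card_image) (simp add: inj_on_def)
  ultimately show ?thesis
    using assms by (auto simp: code_set_def colw_def cfactor_def)
qed

text \<open>Only upper bounds \<open>A\<close>, \<open>B\<close>, \<open>H\<close> for the sums at
  the three kinds of positions enter, so that one statement covers unit and column weights, near the
  origin and elsewhere.\<close>

lemma weighted_cell_count:
  assumes "a \<le> b" "a \<le> K" "K \<le> L" "k \<le> L"
    and "\<And>p l. p \<in> S \<Longrightarrow> l < k \<Longrightarrow> digits p l \<in> \<Lambda>"
    and X: "\<And>p. p \<in> S \<Longrightarrow> fst p div int m ^ max a (min K k) = X"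
    and "\<And>p. p \<in> S \<Longrightarrow> snd p div int n ^ max b k = Y"
    and \<phi>: "\<And>i. 0 \<le> \<phi> i" "\<And>i. 0 \<le> \<psi> i" and "0 \<le> \<theta>"
    and "\<And>p. p \<in> S \<Longrightarrow> \<theta> \<le> (\<Prod>l<k. colw \<phi> \<psi> a b K l (code a b K p l))"
    and A: "(\<Sum>i\<in>cols. \<phi> i) \<le> A" "(\<Sum>c\<in>\<Lambda>. \<psi> (fst c)) \<le> B" "1 \<le> A" "1 \<le> B" "1 \<le> H"
    and H: "\<And>l. K \<le> l \<Longrightarrow> l < k \<Longrightarrow> real (col_count \<Lambda> (dig m (l - K) X)) \<le> H"
  shows "finite (cell a b ` S)" "\<theta> * card (cell a b ` S) \<le> cprod A B H a b K L"
proof -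
  note * = weighted_count[where w = "colw \<phi> \<psi> a b K", OF assms(1,2,5,6,7) _ assms(10,11)]
  show "finite (cell a b ` S)" by (rule *(1)) (auto simp: colw_def \<phi>)
  have "\<theta> * card (cell a b ` S) \<le> (\<Prod>l<k. \<Sum>c\<in>code_set a b K (\<lambda>l. dig m (l - K) X) l. colw \<phi> \<psi> a b K l c)"
    by (rule *(2)) (auto simp: colw_def \<phi>)
  also have "\<dots> \<le> (\<Prod>l<k. cfactor A B H a b K l)"
  proof (intro prod_mono conjI)
    fix l assume "l \<in> {..<k}"
    show "0 \<le> (\<Sum>c\<in>code_set a b K (\<lambda>l. dig m (l - K) X) l. colw \<phi> \<psi> a b K l c)"
      by (intro sum_nonneg) (auto simp: colw_def \<phi>)
    show "(\<Sum>c\<in>code_set a b K (\<lambda>l. dig m (l - K) X) l. colw \<phi> \<psi> a b K l c) \<le> cfactor A B H a b K l"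
      using A H \<open>l \<in> {..<k}\<close> by (subst sum_colw[OF refl]) (auto simp: cfactor_def)
  qed
  also have "\<dots> \<le> cprod A B H a b K L"
    using assms by (intro prod_cfactor_le) auto
  finally show "\<theta> * card (cell a b ` S) \<le> cprod A B H a b K L" .
qed

lemma num_cols_ge_1: "1 \<le> num_cols m \<Lambda>"
proof -
  have "0 < card cols" using digits_nonempty finite_cols by (simp add: card_gt_0_iff cols_eq)
  then show ?thesis by (simp add: num_cols_def)
qed

lemma card_digits_ge_1: "1 \<le> card \<Lambda>"
proof -
  have "0 < card \<Lambda>" using digits_nonempty finite_digits by (simp add: card_gt_0_iff)
  then show ?thesis by simp
qed

lemma cell_count:
  assumes "a \<le> b" "a \<le> K" "K \<le> L" "k \<le> L"
    and "\<And>p l. p \<in> S \<Longrightarrow> l < k \<Longrightarrow> digits p l \<in> \<Lambda>"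
    and "\<And>p. p \<in> S \<Longrightarrow> fst p div int m ^ max a (min K k) = X"
    and "\<And>p. p \<in> S \<Longrightarrow> snd p div int n ^ max b k = Y"
    and "1 \<le> H"
    and "\<And>l. K \<le> l \<Longrightarrow> l < k \<Longrightarrow> real (col_count \<Lambda> (dig m (l - K) X)) \<le> H"
  shows "finite (cell a b ` S)" "real (card (cell a b ` S)) \<le> cprod (num_cols m \<Lambda>) (card \<Lambda>) H a b K L"
proof -
  have w: "1 \<le> (\<Prod>l<k. colw (\<lambda>_. 1) (\<lambda>_. 1) a b K l (code a b K p l))" for p
    by (intro prod_ge_1) (simp add: colw_def)
  note * = weighted_cell_count[where \<phi> = "\<lambda>_. 1" and \<psi> = "\<lambda>_. 1" and \<theta> = 1 and A = "num_cols m \<Lambda>"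
      and B = "card \<Lambda>", OF assms(1-7) _ _ _ w _ _ _ _ assms(8,9)]
  show "finite (cell a b ` S)"
    by (rule *(1)) (use num_cols_ge_1 card_digits_ge_1 in \<open>simp_all add: num_cols_def\<close>)
  have "1 * real (card (cell a b ` S)) \<le> cprod (num_cols m \<Lambda>) (card \<Lambda>) H a b K L"
    by (rule *(2)) (use num_cols_ge_1 card_digits_ge_1 in \<open>simp_all add: num_cols_def\<close>)
  then show "real (card (cell a b ` S)) \<le> cprod (num_cols m \<Lambda>) (card \<Lambda>) H a b K L"
    by simp
qed

subsection \<open>The part of the orbit near the origin\<close>

text \<open>The levels \<open>k \<ge> L\<close> are treated together: within the box \<open>cell K L p \<in> {-1, 0}\<^sup>2\<close> the
  digits beyond position \<open>L\<close> carry no information.\<close>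

definition origin_piece :: "int \<times> int \<Rightarrow> nat \<Rightarrow> nat \<Rightarrow> nat \<Rightarrow> (int \<times> int) set" where
  "origin_piece z K L k =
     {p. cell K L p \<in> {-1, 0} \<times> {-1, 0} \<and> (\<exists>k'\<ge>k. (k < L \<longrightarrow> k' = k) \<and> p \<in> level z k')}"

lemma origin_cover:
  assumes "1 \<le> L"
  shows "{p \<in> orbit z. cell K L p \<in> {-1, 0} \<times> {-1, 0}} \<subseteq> (\<Union>k\<in>{1..L}. origin_piece z K L k)"
proof
  fix p assume *: "p \<in> {p \<in> orbit z. cell K L p \<in> {-1, 0} \<times> {-1, 0}}"
  then obtain k where "1 \<le> k" "p \<in> level z k" by (auto simp: mem_orbit_iff)
  have "p \<in> origin_piece z K L (min k L)"
    unfolding origin_piece_def using * \<open>p \<in> level z k\<close>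
    by (auto intro!: exI[of _ k] simp: min_def)
  moreover have "min k L \<in> {1..L}" using \<open>1 \<le> k\<close> assms by simp
  ultimately show "p \<in> (\<Union>k\<in>{1..L}. origin_piece z K L k)" by blast
qed

text \<open>A level below \<open>L\<close> is known exactly, so its quotients are those of
  \<open>z\<close>. From level \<open>L\<close> on, the quotients at \<open>K\<close> and
  \<open>L\<close> are fixed points and already equal the coordinates of \<open>z\<close>. A
  position in [K, k) exists only if the level exceeds \<open>K\<close>; then \<open>fst z\<close> is
  itself a fixed point and the prescribed digit is its recurring one, whence
  \<open>eta\<close>.\<close>

lemma origin_piece_base:
  assumes "a \<le> K" "K \<le> L" "b \<le> L" "k \<le> L"
  obtains X Y where "\<And>p. p \<in> origin_piece z K L k \<Longrightarrow> fst p div int m ^ max a (min K k) = X"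
    "\<And>p. p \<in> origin_piece z K L k \<Longrightarrow> snd p div int n ^ max b k = Y"
    "\<And>p l. p \<in> origin_piece z K L k \<Longrightarrow> K \<le> l \<Longrightarrow> l < k \<Longrightarrow>
       col_count \<Lambda> (dig m (l - K) X) \<le> eta m \<Lambda> (fst z)"
proof
  let ?X = "if k \<le> K then fst z div int m ^ (max a k - k) else fst z"
  let ?Y = "if k < L then snd z div int n ^ (max b k - k) else snd z"
  fix p assume "p \<in> origin_piece z K L k"
  then obtain k' where c: "cell K L p \<in> {-1, 0} \<times> {-1, 0}" and k': "k' \<ge> k" "k < L \<longrightarrow> k' = k"
    and z: "cell k' k' p = z"
    by (auto simp: origin_piece_def level_iff)
  have x: "fst p div int m ^ k' = fst p div int m ^ K" if "K \<le> k'"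
    using div_power_stable[of m "fst p" K "k' - K"] c m_pos that by (auto simp: cell_def)
  have y: "snd p div int n ^ k' = snd p div int n ^ L" if "L \<le> k'"
    using div_power_stable[of n "snd p" L "k' - L"] c n_pos that by (auto simp: cell_def)
  show X: "fst p div int m ^ max a (min K k) = ?X"
  proof (cases "k < K")
    case True
    then have "k' = k" using k' assms by auto
    then show ?thesis using True z div_power_add[of "fst p" m k "max a k - k"] by (auto simp: cell_def)
  next
    case False
    then show ?thesis using x z k' assms by (auto simp: cell_def)
  qed
  show "snd p div int n ^ max b k = ?Y"
  proof (cases "k < L")
    case True
    then have "k' = k" using k' by auto
    then show ?thesis using True z div_power_add[of "snd p" n k "max b k - k"] by (auto simp: cell_def)
  next
    case False
    then show ?thesis using y z k' assms by (auto simp: cell_def)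
  qed
  fix l assume l: "K \<le> l" "l < k"
  then have "fst z \<in> {-1, 0}" using x z k' c by (auto simp: cell_def)
  then show "col_count \<Lambda> (dig m (l - K) ?X) \<le> eta m \<Lambda> (fst z)"
    using eta_fixed[of "fst z" "l - K"] l by simp
qed

lemma origin_piece_count:
  assumes "a \<le> b" "a \<le> K" "K \<le> L" "b \<le> L" "k \<le> L" "S \<subseteq> origin_piece z K L k"
    and \<phi>: "\<And>i. 0 \<le> \<phi> i" "\<And>i. 0 \<le> \<psi> i" and "0 \<le> \<theta>"
    and "\<And>p. p \<in> S \<Longrightarrow> \<theta> \<le> (\<Prod>l<k. colw \<phi> \<psi> a b K l (code a b K p l))"
    and A: "(\<Sum>i\<in>cols. \<phi> i) \<le> A" "(\<Sum>c\<in>\<Lambda>. \<psi> (fst c)) \<le> B" "1 \<le> A" "1 \<le> B"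
  shows "finite (cell a b ` S)" "\<theta> * card (cell a b ` S) \<le> cprod A B (eta m \<Lambda> (fst z)) a b K L"
proof -
  have "finite (cell a b ` S) \<and> \<theta> * card (cell a b ` S) \<le> cprod A B (eta m \<Lambda> (fst z)) a b K L"
  proof (cases "S = {}")
    case True
    have "0 \<le> cprod A B (eta m \<Lambda> (fst z)) a b K L"
      using cprod_ge_1[OF A(3,4), of "eta m \<Lambda> (fst z)" a b K L] eta_ge_1[of "fst z"] by simp
    then show ?thesis using True by simp
  next
    case False
    \<comment> \<open>The bound by \<open>eta\<close> on the prescribed column is available only if
      the piece contains a point.\<close>
    then obtain p0 where p0: "p0 \<in> origin_piece z K L k" using assms(6) by blast
    obtain X Y where X: "\<And>p. p \<in> origin_piece z K L k \<Longrightarrow> fst p div int m ^ max a (min K k) = X"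
      and Y: "\<And>p. p \<in> origin_piece z K L k \<Longrightarrow> snd p div int n ^ max b k = Y"
      and H: "\<And>p l. p \<in> origin_piece z K L k \<Longrightarrow> K \<le> l \<Longrightarrow> l < k \<Longrightarrow>
       col_count \<Lambda> (dig m (l - K) X) \<le> eta m \<Lambda> (fst z)"
      by (rule origin_piece_base[OF assms(2,3,4,5), of z]) (rule that)
    have d: "digits p l \<in> \<Lambda>" if "p \<in> S" "l < k" for p l
      using that assms(6) by (auto simp: origin_piece_def level_iff)
    have X': "fst p div int m ^ max a (min K k) = X" and Y': "snd p div int n ^ max b k = Y"
      if "p \<in> S" for p using X Y that assms(6) by blast+
    have H': "real (col_count \<Lambda> (dig m (l - K) X)) \<le> eta m \<Lambda> (fst z)" if "K \<le> l" "l < k" for l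
      using H[OF p0 that] by simp
    have H1: "1 \<le> real (eta m \<Lambda> (fst z))" using eta_ge_1[of "fst z"] by simp
    show ?thesis
      by (rule conjI; rule weighted_cell_count[OF assms(1-3,5) d X' Y' \<phi> assms(9,10) A H1 H'])
  qed
  then show "finite (cell a b ` S)" "\<theta> * card (cell a b ` S) \<le> cprod A B (eta m \<Lambda> (fst z)) a b K L"
    by blast+
qed

text \<open>The pieces for the levels below \<open>L\<close> and the one for all others make up the
  factor \<open>L\<close>. It is logarithmic in the size of the box and does not affect any
  exponent.\<close>

lemma origin_count:
  assumes "a \<le> b" "a \<le> K" "K \<le> L" "b \<le> L" "1 \<le> L"
    and "S \<subseteq> {p \<in> orbit z. cell K L p \<in> {-1, 0} \<times> {-1, 0}}"
  shows "finite (cell a b ` S)"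
    "real (card (cell a b ` S)) \<le> L * cprod (num_cols m \<Lambda>) (card \<Lambda>) (eta m \<Lambda> (fst z)) a b K L"
proof -
  have *: "finite (cell a b ` origin_piece z K L k)"
    "1 * real (card (cell a b ` origin_piece z K L k))
      \<le> cprod (num_cols m \<Lambda>) (card \<Lambda>) (eta m \<Lambda> (fst z)) a b K L" if "k \<in> {1..L}" for k
  proof -
    have kL: "k \<le> L" using that by simp
    have w: "1 \<le> (\<Prod>l<k. colw (\<lambda>_. 1) (\<lambda>_. 1) a b K l (code a b K p l))" for p
      by (intro prod_ge_1) (simp add: colw_def)
    note * = origin_piece_count[where \<phi> = "\<lambda>_. 1" and \<psi> = "\<lambda>_. 1" and \<theta> = 1 and A = "num_cols m \<Lambda>"
        and B = "card \<Lambda>", OF assms(1-4) kL order_refl _ _ _ w, of z]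
    show "finite (cell a b ` origin_piece z K L k)"
      by (rule *(1)) (use num_cols_ge_1 card_digits_ge_1 in \<open>simp_all add: num_cols_def\<close>)
    show "1 * real (card (cell a b ` origin_piece z K L k))
      \<le> cprod (num_cols m \<Lambda>) (card \<Lambda>) (eta m \<Lambda> (fst z)) a b K L"
      by (rule *(2)) (use num_cols_ge_1 card_digits_ge_1 in \<open>simp_all add: num_cols_def\<close>)
  qed
  have "S \<subseteq> (\<Union>k\<in>{1..L}. origin_piece z K L k)"
    using assms(6) origin_cover[OF assms(5)] by blast
  note cover = card_image_UN_le[OF finite_atLeastAtMost this *(1),
      where B = "cprod (num_cols m \<Lambda>) (card \<Lambda>) (eta m \<Lambda> (fst z)) a b K L"]
  show "finite (cell a b ` S)" using cover(1) *(2) by simp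
  show "real (card (cell a b ` S)) \<le> L * cprod (num_cols m \<Lambda>) (card \<Lambda>) (eta m \<Lambda> (fst z)) a b K L"
    using cover(2) *(2) by simp
qed


subsection \<open>Arbitrary boxes\<close>

lemma max_col_ge: "i < m \<Longrightarrow> col_count \<Lambda> i \<le> max_col m \<Lambda>"
  unfolding max_col_def by (rule Max_ge) auto

lemma max_col_witness:
  obtains e where "e < m" "col_count \<Lambda> e = max_col m \<Lambda>"
proof -
  have "max_col m \<Lambda> \<in> col_count \<Lambda> ` {0..<m}"
    unfolding max_col_def using m_pos by (intro Max_in) auto
  then show ?thesis using that by auto
qed

lemma max_col_ge_1: "1 \<le> max_col m \<Lambda>"
proof -
  obtain c where c: "c \<in> \<Lambda>" using digits_nonempty by blast
  then have "0 < col_count \<Lambda> (fst c)" by (auto simp: col_count_pos_iff intro!: exI[of _ "snd c"])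
  then show ?thesis using max_col_ge[OF digits_less(3)[OF c]] by linarith
qed

text \<open>\<open>nrm\<close> does not grow under division, so all quotients stay in a bounded
  interval.\<close>

lemma finite_range_div: "0 < b \<Longrightarrow> finite (range (\<lambda>j. (x::int) div int b ^ j))"
proof (rule finite_subset[of _ "{-\<bar>x\<bar> - 1..\<bar>x\<bar> + 1}"])
  assume "0 < b"
  have "-\<bar>x\<bar> - 1 \<le> x div B \<and> x div B \<le> \<bar>x\<bar> + 1" if "0 < B" for B :: int
  proof -
    have "nrm (x div B) \<le> nrm x" using zdiv_mono2[of "nrm x" 1 B] that by (simp add: nrm_div)
    then show ?thesis by (auto simp: nrm_def)
  qed
  then show "range (\<lambda>j. x div int b ^ j) \<subseteq> {-\<bar>x\<bar> - 1..\<bar>x\<bar> + 1}" using \<open>0 < b\<close> by auto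
qed simp

text \<open>A point of level at most \<open>a\<close> has reached \<open>z\<close> before the cell
  scale, so its cell is a quotient of \<open>z\<close> and lies in this finite set.\<close>

definition tails :: "int \<times> int \<Rightarrow> (int \<times> int) set" where
  "tails z = range (\<lambda>j. fst z div int m ^ j) \<times> range (\<lambda>j. snd z div int n ^ j)"

lemma finite_tails: "finite (tails z)"
  unfolding tails_def by (intro finite_cartesian_product finite_range_div m_pos n_pos)

lemma card_tails_ge_1: "1 \<le> card (tails z)"
  using finite_tails[of z] by (simp add: Suc_le_eq card_gt_0_iff) (auto simp: tails_def)

text \<open>The number of pieces must be of order 1 + (L - b) + (K - a) rather than
  \<open>L\<close>, because the Assouad dimension requires a bound in R / r only. Levels above the
  box scale are lumped together; those below the cell scale are sorted by the finitely many
  quotients of \<open>z\<close>.\<close>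

lemma box_piece_count:
  assumes ab: "a \<le> b" "a \<le> K" "K \<le> L" "b \<le> L"
    and S: "S \<subseteq> orbit z" "\<And>p. p \<in> S \<Longrightarrow> cell K L p = q"
  shows "finite (cell a b ` S)"
    "real (card (cell a b ` S)) \<le> (3 * real (card (tails z)) * (1 + real (L - b) + real (K - a)))
        * cprod (num_cols m \<Lambda>) (card \<Lambda>) (max_col m \<Lambda>) a b K L"
proof -
  define XX YY where "XX = range (\<lambda>j. fst z div int m ^ j)" and "YY = range (\<lambda>j. snd z div int n ^ j)"
  let ?c = "cprod (num_cols m \<Lambda>) (card \<Lambda>) (max_col m \<Lambda>) a b K L"
  \<comment> \<open>\<open>A k\<close>: levels from \<open>b\<close> on, with those from
    \<open>L\<close> on lumped into \<open>A L\<close>. \<open>B\<close>: levels up to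
    \<open>a\<close>, sorted by their cell. \<open>C\<close>: levels strictly between
    \<open>a\<close> and \<open>b\<close>, where only the second coordinate has a quotient of
    \<open>z\<close> at the cell scale; those from \<open>K\<close> on are lumped.\<close>
  define A where "A k = {p \<in> S. (\<forall>l<k. digits p l \<in> \<Lambda>) \<and> (k < L \<longrightarrow> cell k k p = z)}" for k
  define B where "B = (\<lambda>(X, Y). {p \<in> S. cell a b p = (X, Y)})"
  define C where "C = (\<lambda>(k, Y). {p \<in> S. (\<forall>l<k. digits p l \<in> \<Lambda>) \<and> snd p div int n ^ b = Y
      \<and> (k < K \<longrightarrow> fst p div int m ^ k = fst z)})"
  have c1: "1 \<le> ?c"
    by (rule cprod_ge_1) (use num_cols_ge_1 card_digits_ge_1 max_col_ge_1 in simp_all)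
  have H: "real (col_count \<Lambda> (dig m l X)) \<le> max_col m \<Lambda>" for l X
    using max_col_ge[OF dig_less[OF m_pos]] by simp
  have H1: "1 \<le> real (max_col m \<Lambda>)" using max_col_ge_1 by simp
  have fst_q: "fst p div int m ^ K = fst q" and snd_q: "snd p div int n ^ L = snd q" if "p \<in> S" for p
    by (simp_all add: S(2)[OF that, symmetric] cell_def)
  have A: "finite (cell a b ` A k) \<and> real (card (cell a b ` A k)) \<le> ?c" if k: "k \<in> {b..L}" for k
  proof -
    let ?X = "if k < K then fst z div int m ^ (max a k - k) else fst q"
    have X: "fst p div int m ^ max a (min K k) = ?X" if "p \<in> A k" for p
    proof (cases "k < K")
      case True
      then have "fst p div int m ^ k = fst z" using that ab by (auto simp: A_def cell_def)
      then show ?thesis using True div_power_add[of "fst p" m k "max a k - k"] by auto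
    next
      case False
      then have "max a (min K k) = K" "p \<in> S" using that ab by (auto simp: A_def)
      then show ?thesis using fst_q[of p] False by simp
    qed
    have Y: "snd p div int n ^ max b k = (if k < L then snd z else snd q)" if "p \<in> A k" for p
    proof (cases "k < L")
      case True
      then show ?thesis using that k by (auto simp: A_def cell_def)
    next
      case False
      then have "max b k = L" "p \<in> S" using that k ab by (auto simp: A_def)
      then show ?thesis using snd_q[of p] False by simp
    qed
    have d: "digits p l \<in> \<Lambda>" if "p \<in> A k" "l < k" for p l using that by (auto simp: A_def)
    have "k \<le> L" using k by simp
    then show ?thesis using cell_count[OF ab(1-3) _ d X Y H1 H] by blast
  qed
  have B: "finite (cell a b ` B i) \<and> real (card (cell a b ` B i)) \<le> ?c" for i
  proof -
    have sub: "cell a b ` B i \<subseteq> {i}" by (auto simp: B_def split: prod.splits)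
    then have "finite (cell a b ` B i)" by (rule finite_subset) simp
    moreover have "card (cell a b ` B i) \<le> 1" using card_mono[OF _ sub] by simp
    ultimately show ?thesis using c1 by linarith
  qed
  have C: "finite (cell a b ` C i) \<and> real (card (cell a b ` C i)) \<le> ?c"
    if i: "i \<in> {a..min K b} \<times> YY" for i
  proof -
    obtain k Y where kY: "i = (k, Y)" by fastforce
    have k: "a \<le> k" "k \<le> K" "k \<le> b" "k \<le> L" using i kY ab by auto
    have X: "fst p div int m ^ max a (min K k) = (if k < K then fst z else fst q)" if "p \<in> C (k, Y)" for p
    proof (cases "k < K")
      case True
      then show ?thesis using that k by (auto simp: C_def max_def)
    next
      case False
      then have "max a (min K k) = K" "p \<in> S" using that k by (auto simp: C_def)
      then show ?thesis using fst_q[of p] False by simp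
    qed
    have Y: "snd p div int n ^ max b k = Y" if "p \<in> C (k, Y)" for p
      using that k by (auto simp: C_def)
    have d: "digits p l \<in> \<Lambda>" if "p \<in> C (k, Y)" "l < k" for p l using that by (auto simp: C_def)
    show ?thesis unfolding kY using cell_count[OF ab(1-3) k(4) d X Y H1 H] by blast
  qed
  have fin: "finite XX" "finite YY"
    unfolding XX_def YY_def by (intro finite_range_div m_pos n_pos)+
  have cov: "S \<subseteq> (\<Union>i\<in>{b..L}. A i) \<union> ((\<Union>i\<in>XX \<times> YY. B i) \<union> (\<Union>i\<in>{a..min K b} \<times> YY. C i))"
  proof
    fix p assume p: "p \<in> S"
    then obtain k where "p \<in> level z k" using S(1) mem_orbit_iff by blast
    then have kz: "cell k k p = z" and kd: "\<And>l. l < k \<Longrightarrow> digits p l \<in> \<Lambda>" by (auto simp: level_iff)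
    show "p \<in> (\<Union>i\<in>{b..L}. A i) \<union> ((\<Union>i\<in>XX \<times> YY. B i) \<union> (\<Union>i\<in>{a..min K b} \<times> YY. C i))"
    proof (cases "b \<le> k")
      case True
      have "p \<in> A (min k L)" using p kz kd by (auto simp: A_def min_def)
      moreover have "min k L \<in> {b..L}" using True ab by simp
      ultimately show ?thesis by (intro UnI1 UN_I)
    next
      case False
      have "snd p div int n ^ b = snd z div int n ^ (b - k)"
        using div_power_add[of "snd p" n k "b - k"] False kz[symmetric] by (simp add: cell_def)
      then have Y: "snd p div int n ^ b \<in> YY" by (simp add: YY_def)
      show ?thesis
      proof (cases "k \<le> a")
        case True
        have "fst p div int m ^ a = fst z div int m ^ (a - k)"
          using div_power_add[of "fst p" m k "a - k"] True kz[symmetric] by (simp add: cell_def)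
        then have "fst p div int m ^ a \<in> XX" by (simp add: XX_def)
        then have "cell a b p \<in> XX \<times> YY" using Y by (simp add: cell_def)
        moreover have "p \<in> B (cell a b p)" using p by (auto simp: B_def)
        ultimately show ?thesis by (intro UnI2[OF UnI1] UN_I)
      next
        case ka: False
        have "p \<in> C (min k K, snd p div int n ^ b)"
          using p kz kd by (auto simp: C_def cell_def min_def)
        moreover have "(min k K, snd p div int n ^ b) \<in> {a..min K b} \<times> YY"
          using Y ka False ab by auto
        ultimately show ?thesis by (intro UnI2[OF UnI2] UN_I)
      qed
    qed
  qed
  note UA = card_image_UN_le[where f = "cell a b" and I = "{b..L}" and T = A and S = "\<Union>i\<in>{b..L}. A i" and B = ?c]
  note UB = card_image_UN_le[where f = "cell a b" and I = "XX \<times> YY" and T = B and S = "\<Union>i\<in>XX \<times> YY. B i" and B = ?c]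
  note UC = card_image_UN_le[where f = "cell a b" and I = "{a..min K b} \<times> YY" and T = C
      and S = "\<Union>i\<in>{a..min K b} \<times> YY. C i" and B = ?c]
  have fA: "finite (cell a b ` (\<Union>i\<in>{b..L}. A i))" by (rule UA(1)) (use A in blast)+
  have fB: "finite (cell a b ` (\<Union>i\<in>XX \<times> YY. B i))" by (rule UB(1)) (use B fin in blast)+
  have fC: "finite (cell a b ` (\<Union>i\<in>{a..min K b} \<times> YY. C i))"
    by (rule UC(1)) (use C fin in blast)+
  have sub: "cell a b ` S \<subseteq> cell a b ` (\<Union>i\<in>{b..L}. A i)
      \<union> (cell a b ` (\<Union>i\<in>XX \<times> YY. B i) \<union> cell a b ` (\<Union>i\<in>{a..min K b} \<times> YY. C i))"
    using cov by (metis image_Un image_mono)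
  have fU: "finite (cell a b ` (\<Union>i\<in>{b..L}. A i)
      \<union> (cell a b ` (\<Union>i\<in>XX \<times> YY. B i) \<union> cell a b ` (\<Union>i\<in>{a..min K b} \<times> YY. C i)))"
    using fA fB fC by blast
  show "finite (cell a b ` S)" by (rule finite_subset[OF sub fU])
  have "card (cell a b ` S) \<le> card (cell a b ` (\<Union>i\<in>{b..L}. A i))
      + (card (cell a b ` (\<Union>i\<in>XX \<times> YY. B i)) + card (cell a b ` (\<Union>i\<in>{a..min K b} \<times> YY. C i)))"
    by (rule order_trans[OF card_mono[OF fU sub] order_trans[OF card_Un_le add_left_mono[OF card_Un_le]]])
  then have "real (card (cell a b ` S)) \<le> real (card (cell a b ` (\<Union>i\<in>{b..L}. A i)))
      + (real (card (cell a b ` (\<Union>i\<in>XX \<times> YY. B i)))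
        + real (card (cell a b ` (\<Union>i\<in>{a..min K b} \<times> YY. C i))))"
    by linarith
  also have "\<dots> \<le> real (card {b..L}) * ?c
      + (real (card (XX \<times> YY)) * ?c + real (card ({a..min K b} \<times> YY)) * ?c)"
  proof (intro add_mono)
    show "real (card (cell a b ` (\<Union>i\<in>{b..L}. A i))) \<le> real (card {b..L}) * ?c"
      by (rule UA(2)) (use A in blast)+
    show "real (card (cell a b ` (\<Union>i\<in>XX \<times> YY. B i))) \<le> real (card (XX \<times> YY)) * ?c"
      by (rule UB(2)) (use B fin in blast)+
    show "real (card (cell a b ` (\<Union>i\<in>{a..min K b} \<times> YY. C i))) \<le> real (card ({a..min K b} \<times> YY)) * ?c"
      by (rule UC(2)) (use C fin in blast)+
  qed
  also have "\<dots> = (real (card {b..L}) + real (card (tails z)) + real (card ({a..min K b} \<times> YY))) * ?c"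
    by (simp add: tails_def XX_def YY_def algebra_simps)
  also have "\<dots> \<le> (3 * real (card (tails z)) * (1 + real (L - b) + real (K - a))) * ?c"
  proof (rule mult_right_mono)
    define t where "t = real (card (tails z))"
    have t1: "1 \<le> t" unfolding t_def using card_tails_ge_1[of z] by simp
    have "card (tails z) = card XX * card YY"
      by (simp add: tails_def XX_def YY_def card_cartesian_product)
    moreover have "1 \<le> card XX" using fin(1) by (simp add: Suc_le_eq card_gt_0_iff XX_def)
    ultimately have "card YY \<le> card (tails z)" by simp
    then have "real (card YY) \<le> t" unfolding t_def by simp
    have "real (card {b..L}) \<le> 1 + real (L - b)" using ab by (simp add: Suc_diff_le)
    also have "\<dots> \<le> t * (1 + real (L - b) + real (K - a))"
      using mult_mono[OF t1, of "1 + real (L - b)" "1 + real (L - b) + real (K - a)"] t1 by simp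
    finally have 1: "real (card {b..L}) \<le> t * (1 + real (L - b) + real (K - a))" .
    have 2: "t \<le> t * (1 + real (L - b) + real (K - a))" using t1 by simp
    have "real (card {a..min K b}) \<le> 1 + real (L - b) + real (K - a)" by simp
    then have 3: "real (card ({a..min K b} \<times> YY)) \<le> t * (1 + real (L - b) + real (K - a))"
      using mult_mono[OF \<open>real (card YY) \<le> t\<close>, of "real (card {a..min K b})" "1 + real (L - b) + real (K - a)"] t1
      by (simp add: card_cartesian_product mult.commute)
    show "real (card {b..L}) + real (card (tails z)) + real (card ({a..min K b} \<times> YY))
        \<le> 3 * real (card (tails z)) * (1 + real (L - b) + real (K - a))"
      using 1 2 3 unfolding t_def by (simp add: mult.assoc)
  qed (use c1 in linarith)
  finally show "real (card (cell a b ` S)) \<le> (3 * real (card (tails z)) * (1 + real (L - b) + real (K - a))) * ?c" .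
qed

text \<open>A box no larger than the cells at scale (K, L) meets at most two of them in each
  direction, hence 12 = 4 * 3.\<close>

lemma box_count:
  assumes "a \<le> b" "a \<le> K" "K \<le> L" "b \<le> L"
    and "S \<subseteq> orbit z" "cell K L ` S \<subseteq> {X..X+1} \<times> {Y..Y+1}"
  shows "finite (cell a b ` S)"
    "real (card (cell a b ` S)) \<le> (12 * real (card (tails z)) * (1 + real (L - b) + real (K - a)))
        * cprod (num_cols m \<Lambda>) (card \<Lambda>) (max_col m \<Lambda>) a b K L"
proof -
  let ?B = "(3 * real (card (tails z)) * (1 + real (L - b) + real (K - a)))
        * cprod (num_cols m \<Lambda>) (card \<Lambda>) (max_col m \<Lambda>) a b K L"
  let ?I = "{X..X+1} \<times> {Y..Y+1}"
  have fI: "finite ?I" by simp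
  have cov: "S \<subseteq> (\<Union>q\<in>?I. {p \<in> S. cell K L p = q})" using assms(6) by blast
  have *: "finite (cell a b ` {p \<in> S. cell K L p = q})"
    "real (card (cell a b ` {p \<in> S. cell K L p = q})) \<le> ?B" for q
    using assms(5) by (intro box_piece_count[OF assms(1-4), where q = q]; blast)+
  note U = card_image_UN_le[OF fI cov *]
  show "finite (cell a b ` S)" by (rule U(1))
  have I: "real (card ?I) = 4" by (simp add: card_cartesian_product)
  have "real (card ?I) * ?B = (12 * real (card (tails z)) * (1 + real (L - b) + real (K - a)))
        * cprod (num_cols m \<Lambda>) (card \<Lambda>) (max_col m \<Lambda>) a b K L"
    unfolding I by (simp only: mult.assoc[symmetric])
  then show "real (card (cell a b ` S)) \<le> (12 * real (card (tails z)) * (1 + real (L - b) + real (K - a)))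
        * cprod (num_cols m \<Lambda>) (card \<Lambda>) (max_col m \<Lambda>) a b K L"
    using U(2) by (simp only:)
qed

subsection \<open>Points with prescribed digits\<close>

definition pt :: "nat \<Rightarrow> int \<times> int \<Rightarrow> (nat \<Rightarrow> nat \<times> nat) \<Rightarrow> int \<times> int" where
  "pt L z d = (expand m L (fst z) (\<lambda>l. fst (d l)), expand n L (snd z) (\<lambda>l. snd (d l)))"

text \<open>Freezing the first digit at [K, L) puts all points \<open>pt L z d\<close> into one cell
  at scale (K, L), while the second digits there still vary over a column. Such words realise the
  full count \<open>cprod\<close> within one box.\<close>

definition words :: "nat \<Rightarrow> nat \<Rightarrow> nat \<Rightarrow> (nat \<Rightarrow> nat \<times> nat) set" where
  "words K L e = PiE {..<L} (\<lambda>l. if l < K then \<Lambda> else column e)"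

lemma finite_words: "finite (words K L e)"
  unfolding words_def by (intro finite_PiE) (auto simp: finite_digits)

lemma words_mem: "d \<in> words K L e \<Longrightarrow> l < L \<Longrightarrow> d l \<in> (if l < K then \<Lambda> else column e)"
  unfolding words_def by (erule PiE_mem) simp

lemma words_digit:
  assumes "d \<in> words K L e" "l < L"
  shows "d l \<in> \<Lambda>" "K \<le> l \<Longrightarrow> fst (d l) = e"
  using words_mem[OF assms] by (simp_all split: if_splits)

lemma
  assumes d: "d \<in> words K L e"
  shows digits_pt: "l < L \<Longrightarrow> digits (pt L z d) l = d l"
    and cell_pt: "cell L L (pt L z d) = z"
proof -
  have lt: "fst (d l) < m" "snd (d l) < n" if "l < L" for l
    using digits_less(3,4)[OF words_digit(1)[OF d that]] .
  show "digits (pt L z d) l = d l" if "l < L"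
    using expand_dig[where f = "\<lambda>l. fst (d l)", OF lt(1) that]
      expand_dig[where f = "\<lambda>l. snd (d l)", OF lt(2) that]
    unfolding digits_def pt_def fst_conv snd_conv by (simp only: prod.collapse)
  show "cell L L (pt L z d) = z"
    using expand_div[where f = "\<lambda>l. fst (d l)", OF lt(1)]
      expand_div[where f = "\<lambda>l. snd (d l)", OF lt(2)]
    unfolding cell_def pt_def fst_conv snd_conv by (simp only: prod.collapse)
qed

lemma pt_level: "d \<in> words K L e \<Longrightarrow> pt L z d \<in> level z L"
  unfolding level_iff
proof (intro conjI allI impI)
  assume d: "d \<in> words K L e"
  show "cell L L (pt L z d) = z" by (rule cell_pt[OF d])
  show "digits (pt L z d) l \<in> \<Lambda>" if "l < L" for l
    unfolding digits_pt[OF d that] by (rule words_digit(1)[OF d that])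
qed

lemma pt_fixed:
  assumes "d \<in> words K L e" "K \<le> L" "\<And>l. dig m l u = e" "u \<in> {-1, 0}"
  shows "fst (pt L (u, v) d) div int m ^ K = u"
proof -
  have u: "u div int m ^ i = u" for i
  proof -
    have "u div int m ^ 0 \<in> {-1, 0}" using assms(4) by simp
    from div_power_stable[OF m_pos this, of i] show ?thesis by simp
  qed
  have "fst (pt L (u, v) d) div int m ^ K = u div int m ^ K"
  proof (rule div_eq_if_dig_eq[OF m_pos assms(2)])
    show "fst (pt L (u, v) d) div int m ^ L = u div int m ^ L"
      using cell_pt[OF assms(1), of "(u, v)"] u by (simp add: cell_def)
    show "dig m l (fst (pt L (u, v) d)) = dig m l u" if "K \<le> l" "l < L" for l
      using digits_pt[OF assms(1) that(2), of "(u, v)"] words_digit(2)[OF assms(1) that(2,1)] assms(3)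
      by (simp add: digits_def prod_eq_iff)
  qed
  then show ?thesis using u by simp
qed

lemma pt_same_cell:
  assumes "d \<in> words K L e" "d' \<in> words K L e" "K \<le> L"
  shows "cell K L (pt L z d) = cell K L (pt L z d')"
proof -
  have "cell L L (pt L z d) = cell L L (pt L z d')"
    by (simp only: cell_pt[OF assms(1)] cell_pt[OF assms(2)])
  then have xL: "fst (pt L z d) div int m ^ L = fst (pt L z d') div int m ^ L"
    and yL: "snd (pt L z d) div int n ^ L = snd (pt L z d') div int n ^ L"
    unfolding cell_def by simp_all
  have "dig m l (fst (pt L z d)) = dig m l (fst (pt L z d'))" if "K \<le> l" "l < L" for l
  proof -
    have "fst (digits (pt L z d) l) = fst (digits (pt L z d') l)"
      by (simp only: digits_pt[OF assms(1) that(2)] digits_pt[OF assms(2) that(2)]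
          words_digit(2)[OF assms(1) that(2,1)] words_digit(2)[OF assms(2) that(2,1)])
    then show ?thesis unfolding digits_def by simp
  qed
  from div_eq_if_dig_eq[OF m_pos assms(3) xL this] yL show ?thesis unfolding cell_def by simp
qed

lemma colw_one: "colw (\<lambda>_. 1) (\<lambda>_. 1) a b K l c = 1"
  by (auto simp: colw_def)

lemma sum_one_code_set:
  "real (card (code_set a b K (\<lambda>_. e) l)) = cfactor (num_cols m \<Lambda>) (card \<Lambda>) (col_count \<Lambda> e) a b K l"
  using sum_colw[where f = "\<lambda>_. e" and i = e and \<phi> = "\<lambda>_. 1" and \<psi> = "\<lambda>_. 1" and a = a and b = b and K = K and l = l]
  by (simp add: colw_one num_cols_def)

text \<open>The converse of the counting bound: the code is a function of the cell, and every
  admissible code is that of some word, the erased entries being filled in freely. If [K, L) is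
  nonempty, this takes a nonempty frozen column.\<close>

lemma words_cell_count:
  assumes "a \<le> b" "K \<le> L" "K < L \<Longrightarrow> e \<in> cols"
  shows "cprod (num_cols m \<Lambda>) (card \<Lambda>) (col_count \<Lambda> e) a b K L \<le> card (cell a b ` pt L z ` words K L e)"
proof -
  let ?E = "pt L z ` words K L e"
  let ?F = "\<lambda>p. restrict (code a b K p) {..<L}"
  let ?P = "PiE {..<L} (code_set a b K (\<lambda>_. e))"
  have fin: "finite ?E" using finite_words by blast
  have "?P \<subseteq> ?F ` ?E"
  proof
    fix f assume f: "f \<in> ?P"
    then have fl: "f l \<in> code_set a b K (\<lambda>_. e) l" if "l < L" for l using that by (auto simp: PiE_iff)
    \<comment> \<open>\<open>Q l c\<close>: the pair \<open>c\<close> is allowed at position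
      \<open>l\<close> and its code entry there is the given \<open>f l\<close>.\<close>
    define Q where "Q l c \<longleftrightarrow> (if l < K then c \<in> \<Lambda> else c \<in> column e) \<and>
        f l = (if l < K then if l < a then (0, 0) else if l < b then (fst c, 0) else c
      else if l < b then (0, 0) else (0, snd c))" for l c
    have "\<exists>c. l < L \<longrightarrow> Q l c" for l
    proof (cases "l < L")
      case True
      obtain c0 where c0: "c0 \<in> \<Lambda>" using digits_nonempty by blast
      consider "l < K" "l < a" | "l < K" "\<not> l < a" "l < b" | "l < K" "\<not> l < a" "\<not> l < b"
        | "\<not> l < K" "l < b" | "\<not> l < K" "\<not> l < b" by blast
      then show ?thesis
      proof cases
        case 1
        then show ?thesis using fl[OF True] c0 by (intro exI[of _ c0]) (simp add: code_set_def Q_def)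
      next
        case 2
        then obtain c where "c \<in> \<Lambda>" "f l = (fst c, 0)"
          using fl[OF True] by (auto simp: code_set_def cols_eq)
        then show ?thesis using 2 by (intro exI[of _ c]) (simp add: Q_def)
      next
        case 3
        then show ?thesis using fl[OF True] by (intro exI[of _ "f l"]) (simp add: code_set_def Q_def)
      next
        case 4
        then obtain c1 where "c1 \<in> column e" using assms(3) True by (fastforce simp: cols_eq)
        then show ?thesis using 4 fl[OF True] by (intro exI[of _ c1]) (simp add: code_set_def Q_def)
      next
        case 5
        then obtain j where "(e, j) \<in> \<Lambda>" "f l = (0, j)"
          using fl[OF True] by (auto simp: code_set_def)
        then show ?thesis using 5 by (intro exI[of _ "(e, j)"]) (simp add: Q_def)
      qed
    qed simp
    then have "\<forall>l. \<exists>c. l < L \<longrightarrow> Q l c" by (rule allI)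
    from choice[OF this] obtain c where c: "\<forall>l. l < L \<longrightarrow> Q l (c l)" by (rule exE)
    define d where "d = restrict c {..<L}"
    have d: "d \<in> words K L e"
      unfolding words_def d_def restrict_PiE_iff using c by (auto simp: Q_def)
    have "code a b K (pt L z d) l = f l" if "l < L" for l
    proof -
      have dl: "digits (pt L z d) l = c l" using digits_pt[OF d that] that by (simp add: d_def)
      then have "dig m l (fst (pt L z d)) = fst (c l)" "dig n l (snd (pt L z d)) = snd (c l)"
        by (simp_all add: digits_def prod_eq_iff)
      then show ?thesis unfolding code_def dl using c[THEN spec, of l] that by (simp add: Q_def)
    qed
    then have "?F (pt L z d) = f"
      using f by (intro ext) (auto simp: PiE_iff extensional_def)
    then show "f \<in> ?F ` ?E" using d by blast
  qed
  then have "card ?P \<le> card (?F ` ?E)" by (rule card_mono[OF finite_imageI[OF fin]])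
  also have "\<dots> \<le> card (cell a b ` ?E)"
  proof (rule card_image_le_if_determined(2))
    fix p q assume "cell a b p = cell a b q"
    then have "code a b K p = code a b K q" by (intro ext code_eq_if_cell_eq[OF assms(1)])
    then show "?F p = ?F q" by (simp only:)
  qed (use fin in blast)
  finally have "real (card ?P) \<le> card (cell a b ` ?E)" by simp
  moreover have "real (card ?P) = cprod (num_cols m \<Lambda>) (card \<Lambda>) (col_count \<Lambda> e) a b K L"
    by (simp add: card_PiE sum_one_code_set prod_cfactor[OF assms(1,2)])
  ultimately show ?thesis by simp
qed

end

section \<open>Squares and cells\<close>

text \<open>Closed squares of equal side that meet both contain the midpoint of their
  centres.\<close>

lemma boxes_meet_iff:
  "box_around (real_pt x) (r / 2) \<inter> box_around (real_pt y) (r / 2) \<noteq> {} \<longleftrightarrow>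
     0 \<le> r \<and> \<bar>real_of_int (fst x) - fst y\<bar> \<le> r \<and> \<bar>real_of_int (snd x) - snd y\<bar> \<le> r"
proof
  assume "box_around (real_pt x) (r / 2) \<inter> box_around (real_pt y) (r / 2) \<noteq> {}"
  then obtain s t where "(s, t) \<in> box_around (real_pt x) (r / 2)" "(s, t) \<in> box_around (real_pt y) (r / 2)"
    by auto
  then show "0 \<le> r \<and> \<bar>real_of_int (fst x) - fst y\<bar> \<le> r \<and> \<bar>real_of_int (snd x) - snd y\<bar> \<le> r"
    unfolding box_around_def real_pt_def by (simp add: abs_le_iff)
next
  assume *: "0 \<le> r \<and> \<bar>real_of_int (fst x) - fst y\<bar> \<le> r \<and> \<bar>real_of_int (snd x) - snd y\<bar> \<le> r"
  have mid: "a - r / 2 \<le> (a + b) / 2 \<and> (a + b) / 2 \<le> a + r / 2 \<and> b - r / 2 \<le> (a + b) / 2 \<and> (a + b) / 2 \<le> b + r / 2" if "\<bar>a - b\<bar> \<le> r" for a b :: real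
    using that by (auto simp: abs_le_iff field_simps)
  have "((real_of_int (fst x) + fst y) / 2, (real_of_int (snd x) + snd y) / 2)
      \<in> box_around (real_pt x) (r / 2) \<inter> box_around (real_pt y) (r / 2)"
    unfolding box_around_def real_pt_def using * mid[of "fst x" "fst y"] mid[of "snd x" "snd y"] by simp
  then show "box_around (real_pt x) (r / 2) \<inter> box_around (real_pt y) (r / 2) \<noteq> {}" by blast
qed

lemma packing_number_attained:
  assumes "finite A"
  obtains X where "X \<subseteq> A" "disjoint_family_on (\<lambda>x. box_around (real_pt x) (r / 2)) X"
    "card X = packing_number r A"
    "\<And>Y. Y \<subseteq> A \<Longrightarrow> disjoint_family_on (\<lambda>x. box_around (real_pt x) (r / 2)) Y \<Longrightarrow> card Y \<le> card X"
proof -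
  let ?D = "\<lambda>X. X \<subseteq> A \<and> disjoint_family_on (\<lambda>x. box_around (real_pt x) (r / 2)) X"
  have fin: "finite {card X | X. ?D X}"
    by (rule finite_subset[of _ "card ` Pow A"]) (use assms in auto)
  have "?D {}" by (simp add: disjoint_family_on_def)
  then have "{card X | X. ?D X} \<noteq> {}" by blast
  then have "packing_number r A \<in> {card X | X. ?D X}"
    unfolding packing_number_def using Max_in[OF fin] by blast
  then obtain X where X: "?D X" "card X = packing_number r A" by auto
  have "card Y \<le> card X" if "?D Y" for Y
    unfolding X(2) packing_number_def by (rule Max_ge[OF fin]) (use that in blast)
  then show ?thesis using that X by blast
qed

lemma div_near:
  assumes "0 < (M::int)" "x \<le> y + M"
  shows "x div M \<le> y div M + 1"
  using zdiv_mono1[OF assms(2,1)] assms(1) by simp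

lemma floor_near:
  fixes w h :: real and M :: int
  assumes "0 < M" "w \<le> real_of_int x" "real_of_int x \<le> w + M"
  shows "\<lfloor>w / M\<rfloor> \<le> x div M" "x div M \<le> \<lfloor>w / M\<rfloor> + 1"
proof -
  have "x div M = \<lfloor>real_of_int x / M\<rfloor>" by (simp add: floor_divide_of_int_eq)
  moreover have "w / M \<le> real_of_int x / M" using assms by (simp add: divide_right_mono)
  moreover have "real_of_int x / M \<le> w / M + 1" using assms by (simp add: field_simps)
  ultimately show "\<lfloor>w / M\<rfloor> \<le> x div M" "x div M \<le> \<lfloor>w / M\<rfloor> + 1" by linarith+
qed

context carpet
begin

lemma cell_box:
  fixes h :: real
  assumes "2 * h \<le> real m ^ K" "2 * h \<le> real n ^ L"
  obtains X Y where "cell K L ` {y. real_pt y \<in> box_around w h} \<subseteq> {X..X+1} \<times> {Y..Y+1}"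
proof
  let ?X = "\<lfloor>(fst w - h) / real_of_int (int m ^ K)\<rfloor>" and ?Y = "\<lfloor>(snd w - h) / real_of_int (int n ^ L)\<rfloor>"
  show "cell K L ` {y. real_pt y \<in> box_around w h} \<subseteq> {?X..?X+1} \<times> {?Y..?Y+1}"
  proof (rule image_subsetI)
    fix y assume "y \<in> {y. real_pt y \<in> box_around w h}"
    then have y: "fst w - h \<le> fst y" "fst y \<le> fst w - h + real_of_int (int m ^ K)"
      "snd w - h \<le> snd y" "snd y \<le> snd w - h + real_of_int (int n ^ L)"
      using assms by (auto simp: box_around_def real_pt_def)
    have p: "0 < int m ^ K" "0 < int n ^ L" using m_pos n_pos by simp_all
    show "cell K L y \<in> {?X..?X+1} \<times> {?Y..?Y+1}"
      using floor_near[OF p(1) y(1,2)] floor_near[OF p(2) y(3,4)] by (simp add: cell_def)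
  qed
qed

lemma cell_eq_near:
  assumes "cell a b p = cell a b q"
  shows "\<bar>fst p - fst q\<bar> < int m ^ a" "\<bar>snd p - snd q\<bar> < int n ^ b"
proof -
  have p: "0 < int m ^ a" "0 < int n ^ b" using m_pos n_pos by simp_all
  have e: "fst p div int m ^ a = fst q div int m ^ a" "snd p div int n ^ b = snd q div int n ^ b"
    using assms by (simp_all add: cell_def)
  show "\<bar>fst p - fst q\<bar> < int m ^ a"
    using div_bounds[OF p(1) e(1)] div_bounds[OF p(1) refl, of "fst q"] by (simp add: algebra_simps)
  show "\<bar>snd p - snd q\<bar> < int n ^ b"
    using div_bounds[OF p(2) e(2)] div_bounds[OF p(2) refl, of "snd q"] by (simp add: algebra_simps)
qed

text \<open>Points of one cell are less than m^a and n^b apart, both at most \<open>r\<close>, so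
  their squares meet and a packing has at most one point per cell.\<close>

lemma packing_number_le:
  fixes r :: real
  assumes "finite A" "real m ^ a \<le> r" "real n ^ b \<le> r"
  shows "packing_number r A \<le> card (cell a b ` A)"
proof -
  obtain X where X: "X \<subseteq> A" "disjoint_family_on (\<lambda>x. box_around (real_pt x) (r / 2)) X"
    "card X = packing_number r A"
    by (rule packing_number_attained[OF assms(1)]) blast
  have "inj_on (cell a b) X"
  proof (rule inj_onI, rule ccontr)
    fix p q assume pq: "p \<in> X" "q \<in> X" "cell a b p = cell a b q" "p \<noteq> q"
    have "real_of_int \<bar>fst p - fst q\<bar> < real_of_int (int m ^ a)"
      "real_of_int \<bar>snd p - snd q\<bar> < real_of_int (int n ^ b)"
      using cell_eq_near[OF pq(3)] by (simp_all only: of_int_less_iff)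
    moreover have "0 < real m ^ a" using m_pos by simp
    ultimately have "box_around (real_pt p) (r / 2) \<inter> box_around (real_pt q) (r / 2) \<noteq> {}"
      unfolding boxes_meet_iff using assms(2,3) by simp
    then show False using X(2) pq by (auto simp: disjoint_family_on_def)
  qed
  then have "card X = card (cell a b ` X)" by (simp add: card_image)
  also have "\<dots> \<le> card (cell a b ` A)" using X(1) assms(1) by (intro card_mono) auto
  finally show ?thesis using X(3) by simp
qed

text \<open>A packing of largest size cannot be enlarged, so every point of \<open>A\<close> is
  within \<open>r\<close> of one of its points in both coordinates. The cell of that point and the
  adjacent ones number 3 * 3.\<close>

lemma packing_number_ge:
  fixes r :: real
  assumes "finite A" "0 \<le> r" "r \<le> real m ^ a" "r \<le> real n ^ b"
  shows "card (cell a b ` A) \<le> 9 * packing_number r A"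
proof -
  obtain X where X: "X \<subseteq> A" "disjoint_family_on (\<lambda>x. box_around (real_pt x) (r / 2)) X"
    "card X = packing_number r A"
    and max: "\<And>Y. Y \<subseteq> A \<Longrightarrow> disjoint_family_on (\<lambda>x. box_around (real_pt x) (r / 2)) Y \<Longrightarrow> card Y \<le> card X"
    by (rule packing_number_attained[OF assms(1)]) blast
  have finX: "finite X" using X(1) assms(1) finite_subset by blast
  let ?N = "\<lambda>x. {fst (cell a b x) - 1..fst (cell a b x) + 1} \<times> {snd (cell a b x) - 1..snd (cell a b x) + 1}"
  have p: "0 < int m ^ a" "0 < int n ^ b" using m_pos n_pos by simp_all
  have sub: "cell a b ` A \<subseteq> (\<Union>x\<in>X. ?N x)"
  proof (rule image_subsetI)
    fix y assume y: "y \<in> A"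
    have "\<exists>x\<in>X. box_around (real_pt x) (r / 2) \<inter> box_around (real_pt y) (r / 2) \<noteq> {}"
    proof (rule ccontr)
      assume no: "\<not> ?thesis"
      then have "y \<notin> X" using assms(2) boxes_meet_iff[of y r y] by auto
      moreover have "disjoint_family_on (\<lambda>x. box_around (real_pt x) (r / 2)) (insert y X)"
        unfolding disjoint_family_on_insert[OF \<open>y \<notin> X\<close>] using X(2) no by blast
      then have "card (insert y X) \<le> card X" using max X(1) y by blast
      ultimately show False using finX by simp
    qed
    then obtain x where x: "x \<in> X" "\<bar>real_of_int (fst x) - fst y\<bar> \<le> r" "\<bar>real_of_int (snd x) - snd y\<bar> \<le> r"
      unfolding boxes_meet_iff by blast
    then have "\<bar>real_of_int (fst x) - fst y\<bar> \<le> real_of_int (int m ^ a)"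
      "\<bar>real_of_int (snd x) - snd y\<bar> \<le> real_of_int (int n ^ b)"
      using assms(3,4) by simp_all
    then have "fst y \<le> fst x + int m ^ a" "fst x \<le> fst y + int m ^ a"
      "snd y \<le> snd x + int n ^ b" "snd x \<le> snd y + int n ^ b" by linarith+
    then have "cell a b y \<in> ?N x"
      using div_near[OF p(1), of "fst y" "fst x"] div_near[OF p(1), of "fst x" "fst y"]
        div_near[OF p(2), of "snd y" "snd x"] div_near[OF p(2), of "snd x" "snd y"]
      by (simp add: cell_def)
    then show "cell a b y \<in> (\<Union>x\<in>X. ?N x)" by (rule UN_I[OF x(1)])
  qed
  have "finite (\<Union>x\<in>X. ?N x)" using finX by (rule finite_UN_I) simp
  then have "card (cell a b ` A) \<le> card (\<Union>x\<in>X. ?N x)" using sub by (rule card_mono)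
  also have "\<dots> \<le> (\<Sum>x\<in>X. card (?N x))" by (rule card_UN_le[OF finX])
  also have "\<dots> = 9 * card X" by (simp add: card_cartesian_product)
  finally show ?thesis using X(3) by simp
qed

lemma covering_number_le:
  fixes r :: real
  assumes "finite (cell a b ` A)" "real m ^ a \<le> r" "real n ^ b \<le> r"
  shows "covering_number r A \<le> card (cell a b ` A)"
proof -
  let ?w = "\<lambda>c. (real_of_int (int m ^ a * fst c) + r / 2, real_of_int (int n ^ b * snd c) + r / 2)"
  let ?W = "?w ` cell a b ` A"
  have p: "0 < int m ^ a" "0 < int n ^ b" using m_pos n_pos by simp_all
  have "real_pt ` A \<subseteq> (\<Union>w\<in>?W. box_around w (r / 2))"
  proof (rule image_subsetI)
    fix y assume y: "y \<in> A"
    have "int m ^ a * (fst y div int m ^ a) \<le> fst y" "fst y \<le> int m ^ a * (fst y div int m ^ a) + int m ^ a"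
      "int n ^ b * (snd y div int n ^ b) \<le> snd y" "snd y \<le> int n ^ b * (snd y div int n ^ b) + int n ^ b"
      using div_bounds[OF p(1) refl, of "fst y"] div_bounds[OF p(2) refl, of "snd y"]
      by (simp_all add: algebra_simps)
    then have "real_of_int (int m ^ a * (fst y div int m ^ a)) \<le> fst y"
      "fst y \<le> real_of_int (int m ^ a * (fst y div int m ^ a)) + real m ^ a"
      "real_of_int (int n ^ b * (snd y div int n ^ b)) \<le> snd y"
      "snd y \<le> real_of_int (int n ^ b * (snd y div int n ^ b)) + real n ^ b"
      using of_int_le_iff[where 'a = real] by (metis, metis of_int_add of_int_of_nat_eq of_int_power,
          metis, metis of_int_add of_int_of_nat_eq of_int_power)
    then have "real_pt y \<in> box_around (?w (cell a b y)) (r / 2)"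
      using assms(2,3) by (simp add: box_around_def real_pt_def cell_def)
    then show "real_pt y \<in> (\<Union>w\<in>?W. box_around w (r / 2))" using y by blast
  qed
  then have "covering_number r A \<le> card ?W"
    unfolding covering_number_def using assms(1) by (intro Least_le exI[of _ ?W]) simp
  also have "\<dots> \<le> card (cell a b ` A)" by (rule card_image_le[OF assms(1)])
  finally show ?thesis .
qed

text \<open>A square of side \<open>r\<close> meets at most 2 * 2 cells. Finiteness of
  \<open>A\<close> ensures that some finite cover exists, so that the least number is
  attained.\<close>

lemma covering_number_ge:
  fixes r :: real
  assumes "finite A" "0 \<le> r" "r \<le> real m ^ a" "r \<le> real n ^ b"
  shows "card (cell a b ` A) \<le> 4 * covering_number r A"
proof -
  let ?P = "\<lambda>N. \<exists>W. finite W \<and> card W = N \<and> real_pt ` A \<subseteq> (\<Union>w\<in>W. box_around w (r / 2))"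
  have "?P (card (real_pt ` A))"
  proof (intro exI conjI)
    have "w \<in> box_around w (r / 2)" for w
      using assms(2) by (cases w) (simp add: box_around_def)
    then show "real_pt ` A \<subseteq> (\<Union>w\<in>real_pt ` A. box_around w (r / 2))" by blast
  qed (use assms(1) in simp_all)
  then have "?P (covering_number r A)" unfolding covering_number_def by (rule LeastI)
  then obtain W where W: "finite W" "card W = covering_number r A"
    "real_pt ` A \<subseteq> (\<Union>w\<in>W. box_around w (r / 2))" by blast
  let ?S = "\<lambda>w. {y. real_pt y \<in> box_around w (r / 2)}"
  have S: "finite (cell a b ` ?S w) \<and> real (card (cell a b ` ?S w)) \<le> 4" for w
  proof -
    have "2 * (r / 2) \<le> real m ^ a" "2 * (r / 2) \<le> real n ^ b" using assms by simp_all
    then obtain X Y where XY: "cell a b ` ?S w \<subseteq> {X..X+1} \<times> {Y..Y+1}" by (rule cell_box)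
    have "card (cell a b ` ?S w) \<le> card ({X..X+1} \<times> {Y..Y+1})" by (rule card_mono[OF _ XY]) simp
    moreover have "finite (cell a b ` ?S w)" by (rule finite_subset[OF XY]) simp
    ultimately show ?thesis by (simp add: card_cartesian_product)
  qed
  have "A \<subseteq> (\<Union>w\<in>W. ?S w)" using W(3) by auto
  from card_image_UN_le(2)[OF W(1) this, of "cell a b" 4] S
  have "real (card (cell a b ` A)) \<le> real (card W) * 4" by blast
  then show ?thesis using W(2) by simp
qed

end

section \<open>Covers by cubes\<close>

lemma cube_diam_eqI:
  assumes "0 < r" "E \<subseteq> cube x r" "p \<in> E" "q \<in> E" "fst q - fst p = int r - 1"
  shows "cube_diam E = r"
  unfolding cube_diam_def
proof (rule Least_equality)
  show "0 < r \<and> (\<exists>x. E \<subseteq> cube x r)" using assms by blast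
  fix s assume "0 < s \<and> (\<exists>x. E \<subseteq> cube x s)"
  then obtain y where "E \<subseteq> cube y s" by blast
  then have "p \<in> cube y s" "q \<in> cube y s" using assms by blast+
  then show "r \<le> s" using assms(5) by (auto simp: cube_def)
qed

lemma cube_diam_cube: "0 < r \<Longrightarrow> cube_diam (cube x r) = r"
  by (rule cube_diam_eqI[of r _ x x "(fst x + int r - 1, snd x)"]) (auto simp: cube_def)

text \<open>The extreme points of the outer cube on the horizontal axis survive the removal of the
  inner cube, so the shell is as wide as the cube.\<close>

lemma cube_diam_shell: "cube_diam (shell (Suc (Suc k))) = 2 ^ Suc (Suc k)"
proof (rule cube_diam_eqI)
  show "shell (Suc (Suc k)) \<subseteq> cube (- (2 ^ Suc k), - (2 ^ Suc k)) (2 ^ Suc (Suc k))"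
    by (auto simp: mem_shell_iff cube_def nrm_less_iff)
  have nrm1: "nrm (- (2 ^ Suc k)) = 2 ^ Suc k - 1" "nrm (2 ^ Suc k - 1) = 2 ^ Suc k - 1"
    by (simp_all add: nrm_def)
  have k: "(2::int) ^ k \<le> 2 ^ Suc k - 1" by simp
  show "(- (2 ^ Suc k), 0) \<in> shell (Suc (Suc k))" "(2 ^ Suc k - 1, 0) \<in> shell (Suc (Suc k))"
    unfolding mem_shell_iff fst_conv snd_conv nrm1 using k by (simp_all add: nrm_def)
qed simp_all

lemma nu_bdd_below:
  "bdd_below {(\<Sum>U\<in>\<U>. (real (cube_diam U) / real (cube_diam F)) powr \<alpha>) | \<U>.
          finite \<U> \<and> \<U> \<subseteq> cubes \<and> A \<inter> F \<subseteq> \<Union>\<U>}"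
  by (rule bdd_belowI[of _ 0]) (auto intro!: sum_nonneg)

lemma nu_le:
  assumes "finite \<U>" "\<U> \<subseteq> cubes" "A \<inter> F \<subseteq> \<Union>\<U>"
  shows "nu \<alpha> A F \<le> (\<Sum>U\<in>\<U>. (real (cube_diam U) / real (cube_diam F)) powr \<alpha>)"
  unfolding nu_def by (rule cInf_lower[OF _ nu_bdd_below]) (use assms in blast)

text \<open>The cube around \<open>F\<close> provides a cover, so that the infimum is over a
  nonempty set of reals.\<close>

lemma nu_ge:
  assumes "\<And>\<U>. finite \<U> \<Longrightarrow> \<U> \<subseteq> cubes \<Longrightarrow> A \<inter> F \<subseteq> \<Union>\<U> \<Longrightarrow>
      c \<le> (\<Sum>U\<in>\<U>. (real (cube_diam U) / real (cube_diam F)) powr \<alpha>)"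
    and "F \<subseteq> cube x r" "0 < r"
  shows "c \<le> nu \<alpha> A F"
  unfolding nu_def
proof (rule cInf_greatest)
  have "finite {cube x r}" "{cube x r} \<subseteq> cubes" "A \<inter> F \<subseteq> \<Union>{cube x r}"
    using assms(2,3) unfolding cubes_def by (simp, blast, blast)
  then show "{(\<Sum>U\<in>\<U>. (real (cube_diam U) / real (cube_diam F)) powr \<alpha>) | \<U>.
          finite \<U> \<and> \<U> \<subseteq> cubes \<and> A \<inter> F \<subseteq> \<Union>\<U>} \<noteq> {}" by blast
qed (use assms(1) in blast)

lemma shell_subset_cube: "shell (Suc k) \<subseteq> cube (- (2 ^ k), - (2 ^ k)) (2 ^ Suc k)"
  using shell_subset_dyadic_cube[of "Suc k"] by (force simp: mem_dyadic_cube_iff cube_def nrm_less_iff)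

lemma nu_shell_nonneg: "0 \<le> nu \<alpha> A (shell (Suc k))"
  by (rule nu_ge[OF _ shell_subset_cube]) (auto intro!: sum_nonneg)

lemma finite_shell: "finite (shell k)"
proof (cases k)
  case 0
  have "shell 0 = {}" by (simp add: shell_def)
  then show ?thesis using 0 by simp
next
  case (Suc j)
  have "cube x r \<subseteq> {fst x..fst x + int r} \<times> {snd x..snd x + int r}" for x r
    by (auto simp: cube_def)
  then show ?thesis unfolding Suc using finite_subset[OF shell_subset_cube]
    by (meson finite_SigmaI finite_atLeastAtMost_int finite_subset)
qed

section \<open>Exponents\<close>

text \<open>\<open>X\<close> and \<open>Y\<close> are the logarithms of the outer and inner scale, \<open>\<kappa> = 1 / ln m\<close> and
  \<open>l = 1 / ln n\<close>.\<close>

definition gexp :: "real \<Rightarrow> real \<Rightarrow> real \<Rightarrow> real \<Rightarrow> real \<Rightarrow> real \<Rightarrow> real \<Rightarrow> real" where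
  "gexp \<kappa> l \<tau> \<sigma> h X Y =
     \<tau> * (min (l * Y) (\<kappa> * X) - \<kappa> * Y) + \<sigma> * max 0 (\<kappa> * X - l * Y) + h * (l * X - max (l * Y) (\<kappa> * X))"

text \<open>This is the case n^K <= r up to rounding: no freely varying second digit is seen, and
  only the ratio of the scales matters.\<close>

lemma gexp_outer:
  assumes "\<kappa> * X \<le> l * Y"
  shows "gexp \<kappa> l \<tau> \<sigma> h X Y = (\<kappa> * \<tau> + l * h) * (X - Y)"
  using assms by (simp add: gexp_def min_absorb2 max_absorb1 algebra_simps)

text \<open>The right side is arranged so that, for \<kappa> <= l and Y >= 0, the weights
  \<open>(l - \<kappa>) / \<kappa> * Y\<close> and \<open>X - l / \<kappa> * Y\<close> are
  nonnegative. They add up to \<open>X - Y\<close>, and \<open>convex_bounds\<close>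
  applies.\<close>

lemma gexp_inner:
  assumes "0 < \<kappa>" "l * Y \<le> \<kappa> * X"
  shows "gexp \<kappa> l \<tau> \<sigma> h X Y =
    (\<kappa> * \<tau> + l * h) * ((l - \<kappa>) / \<kappa> * Y) + (\<kappa> * (\<sigma> - h) + l * h) * (X - l / \<kappa> * Y)"
proof -
  have "gexp \<kappa> l \<tau> \<sigma> h X Y = \<tau> * (l * Y - \<kappa> * Y) + \<sigma> * (\<kappa> * X - l * Y) + h * (l * X - \<kappa> * X)"
    using assms(2) by (simp add: gexp_def min_absorb1 max_absorb2)
  also have "\<dots> = (\<kappa> * \<tau> + l * h) * ((l - \<kappa>) / \<kappa> * Y) + (\<kappa> * (\<sigma> - h) + l * h) * (X - l / \<kappa> * Y)"
    using assms(1) by (simp add: field_simps)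
  finally show ?thesis .
qed

lemma gexp_zero:
  assumes "0 < \<kappa>" "0 \<le> X"
  shows "gexp \<kappa> l \<tau> \<sigma> h X 0 = (\<kappa> * (\<sigma> - h) + l * h) * X"
  using gexp_inner[OF assms(1), of l 0 X \<tau> \<sigma> h] assms by simp

lemma convex_bounds:
  fixes d e w w' :: real
  assumes "0 \<le> w" "0 \<le> w'"
  shows "min e d * (w + w') \<le> d * w + e * w'" "d * w + e * w' \<le> max e d * (w + w')"
proof -
  have "min e d * w \<le> d * w" "min e d * w' \<le> e * w'" "d * w \<le> max e d * w" "e * w' \<le> max e d * w'"
    using assms by (intro mult_right_mono; simp)+
  then show "min e d * (w + w') \<le> d * w + e * w'" "d * w + e * w' \<le> max e d * (w + w')"
    by (simp_all add: distrib_left)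
qed

lemma gexp_bounds:
  fixes \<tau> \<sigma> h :: real
  assumes "0 < \<kappa>" "\<kappa> \<le> l" "0 \<le> Y" "Y \<le> X"
  defines "e \<equiv> \<kappa> * (\<sigma> - h) + l * h" and "d \<equiv> \<kappa> * \<tau> + l * h"
  shows "min e d * (X - Y) \<le> gexp \<kappa> l \<tau> \<sigma> h X Y" "gexp \<kappa> l \<tau> \<sigma> h X Y \<le> max e d * (X - Y)"
proof -
  have "min e d * (X - Y) \<le> gexp \<kappa> l \<tau> \<sigma> h X Y \<and> gexp \<kappa> l \<tau> \<sigma> h X Y \<le> max e d * (X - Y)"
  proof (cases "\<kappa> * X \<le> l * Y")
    case True
    show ?thesis
      unfolding gexp_outer[OF True] d_def[symmetric]
      using assms(4) by (intro conjI mult_right_mono) simp_all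
  next
    case False
    let ?w = "(l - \<kappa>) / \<kappa> * Y" and ?w' = "X - l / \<kappa> * Y"
    have "0 \<le> ?w" using assms(1-3) by simp
    moreover have "0 \<le> ?w'" using assms(1) False by (simp add: field_simps)
    moreover have s: "?w + ?w' = X - Y" using assms(1) by (simp add: field_simps)
    moreover have g: "gexp \<kappa> l \<tau> \<sigma> h X Y = d * ?w + e * ?w'"
      unfolding d_def e_def by (rule gexp_inner) (use assms(1) False in simp_all)
    ultimately show ?thesis
      unfolding g s[symmetric] by (intro conjI convex_bounds)
  qed
  then show "min e d * (X - Y) \<le> gexp \<kappa> l \<tau> \<sigma> h X Y" "gexp \<kappa> l \<tau> \<sigma> h X Y \<le> max e d * (X - Y)"
    by blast+
qed

lemma real_nat_diff: "real (p - q) = max 0 (real p - real q)"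
  by (simp add: max_def of_nat_diff)

lemma ln_cprod:
  assumes "1 \<le> A" "1 \<le> B" "1 \<le> H"
  shows "ln (cprod A B H a b K L) =
    ln A * max 0 (min (real b) K - a) + ln B * max 0 (real K - b) + ln H * max 0 (L - max (real b) K)"
  using assms
  by (simp add: cprod_def ln_mult ln_realpow real_nat_diff[symmetric] of_nat_min[symmetric] of_nat_max[symmetric]
      del: of_nat_min of_nat_max)

lemma abs_diff_add3:
  fixes x y x' y' x'' y'' :: real
  assumes "\<bar>x - y\<bar> \<le> a" "\<bar>x' - y'\<bar> \<le> b" "\<bar>x'' - y''\<bar> \<le> c"
  shows "\<bar>x + x' + x'' - (y + y' + y'')\<bar> \<le> a + b + c"
  using assms by linarith

text \<open>Each range of positions has two ends, each with error \<open>c\<close>, hence 2 * c. The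
  alternative \<open>H = 1\<close> is for the words at the origin with \<open>eta\<close> equal to
  1, which end at L = K instead of log_n R.\<close>

lemma ln_cprod_near:
  assumes "1 \<le> A" "1 \<le> B" "1 \<le> H"
    and "\<bar>real a - \<kappa> * Y\<bar> \<le> c" "\<bar>real b - l * Y\<bar> \<le> c" "\<bar>real K - \<kappa> * X\<bar> \<le> c"
    and "H = 1 \<or> \<bar>real L - l * X\<bar> \<le> c"
    and "0 < \<kappa>" "\<kappa> \<le> l" "0 \<le> Y" "Y \<le> X"
  shows "\<bar>ln (cprod A B H a b K L) - gexp \<kappa> l (ln A) (ln B) (ln H) X Y\<bar> \<le> 2 * c * (ln A + ln B + ln H)"
proof -
  have *: "\<kappa> * Y \<le> l * Y" "\<kappa> * X \<le> l * X" "\<kappa> * Y \<le> \<kappa> * X" "l * Y \<le> l * X"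
    using assms(8-11) by (simp_all add: mult_right_mono)
  have 1: "\<bar>max 0 (min (real b) K - a) - (min (l * Y) (\<kappa> * X) - \<kappa> * Y)\<bar> \<le> 2 * c"
    using assms(4-6) * by linarith
  have 2: "\<bar>max 0 (real K - b) - max 0 (\<kappa> * X - l * Y)\<bar> \<le> 2 * c"
    using assms(5,6) by linarith
  have 3: "H = 1 \<or> \<bar>max 0 (L - max (real b) K) - (l * X - max (l * Y) (\<kappa> * X))\<bar> \<le> 2 * c"
    using assms(5-7) * by linarith
  have m: "\<bar>s * x - s * y\<bar> \<le> 2 * c * s" if "0 \<le> s" "\<bar>x - y\<bar> \<le> 2 * c" for s x y :: real
  proof -
    have "\<bar>s * x - s * y\<bar> = \<bar>x - y\<bar> * s"
      using that(1) by (simp only: right_diff_distrib[symmetric] abs_mult abs_of_nonneg mult.commute)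
    then show ?thesis using mult_right_mono[OF that(2,1)] by simp
  qed
  have h3: "\<bar>ln H * max 0 (L - max (real b) K) - ln H * (l * X - max (l * Y) (\<kappa> * X))\<bar> \<le> 2 * c * ln H"
    using 3 m[of "ln H"] assms(3) by auto
  have "0 \<le> ln A" "0 \<le> ln B" using assms(1,2) by simp_all
  from abs_diff_add3[OF m[OF this(1) 1] m[OF this(2) 2] h3] show ?thesis
    unfolding ln_cprod[OF assms(1-3)] gexp_def distrib_left .
qed

section \<open>Rounded logarithms and power bounds for \<open>cprod\<close>\<close>

definition lo :: "nat \<Rightarrow> real \<Rightarrow> nat" where "lo b r = nat \<lfloor>log b r\<rfloor>"

lemma lo_bounds:
  assumes "2 \<le> b" "1 \<le> r"
  shows "real b ^ lo b r \<le> r" "r < real b ^ Suc (lo b r)"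
    "\<bar>real (lo b r) - log b r\<bar> \<le> 1" "\<bar>real (Suc (lo b r)) - log b r\<bar> \<le> 1"
proof -
  have "0 \<le> log b r" using assms by simp
  then have *: "real (lo b r) = \<lfloor>log b r\<rfloor>" by (simp add: lo_def)
  then have le: "real (lo b r) \<le> log b r" and lt: "log b r < real (Suc (lo b r))" by linarith+
  show "\<bar>real (lo b r) - log b r\<bar> \<le> 1" "\<bar>real (Suc (lo b r)) - log b r\<bar> \<le> 1"
    using le lt by simp_all
  have r: "r = real b powr log b r" using assms by simp
  have "real b powr real (lo b r) \<le> real b powr log b r" using le assms by (intro powr_mono) simp_all
  then show "real b ^ lo b r \<le> r" unfolding r[symmetric] using assms by (simp add: powr_realpow)
  have "real b powr log b r < real b powr real (Suc (lo b r))" using lt assms by (intro powr_less_mono) simp_all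
  then show "r < real b ^ Suc (lo b r)" unfolding r[symmetric] using assms by (simp add: powr_realpow del: of_nat_Suc power_Suc)
qed

lemma lo_mono: "2 \<le> b \<Longrightarrow> 0 < r \<Longrightarrow> r \<le> R \<Longrightarrow> lo b r \<le> lo b R"
  unfolding lo_def by (intro nat_mono floor_mono) simp

lemma log_base_mono:
  assumes "1 < (n::real)" "n \<le> m" "1 \<le> r"
  shows "log m r \<le> log n r"
  unfolding log_def using assms by (intro divide_left_mono mult_pos_pos) simp_all

context carpet
begin

lemma lo_base_mono: "1 \<le> r \<Longrightarrow> lo m r \<le> lo n r"
  unfolding lo_def using two_le_n n_less_m by (intro nat_mono floor_mono log_base_mono) simp_all

text \<open>Exponents of the cell count: \<open>dimM\<close> belongs to the inner scale 1,
  \<open>dimA\<close> to inner scales so coarse that no second digit below position \<open>K\<close>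
  is seen. \<open>H\<close> will be \<open>eta\<close> or the size of the fullest column.\<close>

definition dimM :: "real \<Rightarrow> real \<Rightarrow> real" where "dimM B H = log m B - log m H + log n H"
definition dimA :: "real \<Rightarrow> real \<Rightarrow> real" where "dimA A H = log m A + log n H"

lemma exp_mult_ln: "0 < x \<Longrightarrow> exp (d * ln x) = x powr (d::real)"
  by (simp add: powr_def)

text \<open>All rounding of the four scales goes into the constant, which depends on neither
  \<open>r\<close> nor \<open>R\<close>.\<close>

lemma cprod_est:
  assumes A: "1 \<le> A" "1 \<le> B" "1 \<le> H" and r: "1 \<le> r" "r \<le> R"
    and near: "\<bar>real a - log m r\<bar> \<le> c" "\<bar>real b - log n r\<bar> \<le> c" "\<bar>real K - log m R\<bar> \<le> c"
      "H = 1 \<or> \<bar>real L - log n R\<bar> \<le> c"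
  defines "C \<equiv> exp (2 * c * (ln A + ln B + ln H))" and "P \<equiv> cprod A B H a b K L"
  shows "P \<le> C * (R / r) powr max (dimM B H) (dimA A H)"
    "(R / r) powr min (dimM B H) (dimA A H) \<le> C * P"
    "r = 1 \<Longrightarrow> P \<le> C * R powr dimM B H"
    "r = 1 \<Longrightarrow> R powr dimM B H \<le> C * P"
    "log m R \<le> log n r \<Longrightarrow> P \<le> C * (R / r) powr dimA A H"
    "log m R \<le> log n r \<Longrightarrow> (R / r) powr dimA A H \<le> C * P"
proof -
  define \<kappa> l g where "\<kappa> = 1 / ln (real m)" and "l = 1 / ln (real n)"
    and "g = gexp \<kappa> l (ln A) (ln B) (ln H) (ln R) (ln r)"
  have kl: "0 < \<kappa>" "\<kappa> \<le> l"
    unfolding \<kappa>_def l_def using two_le_n n_less_m by (simp_all add: divide_left_mono)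
  have X: "0 \<le> ln r" "ln r \<le> ln R" "0 \<le> ln R" using r by simp_all
  have P: "0 < P" unfolding P_def using cprod_ge_1[OF A] by (rule less_le_trans[OF zero_less_one])
  have dM: "\<kappa> * (ln B - ln H) + l * ln H = dimM B H"
    by (simp add: dimM_def \<kappa>_def l_def log_def diff_divide_distrib)
  have dA: "\<kappa> * ln A + l * ln H = dimA A H"
    by (simp add: dimA_def \<kappa>_def l_def log_def)
  have *: "\<bar>ln P - g\<bar> \<le> 2 * c * (ln A + ln B + ln H)"
    unfolding P_def g_def using A near kl X
    by (intro ln_cprod_near) (simp_all add: \<kappa>_def l_def log_def)
  have up: "P \<le> C * x powr d" if "g \<le> d * ln x" "0 < x" for d x
  proof -
    have "P = exp (ln P)" using P by simp
    also have "\<dots> \<le> exp (2 * c * (ln A + ln B + ln H) + d * ln x)" using * that(1) by simp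
    finally show ?thesis using that(2) by (simp add: C_def exp_add exp_mult_ln)
  qed
  have low: "x powr d \<le> C * P" if "d * ln x \<le> g" "0 < x" for d x
  proof -
    have "x powr d = exp (d * ln x)" using that(2) by (simp add: exp_mult_ln)
    also have "\<dots> \<le> exp (2 * c * (ln A + ln B + ln H) + ln P)" using * that(1) by simp
    finally show ?thesis using P by (simp add: C_def exp_add)
  qed
  have q: "0 < R / r" "ln (R / r) = ln R - ln r" "0 < R" using r by (simp_all add: ln_div)
  note gb = gexp_bounds[OF kl X(1,2), where \<sigma> = "ln B" and h = "ln H" and \<tau> = "ln A", unfolded dM dA, folded g_def]
  show "P \<le> C * (R / r) powr max (dimM B H) (dimA A H)" by (rule up) (use gb q in simp_all)
  show "(R / r) powr min (dimM B H) (dimA A H) \<le> C * P" by (rule low) (use gb q in simp_all)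
  show "P \<le> C * R powr dimM B H" if "r = 1"
    by (rule up) (use gexp_zero[OF kl(1) X(3), of l "ln A" "ln B" "ln H"] that q dM g_def in simp_all)
  show "R powr dimM B H \<le> C * P" if "r = 1"
    by (rule low) (use gexp_zero[OF kl(1) X(3), of l "ln A" "ln B" "ln H"] that q dM g_def in simp_all)
  have o: "g = dimA A H * ln (R / r)" if "log m R \<le> log n r"
    unfolding g_def q(2) dA[symmetric] by (rule gexp_outer) (use that in \<open>simp add: \<kappa>_def l_def log_def\<close>)
  show "P \<le> C * (R / r) powr dimA A H" if "log m R \<le> log n r"
    by (rule up) (use o[OF that] q in simp_all)
  show "(R / r) powr dimA A H \<le> C * P" if "log m R \<le> log n r"
    by (rule low) (use o[OF that] q in simp_all)
qed

end

section \<open>Mass, Beurling and Assouad dimensions\<close>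

lemma abs_le_nrm: "\<bar>x\<bar> \<le> nrm x + 1" "nrm x \<le> \<bar>x\<bar>"
  by (auto simp: nrm_def)

lemma finite_box_points: "finite {y. real_pt y \<in> box_around w h}"
proof (rule finite_subset)
  show "{y. real_pt y \<in> box_around w h} \<subseteq>
      {\<lfloor>fst w - h\<rfloor>..\<lceil>fst w + h\<rceil>} \<times> {\<lfloor>snd w - h\<rfloor>..\<lceil>snd w + h\<rceil>}"
  proof
    fix y assume "y \<in> {y. real_pt y \<in> box_around w h}"
    then have "fst w - h \<le> fst y" "fst y \<le> fst w + h" "snd w - h \<le> snd y" "snd y \<le> snd w + h"
      by (auto simp: box_around_def real_pt_def)
    then show "y \<in> {\<lfloor>fst w - h\<rfloor>..\<lceil>fst w + h\<rceil>} \<times> {\<lfloor>snd w - h\<rfloor>..\<lceil>snd w + h\<rceil>}"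
      unfolding mem_Times_iff atLeastAtMost_iff by linarith
  qed
qed simp

lemma log_card_div:
  assumes "0 < card S" "1 < h"
  shows "log_card S / ereal (ln h) = ereal (ln (card S) / ln h)"
  using assms by (simp add: log_card_def)

text \<open>Serves the mass dimension, with a one-element index set, and the Beurling dimension,
  with all centres. The factor \<open>2 + ln h\<close> leaves room for the number of levels and
  disappears after division by \<open>ln h\<close>.\<close>

lemma log_card_limit:
  fixes S :: "real \<Rightarrow> 'i \<Rightarrow> 'b set" and C D :: real
  assumes "0 < C" and low: "\<forall>\<^sub>F h in at_top. \<exists>i\<in>I. h powr D \<le> C * card (S h i)"
    and up: "\<forall>\<^sub>F h in at_top. \<forall>i\<in>I. card (S h i) \<le> C * (2 + ln h) * h powr D"
  shows "((\<lambda>h. SUP i\<in>I. log_card (S h i) / ereal (ln h)) \<longlongrightarrow> ereal D) at_top"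
proof (rule tendsto_sandwich)
  have ln1: "\<forall>\<^sub>F h in at_top. (1::real) < h" by (rule eventually_gt_at_top)
  show "\<forall>\<^sub>F h in at_top. ereal ((D * ln h - ln C) / ln h) \<le> (SUP i\<in>I. log_card (S h i) / ereal (ln h))"
    using low ln1
  proof eventually_elim
    case (elim h)
    then obtain i where i: "i \<in> I" "h powr D \<le> C * card (S h i)" by blast
    have p: "0 < h powr D" using elim by simp
    then have c: "0 < card (S h i)" using i(2) by (cases "card (S h i) = 0") auto
    have "ln (h powr D) \<le> ln (C * card (S h i))" using i(2) p by (intro ln_mono) auto
    then have "D * ln h - ln C \<le> ln (card (S h i))"
      using c assms(1) elim by (simp add: ln_mult ln_powr)
    then have "ereal ((D * ln h - ln C) / ln h) \<le> log_card (S h i) / ereal (ln h)"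
      unfolding log_card_div[OF c elim(2)] using elim(2) by (simp add: divide_right_mono)
    also have "\<dots> \<le> (SUP i\<in>I. log_card (S h i) / ereal (ln h))" by (rule SUP_upper[OF i(1)])
    finally show ?case .
  qed
  show "\<forall>\<^sub>F h in at_top. (SUP i\<in>I. log_card (S h i) / ereal (ln h))
      \<le> ereal ((D * ln h + ln C + ln (2 + ln h)) / ln h)"
    using up ln1
  proof eventually_elim
    case (elim h)
    show ?case
    proof (rule SUP_least)
      fix i assume i: "i \<in> I"
      show "log_card (S h i) / ereal (ln h) \<le> ereal ((D * ln h + ln C + ln (2 + ln h)) / ln h)"
      proof (cases "card (S h i) = 0")
        case True
        then show ?thesis using elim(2) by (simp add: log_card_def divide_ereal_def)
      next
        case False
        then have c: "0 < card (S h i)" by simp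
        have "0 < ln h" using elim(2) by simp
        then have "0 < 2 + ln h" by simp
        have "ln (card (S h i)) \<le> ln (C * (2 + ln h) * h powr D)"
          using elim(1) i c by (intro ln_mono) auto
        also have "\<dots> = D * ln h + ln C + ln (2 + ln h)"
          using assms(1) elim(2) \<open>0 < 2 + ln h\<close> by (simp add: ln_mult ln_powr)
        finally show ?thesis
          unfolding log_card_div[OF c elim(2)] using elim(2) by (simp add: divide_right_mono)
      qed
    qed
  qed
  have "((\<lambda>h. (D * ln h - ln C) / ln h) \<longlongrightarrow> D) at_top" by real_asymp
  then show "((\<lambda>h. ereal ((D * ln h - ln C) / ln h)) \<longlongrightarrow> ereal D) at_top" by simp
  have "((\<lambda>h. (D * ln h + ln C + ln (2 + ln h)) / ln h) \<longlongrightarrow> D) at_top" by real_asymp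
  then show "((\<lambda>h. ereal ((D * ln h + ln C + ln (2 + ln h)) / ln h)) \<longlongrightarrow> ereal D) at_top" by simp
qed

lemma Inf_ereal_image_eqI:
  assumes "\<And>\<alpha>. \<alpha> \<in> S \<Longrightarrow> D \<le> \<alpha>" "\<And>\<alpha>. D < \<alpha> \<Longrightarrow> \<alpha> \<in> S"
  shows "Inf (ereal ` S) = ereal D"
proof (rule antisym)
  show "ereal D \<le> Inf (ereal ` S)" using assms(1) by (intro Inf_greatest) auto
  show "Inf (ereal ` S) \<le> ereal D"
  proof (rule ereal_le_epsilon2)
    fix e :: real assume "0 < e"
    then have "ereal (D + e) \<in> ereal ` S" using assms(2) by simp
    then show "Inf (ereal ` S) \<le> ereal D + ereal e" by (simp add: Inf_lower)
  qed
qed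

lemma lo_le:
  assumes "2 \<le> b" "1 \<le> h" "1 \<le> r" "r \<le> 2 * h"
  shows "real (Suc (lo b r)) \<le> 2 * (2 + ln h)"
proof -
  have "log b r \<le> log 2 r" using assms by (intro log_base_mono) auto
  also have "\<dots> \<le> log 2 (2 * h)" using assms by simp
  also have "\<dots> = 1 + ln h / ln 2" using assms by (simp add: log_def ln_mult add_divide_distrib)
  finally have 1: "log b r \<le> 1 + ln h / ln 2" .
  have "1 / ln 2 \<le> (2::real)" using ln2_ge_two_thirds by (simp add: field_simps)
  then have 2: "ln h / ln 2 \<le> ln h * 2" using mult_left_mono[of "1 / ln 2" 2 "ln h"] assms by simp
  have "log b r \<le> 1 + ln h * 2" using order_trans[OF 1 add_left_mono[OF 2]] .
  moreover have "real (Suc (lo b r)) \<le> 1 + log b r" using lo_bounds(4)[OF assms(1,3)] by (simp add: abs_le_iff)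
  ultimately have "real (Suc (lo b r)) \<le> 2 + ln h * 2" by linarith
  then show ?thesis by simp
qed

context carpet
begin

section \<open>Words and boxes at the origin; the mass dimension\<close>

lemma num_cols_real: "1 \<le> real (num_cols m \<Lambda>)" "1 \<le> real (card \<Lambda>)" "1 \<le> real (max_col m \<Lambda>)"
    "1 \<le> real (eta m \<Lambda> u)"
  using num_cols_ge_1 card_digits_ge_1 max_col_ge_1 eta_ge_1[of u] by simp_all

lemma card_cell_00: "cell 0 0 ` S = S"
  by (simp add: cell_def)

lemma origin_box_count:
  assumes "1 \<le> h" "S \<subseteq> orbit z" "\<And>p. p \<in> S \<Longrightarrow> nrm (fst p) < int m ^ K \<and> nrm (snd p) < int n ^ L"
    and "a \<le> b" "a \<le> K" "K \<le> L" "b \<le> L" "1 \<le> L"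
  shows "finite (cell a b ` S)"
    "real (card (cell a b ` S)) \<le> L * cprod (num_cols m \<Lambda>) (card \<Lambda>) (eta m \<Lambda> (fst z)) a b K L"
proof -
  have "cell K L p \<in> {-1, 0} \<times> {-1, 0}" if "p \<in> S" for p
  proof -
    have "nrm (fst p) < int m ^ K" "nrm (snd p) < int n ^ L" using assms(3)[OF that] by simp_all
    then have "fst p div int m ^ K \<in> {-1, 0}" "snd p div int n ^ L \<in> {-1, 0}"
      using nrm_div_eq_0_iff[of "int m ^ K" "fst p"] nrm_div_eq_0_iff[of "int n ^ L" "snd p"] m_pos n_pos
      by simp_all
    then show ?thesis by (simp only: cell_def mem_Times_iff fst_conv snd_conv)
  qed
  then have "S \<subseteq> {p \<in> orbit z. cell K L p \<in> {-1, 0} \<times> {-1, 0}}" using assms(2) by blast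
  from origin_count[OF assms(4-8) this]
  show "finite (cell a b ` S)"
    "real (card (cell a b ` S)) \<le> L * cprod (num_cols m \<Lambda>) (card \<Lambda>) (eta m \<Lambda> (fst z)) a b K L" .
qed

definition main_col :: "int \<Rightarrow> nat \<Rightarrow> bool" where
  "main_col u e \<longleftrightarrow> e \<in> cols \<and>
     (eta m \<Lambda> u \<noteq> 1 \<longrightarrow> u \<in> {-1, 0} \<and> (\<forall>l. dig m l u = e) \<and> col_count \<Lambda> e = eta m \<Lambda> u)"

lemma dig_fixed: "u \<in> {-1, 0} \<Longrightarrow> dig m l u = dig m 0 u"
proof -
  have "(- 1::int) div int m ^ l = -1" using m_pos by (intro div_eq_minus1) simp
  then show "u \<in> {-1, 0} \<Longrightarrow> dig m l u = dig m 0 u" by (auto simp: dig_def)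
qed

lemma main_col_exists: obtains e where "main_col u e"
proof (cases "eta m \<Lambda> u = 1")
  case True
  have "cols \<noteq> {}" using digits_nonempty by (simp add: cols_eq)
  then show ?thesis using that True by (auto simp: main_col_def)
next
  case False
  then have u: "u \<in> {-1, 0}" using eta_eq_1 by blast
  have c: "col_count \<Lambda> (dig m 0 u) = eta m \<Lambda> u"
    using eta_fixed[OF u, of 0] False by (simp add: max_def split: if_splits)
  then have "0 < col_count \<Lambda> (dig m 0 u)" using eta_ge_1[of u] by simp
  then have "dig m 0 u \<in> cols" by (simp add: nonempty_cols_def dig_less[OF m_pos])
  then have "main_col u (dig m 0 u)" using u c dig_fixed[OF u] by (simp add: main_col_def)
  then show ?thesis by (rule that)
qed

lemma cprod_LK: "cprod A B H a b K K = cprod A B H' a b K K"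
  by (simp add: cprod_def)

lemma words_origin_count:
  assumes "a \<le> b" "K \<le> L" "main_col u e" "eta m \<Lambda> u = 1 \<Longrightarrow> L = K"
  shows "cprod (num_cols m \<Lambda>) (card \<Lambda>) (eta m \<Lambda> u) a b K L \<le> card (cell a b ` pt L z ` words K L e)"
proof -
  have "e \<in> cols" using assms(3) by (simp add: main_col_def)
  note * = words_cell_count[OF assms(1,2) this, of z]
  show ?thesis
  proof (cases "eta m \<Lambda> u = 1")
    case True
    then show ?thesis using * assms(4) cprod_LK[of _ _ "eta m \<Lambda> u" a b K "col_count \<Lambda> e"] by simp
  next
    case False
    then show ?thesis using * assms(3) by (simp add: main_col_def)
  qed
qed

lemma words_origin_nrm:
  assumes "K \<le> L" "main_col u e" "eta m \<Lambda> u = 1 \<Longrightarrow> L = K" "d \<in> words K L e"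
  shows "nrm (fst (pt L (u, v) d)) div int m ^ K = nrm u" "nrm (snd (pt L (u, v) d)) div int n ^ L = nrm v"
proof -
  have c: "cell L L (pt L (u, v) d) = (u, v)" by (rule cell_pt[OF assms(4)])
  then have "snd (pt L (u, v) d) div int n ^ L = v" by (simp add: cell_def)
  then show "nrm (snd (pt L (u, v) d)) div int n ^ L = nrm v"
    using nrm_div[of "int n ^ L" "snd (pt L (u, v) d)"] n_pos by simp
  have "fst (pt L (u, v) d) div int m ^ K = u"
  proof (cases "eta m \<Lambda> u = 1")
    case True
    then show ?thesis using c assms(3) by (simp add: cell_def)
  next
    case False
    then show ?thesis using pt_fixed[OF assms(4,1), of u v] assms(2) by (simp add: main_col_def)
  qed
  then show "nrm (fst (pt L (u, v) d)) div int m ^ K = nrm u"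
    using nrm_div[of "int m ^ K" "fst (pt L (u, v) d)"] m_pos by simp
qed

lemma nrm_div_less:
  assumes "nrm x div int b ^ K = c" "0 < b"
  shows "nrm x < int b ^ K * (c + 1)"
  using div_bounds(2)[OF _ assms(1)] assms(2) by simp

lemma words_nonempty:
  assumes "e \<in> cols" shows "words K L e \<noteq> {}"
proof -
  obtain c where "c \<in> column e" using assms by (auto simp: cols_eq)
  then have "restrict (\<lambda>_. c) {..<L} \<in> words K L e" by (auto simp: words_def restrict_PiE_iff)
  then show ?thesis by blast
qed

lemma pt_orbit: "d \<in> words K L e \<Longrightarrow> 1 \<le> L \<Longrightarrow> pt L z d \<in> orbit z"
  unfolding mem_orbit_iff using pt_level by blast

lemma dimM_eq: "1 \<le> B \<Longrightarrow> 1 \<le> H \<Longrightarrow> dimM B H = log m (B / H) + log n H"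
  by (simp add: dimM_def log_divide)

lemma mass_limit:
  "((\<lambda>h. log_card {y \<in> orbit (u, v). real_pt y \<in> box_around (0, 0) h} / ereal (ln h))
     \<longlongrightarrow> ereal (dimM (card \<Lambda>) (eta m \<Lambda> u))) at_top"
proof -
  let ?D = "dimM (card \<Lambda>) (eta m \<Lambda> u)"
  let ?S = "\<lambda>h. {y \<in> orbit (u, v). real_pt y \<in> box_around (0, 0) h}"
  let ?P = "cprod (num_cols m \<Lambda>) (card \<Lambda>) (eta m \<Lambda> u) 0 0"
  define C0 where "C0 = exp (2 * 1 * (ln (num_cols m \<Lambda>) + ln (card \<Lambda>) + ln (eta m \<Lambda> u)))"
  \<comment> \<open>Words from (u, v) have coordinates below m^K (nrm u + 1) and n^L (nrm v + 1), at
    most \<open>V\<close> times the scale; the lower bound therefore works at scale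
    \<open>h / V\<close>.\<close>
  define V where "V = real_of_int (1 + nrm u + nrm v)"
  define C where "C = max (2 * C0) (C0 * V powr ?D)"
  note one = num_cols_real(1,2) num_cols_real(4)[of u]
  have C0: "0 < C0" by (simp add: C0_def)
  have V: "1 \<le> V" by (simp add: V_def)
  note est = cprod_est[OF one order_refl, where a = 0 and b = 0 and c = 1, folded C0_def]
  have low: "h powr ?D \<le> C * card (?S h)" if h: "V * m \<le> h" for h
  proof -
    define t where "t = h / V"
    have t: "m \<le> t" "h = V * t" using h V by (simp_all add: t_def field_simps)
    then have t1: "1 \<le> t" using m_pos by linarith
    define K where "K = lo m t"
    define L where "L = (if eta m \<Lambda> u = 1 then K else lo n t)"
    have KL: "K \<le> L" using lo_base_mono[OF t1] by (simp add: L_def K_def)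
    \<comment> \<open>The orbit begins with level 1, so the words must not be empty; hence the
      threshold \<open>V * m\<close>.\<close>
    have K1: "1 \<le> K"
      using t lo_mono[OF two_le_m, of m t] m_pos two_le_m by (simp add: K_def lo_def)
    obtain e where e: "main_col u e" by (rule main_col_exists)
    have LK: "eta m \<Lambda> u = 1 \<Longrightarrow> L = K" by (simp add: L_def)
    let ?E = "pt L (u, v) ` words K L e"
    have mK: "real m ^ K \<le> t" unfolding K_def by (rule lo_bounds(1)[OF two_le_m t1])
    have nL: "real n ^ L \<le> t"
    proof (cases "eta m \<Lambda> u = 1")
      case True
      have "real n ^ K \<le> real m ^ K" using n_less_m by (intro power_mono) simp_all
      then show ?thesis using mK True by (simp add: L_def)
    next
      case False
      then show ?thesis using lo_bounds(1)[OF two_le_n t1] by (simp add: L_def)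
    qed
    have "?E \<subseteq> ?S h"
    proof (rule image_subsetI)
      fix d assume d: "d \<in> words K L e"
      note nr = words_origin_nrm[OF KL e LK d, of v]
      have x: "\<bar>fst (pt L (u, v) d)\<bar> \<le> int m ^ K * (nrm u + 1)"
        using nrm_div_less[OF nr(1) m_pos] abs_le_nrm(1)[of "fst (pt L (u, v) d)"] by linarith
      have y: "\<bar>snd (pt L (u, v) d)\<bar> \<le> int n ^ L * (nrm v + 1)"
        using nrm_div_less[OF nr(2) n_pos] abs_le_nrm(1)[of "snd (pt L (u, v) d)"] by linarith
      have "real_of_int \<bar>fst (pt L (u, v) d)\<bar> \<le> real_of_int (int m ^ K * (nrm u + 1))"
        using x by (simp only: of_int_le_iff)
      also have "\<dots> \<le> t * V" unfolding of_int_mult using mK t1 by (intro mult_mono) (simp_all add: V_def)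
      finally have x': "real_of_int \<bar>fst (pt L (u, v) d)\<bar> \<le> h" using t by (simp add: mult.commute)
      have "real_of_int \<bar>snd (pt L (u, v) d)\<bar> \<le> real_of_int (int n ^ L * (nrm v + 1))"
        using y by (simp only: of_int_le_iff)
      also have "\<dots> \<le> t * V" unfolding of_int_mult using nL t1 by (intro mult_mono) (simp_all add: V_def)
      finally have y': "real_of_int \<bar>snd (pt L (u, v) d)\<bar> \<le> h" using t by (simp add: mult.commute)
      have "real_pt (pt L (u, v) d) \<in> box_around (0, 0) h"
        using x' y' by (simp add: box_around_def real_pt_def abs_le_iff)
      moreover have "pt L (u, v) d \<in> orbit (u, v)" by (rule pt_orbit[OF d]) (use K1 KL in simp)
      ultimately show "pt L (u, v) d \<in> ?S h" by blast
    qed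
    then have "card ?E \<le> card (?S h)"
      by (rule card_mono[rotated]) (rule finite_subset[OF _ finite_box_points], blast)
    moreover have "?P K L \<le> card ?E"
      using words_origin_count[OF order_refl KL e LK, of 0 "(u, v)"] unfolding card_cell_00 .
    ultimately have PE: "?P K L \<le> card (?S h)" by linarith
    have "t powr ?D \<le> C0 * ?P K L"
      by (rule est(4)[OF t1]) (use lo_bounds(3)[OF two_le_m t1] lo_bounds(3)[OF two_le_n t1] in
          \<open>auto simp: K_def L_def\<close>)
    also have "\<dots> \<le> C0 * card (?S h)" using PE C0 by simp
    finally have "V powr ?D * t powr ?D \<le> V powr ?D * (C0 * card (?S h))" by (intro mult_left_mono) simp_all
    also have "V powr ?D * t powr ?D = h powr ?D" using t(2) V t1 by (simp add: powr_mult)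
    also have "V powr ?D * (C0 * card (?S h)) = (C0 * V powr ?D) * card (?S h)" by simp
    also have "\<dots> \<le> C * card (?S h)" unfolding C_def by (intro mult_right_mono) simp_all
    finally show ?thesis .
  qed
  have up: "card (?S h) \<le> C * (2 + ln h) * h powr ?D" if h: "1 \<le> h" for h
  proof -
    define K L where "K = Suc (lo m h)" and "L = Suc (lo n h)"
    have KL: "K \<le> L" using lo_base_mono[OF h] by (simp add: L_def K_def)
    have "nrm (fst p) < int m ^ K \<and> nrm (snd p) < int n ^ L" if "p \<in> ?S h" for p
    proof -
      have "\<bar>real_of_int (fst p)\<bar> \<le> h" "\<bar>real_of_int (snd p)\<bar> \<le> h"
        using that by (auto simp: box_around_def real_pt_def)
      moreover have "h < real m ^ K" "h < real n ^ L"
        unfolding K_def L_def using lo_bounds(2)[OF two_le_m h] lo_bounds(2)[OF two_le_n h] .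
      ultimately have "real_of_int \<bar>fst p\<bar> < real_of_int (int m ^ K)" "real_of_int \<bar>snd p\<bar> < real_of_int (int n ^ L)"
        by simp_all
      then show ?thesis
        unfolding of_int_less_iff using abs_le_nrm(2)[of "fst p"] abs_le_nrm(2)[of "snd p"] by linarith
    qed
    then have "real (card (cell 0 0 ` ?S h)) \<le> L * ?P K L"
      using origin_box_count(2)[OF h, of "?S h" "(u, v)" K L 0 0] KL by (auto simp: L_def)
    then have "card (?S h) \<le> L * ?P K L" unfolding card_cell_00 .
    also have "\<dots> \<le> (2 * (2 + ln h)) * (C0 * h powr ?D)"
    proof (rule mult_mono)
      show "real L \<le> 2 * (2 + ln h)" unfolding L_def by (rule lo_le[OF two_le_n]) (use h in simp_all)
      show "?P K L \<le> C0 * h powr ?D"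
        by (rule est(3)[OF h]) (use lo_bounds(4)[OF two_le_m h] lo_bounds(4)[OF two_le_n h] in
            \<open>auto simp: K_def L_def\<close>)
      show "0 \<le> ?P K L" using cprod_ge_1[OF one, of 0 0 K L] by simp
    qed (use h in simp)
    also have "\<dots> = (2 * C0) * ((2 + ln h) * h powr ?D)" by simp
    also have "\<dots> \<le> C * ((2 + ln h) * h powr ?D)"
      unfolding C_def using h by (intro mult_right_mono) simp_all
    finally show ?thesis by (simp add: mult.assoc)
  qed
  have "((\<lambda>h. SUP i\<in>{()}. log_card (?S h) / ereal (ln h)) \<longlongrightarrow> ereal ?D) at_top"
  proof (rule log_card_limit)
    show "0 < C" unfolding C_def using C0 by simp
    show "\<forall>\<^sub>F h in at_top. \<exists>i\<in>{()}. h powr ?D \<le> C * card (?S h)"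
      using eventually_ge_at_top[of "V * m"] by eventually_elim (use low in simp)
    show "\<forall>\<^sub>F h in at_top. \<forall>i\<in>{()}. card (?S h) \<le> C * (2 + ln h) * h powr ?D"
      using eventually_ge_at_top[of 1] by eventually_elim (use up in simp)
  qed
  then show ?thesis by simp
qed

theorem mass_dim_orbit:
  "mass_dim_exists (orbit (u, v))"
  "mass_dim (orbit (u, v)) = ereal (log m (card \<Lambda> / eta m \<Lambda> u) + log n (eta m \<Lambda> u))"
proof -
  have D: "dimM (card \<Lambda>) (eta m \<Lambda> u) = log m (card \<Lambda> / eta m \<Lambda> u) + log n (eta m \<Lambda> u)"
    by (rule dimM_eq) (use num_cols_real in simp_all)
  have l: "lower_mass_dim (orbit (u, v)) = ereal (dimM (card \<Lambda>) (eta m \<Lambda> u))"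
    unfolding lower_mass_dim_def by (rule lim_imp_Liminf[OF _ mass_limit]) simp
  have u: "upper_mass_dim (orbit (u, v)) = ereal (dimM (card \<Lambda>) (eta m \<Lambda> u))"
    unfolding upper_mass_dim_def by (rule lim_imp_Limsup[OF _ mass_limit]) simp
  show "mass_dim_exists (orbit (u, v))" unfolding mass_dim_exists_def l u ..
  show "mass_dim (orbit (u, v)) = ereal (log m (card \<Lambda> / eta m \<Lambda> u) + log n (eta m \<Lambda> u))"
    unfolding mass_dim_def l u D[symmetric] by (rule the_equality) auto
qed


section \<open>Beurling dimension\<close>

lemma max_col_cols: obtains e where "e \<in> cols" "col_count \<Lambda> e = max_col m \<Lambda>"
proof -
  obtain e where e: "e < m" "col_count \<Lambda> e = max_col m \<Lambda>" by (rule max_col_witness)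
  then have "e \<in> cols" using max_col_ge_1 by (simp add: nonempty_cols_def)
  then show ?thesis using e(2) by (rule that)
qed

text \<open>For the lower bound the box is centred at an orbit point: words with the fullest column
  frozen share a cell at scale (K, L), wherever that cell lies. So the value does not depend on
  \<open>z\<close>.\<close>

lemma beurling_limit:
  "((\<lambda>h. SUP w. log_card {y \<in> orbit z. real_pt y \<in> box_around w h} / ereal (ln h))
     \<longlongrightarrow> ereal (dimM (card \<Lambda>) (max_col m \<Lambda>))) at_top"
proof -
  let ?D = "dimM (card \<Lambda>) (max_col m \<Lambda>)"
  let ?S = "\<lambda>h w. {y \<in> orbit z. real_pt y \<in> box_around w h}"
  let ?P = "cprod (num_cols m \<Lambda>) (card \<Lambda>) (max_col m \<Lambda>) 0 0"
  define C0 where "C0 = exp (2 * 1 * (ln (num_cols m \<Lambda>) + ln (card \<Lambda>) + ln (max_col m \<Lambda>)))"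
  define T where "T = 12 * real (card (tails z))"
  \<comment> \<open>The 5 comes from \<open>1 + L + K <= 5 * (2 + ln h)\<close>, the power of 2 from
    the side 2 h of the box.\<close>
  define C where "C = max (5 * T * C0 * 2 powr ?D) C0"
  note one = num_cols_real(1-3)
  have C0: "0 < C0" by (simp add: C0_def)
  have T: "0 < T" using card_tails_ge_1[of z] by (simp add: T_def)
  note est = cprod_est[OF one order_refl, where a = 0 and b = 0 and c = 1, folded C0_def]
  have low: "\<exists>w. h powr ?D \<le> C * card (?S h w)" if h: "real m \<le> h" for h
  proof -
    have h1: "1 \<le> h" using h m_pos by linarith
    define K L where "K = lo m h" and "L = lo n h"
    have KL: "K \<le> L" using lo_base_mono[OF h1] by (simp add: L_def K_def)
    have K1: "1 \<le> K"
      using h lo_mono[OF two_le_m, of m h] m_pos two_le_m by (simp add: K_def lo_def)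
    obtain e where e: "e \<in> cols" "col_count \<Lambda> e = max_col m \<Lambda>" by (rule max_col_cols)
    let ?E = "pt L z ` words K L e"
    obtain d0 where d0: "d0 \<in> words K L e" using words_nonempty[OF e(1)] by blast
    let ?w = "real_pt (pt L z d0)"
    have mn: "real m ^ K \<le> h" "real n ^ L \<le> h"
      unfolding K_def L_def using lo_bounds(1)[OF two_le_m h1] lo_bounds(1)[OF two_le_n h1] .
    have "?E \<subseteq> ?S h ?w"
    proof (rule image_subsetI)
      fix d assume d: "d \<in> words K L e"
      have "\<bar>fst (pt L z d) - fst (pt L z d0)\<bar> < int m ^ K" "\<bar>snd (pt L z d) - snd (pt L z d0)\<bar> < int n ^ L"
        by (rule cell_eq_near[OF pt_same_cell[OF d d0 KL]])+
      then have "real_of_int \<bar>fst (pt L z d) - fst (pt L z d0)\<bar> < real_of_int (int m ^ K)"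
        "real_of_int \<bar>snd (pt L z d) - snd (pt L z d0)\<bar> < real_of_int (int n ^ L)"
        by (simp_all only: of_int_less_iff)
      then have "\<bar>real_of_int (fst (pt L z d)) - fst (pt L z d0)\<bar> \<le> h"
        "\<bar>real_of_int (snd (pt L z d)) - snd (pt L z d0)\<bar> \<le> h" using mn by simp_all
      then have "real_pt (pt L z d) \<in> box_around ?w h"
        by (simp add: box_around_def real_pt_def abs_le_iff)
      moreover have "pt L z d \<in> orbit z" by (rule pt_orbit[OF d]) (use K1 KL in simp)
      ultimately show "pt L z d \<in> ?S h ?w" by blast
    qed
    then have "card ?E \<le> card (?S h ?w)"
      by (rule card_mono[rotated]) (rule finite_subset[OF _ finite_box_points], blast)
    moreover have "?P K L \<le> card ?E"
      using words_cell_count[OF order_refl KL e(1), of 0 z] unfolding card_cell_00 e(2) .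
    ultimately have PE: "?P K L \<le> card (?S h ?w)" by linarith
    have "h powr ?D \<le> C0 * ?P K L"
      by (rule est(4)[OF h1]) (use lo_bounds(3)[OF two_le_m h1] lo_bounds(3)[OF two_le_n h1] in
          \<open>auto simp: K_def L_def\<close>)
    also have "\<dots> \<le> C0 * card (?S h ?w)" using PE C0 by simp
    also have "\<dots> \<le> C * card (?S h ?w)" unfolding C_def by (intro mult_right_mono) simp_all
    finally show ?thesis by blast
  qed
  have up: "card (?S h w) \<le> C * (2 + ln h) * h powr ?D" if h: "1 \<le> h" for h w
  proof -
    have h2: "1 \<le> 2 * h" using h by simp
    define K L where "K = Suc (lo m (2 * h))" and "L = Suc (lo n (2 * h))"
    have KL: "K \<le> L" using lo_base_mono[OF h2] by (simp add: L_def K_def)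
    have b: "2 * h \<le> real m ^ K" "2 * h \<le> real n ^ L"
      unfolding K_def L_def
      using lo_bounds(2)[OF two_le_m h2, THEN less_imp_le] lo_bounds(2)[OF two_le_n h2, THEN less_imp_le] .
    obtain X Y where XY: "cell K L ` {y. real_pt y \<in> box_around w h} \<subseteq> {X..X+1} \<times> {Y..Y+1}"
      by (rule cell_box[OF b])
    then have XY': "cell K L ` ?S h w \<subseteq> {X..X+1} \<times> {Y..Y+1}" by blast
    have "?S h w \<subseteq> orbit z" by blast
    from box_count(2)[OF order_refl le0 KL le0 this XY']
    have "card (?S h w) \<le> T * (1 + real L + real K) * ?P K L" unfolding card_cell_00 T_def by simp
    also have "\<dots> \<le> (T * (5 * (2 + ln h))) * (C0 * (2 * h) powr ?D)"
    proof (rule mult_mono)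
      have "0 \<le> ln h" using h by simp
      moreover have "real L \<le> 2 * (2 + ln h)" unfolding L_def by (rule lo_le[OF two_le_n]) (use h in simp_all)
      moreover have "real K \<le> 2 * (2 + ln h)" unfolding K_def by (rule lo_le[OF two_le_m]) (use h in simp_all)
      ultimately have "1 + real L + real K \<le> 5 * (2 + ln h)" by (simp add: distrib_left)
      then show "T * (1 + real L + real K) \<le> T * (5 * (2 + ln h))" using T by simp
      show "?P K L \<le> C0 * (2 * h) powr ?D"
        by (rule est(3)[OF h2]) (use lo_bounds(4)[OF two_le_m h2] lo_bounds(4)[OF two_le_n h2] in
            \<open>auto simp: K_def L_def\<close>)
      show "0 \<le> ?P K L" using cprod_ge_1[OF one, of 0 0 K L] by simp
      show "0 \<le> T * (5 * (2 + ln h))" using T \<open>0 \<le> ln h\<close> by simp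
    qed
    also have "\<dots> = (5 * T * C0 * 2 powr ?D) * ((2 + ln h) * h powr ?D)"
      using h by (simp add: powr_mult)
    also have "\<dots> \<le> C * ((2 + ln h) * h powr ?D)"
      unfolding C_def using h by (intro mult_right_mono) simp_all
    finally show ?thesis by (simp add: mult.assoc)
  qed
  show ?thesis
  proof (rule log_card_limit)
    show "0 < C" unfolding C_def using C0 by simp
    show "\<forall>\<^sub>F h in at_top. \<exists>w\<in>UNIV. h powr ?D \<le> C * card (?S h w)"
      using eventually_ge_at_top[of "real m"] by eventually_elim (use low in simp)
    show "\<forall>\<^sub>F h in at_top. \<forall>w\<in>UNIV. card (?S h w) \<le> C * (2 + ln h) * h powr ?D"
      using eventually_ge_at_top[of 1] by eventually_elim (use up in simp)
  qed
qed

theorem beurling_dim_orbit: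
  "beurling_dim (orbit z) = ereal (log m (card \<Lambda> / max_col m \<Lambda>) + log n (max_col m \<Lambda>))"
proof -
  have "dimM (card \<Lambda>) (max_col m \<Lambda>) = log m (card \<Lambda> / max_col m \<Lambda>) + log n (max_col m \<Lambda>)"
    by (rule dimM_eq) (use num_cols_real in simp_all)
  then show ?thesis
    unfolding beurling_dim_def using lim_imp_Limsup[OF _ beurling_limit[of z]] by simp
qed

section \<open>Assouad dimension\<close>

lemma card_digits_le: "card \<Lambda> \<le> num_cols m \<Lambda> * max_col m \<Lambda>"
proof -
  have "real (card \<Lambda>) = (\<Sum>i\<in>cols. real (col_count \<Lambda> i))"
    using sum_digits_by_column[of "\<lambda>_. 1"] by simp
  also have "\<dots> \<le> (\<Sum>i\<in>cols. real (max_col m \<Lambda>))"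
    by (intro sum_mono of_nat_mono max_col_ge) (simp add: nonempty_cols_def)
  finally have "real (card \<Lambda>) \<le> real (num_cols m \<Lambda> * max_col m \<Lambda>)" by (simp add: num_cols_def)
  then show ?thesis unfolding of_nat_le_iff .
qed

text \<open>No column exceeds the fullest one, so with this \<open>H\<close> the exponent at inner
  scale 1 is the smaller of the two and \<open>dimA\<close> alone governs the uniform bound.\<close>

lemma dimM_le_dimA: "dimM (card \<Lambda>) (max_col m \<Lambda>) \<le> dimA (num_cols m \<Lambda>) (max_col m \<Lambda>)"
proof -
  have "real (card \<Lambda>) \<le> real (num_cols m \<Lambda>) * real (max_col m \<Lambda>)"
    using card_digits_le unfolding of_nat_mult[symmetric] of_nat_le_iff .
  then have "log m (card \<Lambda>) \<le> log m (real (num_cols m \<Lambda>) * real (max_col m \<Lambda>))"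
    using num_cols_real two_le_m by (intro log_mono) simp_all
  also have "\<dots> = log m (num_cols m \<Lambda>) + log m (max_col m \<Lambda>)"
    using num_cols_real(1,3) by (simp add: log_mult)
  finally show ?thesis by (simp add: dimM_def dimA_def)
qed

lemma dimA_nonneg: "1 \<le> A \<Longrightarrow> 1 \<le> H \<Longrightarrow> 0 \<le> dimA A H"
  using two_le_m two_le_n by (simp add: dimA_def)

lemma ball_subset_box: "{y. real_pt y \<in> ball (real_pt x) R} \<subseteq> {y. real_pt y \<in> box_around (real_pt x) R}"
proof
  fix y assume "y \<in> {y. real_pt y \<in> ball (real_pt x) R}"
  then have d: "dist (real_pt x) (real_pt y) < R" by simp
  have "dist (fst (real_pt x)) (fst (real_pt y)) < R" "dist (snd (real_pt x)) (snd (real_pt y)) < R"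
    using le_less_trans[OF dist_fst_le d] le_less_trans[OF dist_snd_le d] .
  then show "y \<in> {y. real_pt y \<in> box_around (real_pt x) R}"
    by (auto simp: box_around_def mem_Times_iff dist_real_def)
qed

lemma assouad_upper:
  assumes "dimA (num_cols m \<Lambda>) (max_col m \<Lambda>) < \<alpha>"
  shows "\<exists>C>0. \<forall>x\<in>orbit z. \<forall>r R :: real. 1 \<le> r \<and> r < R \<longrightarrow>
       real (covering_number r {y \<in> orbit z. real_pt y \<in> ball (real_pt x) R}) \<le> C * (R / r) powr \<alpha>"
proof -
  let ?D = "dimA (num_cols m \<Lambda>) (max_col m \<Lambda>)"
  let ?P = "cprod (num_cols m \<Lambda>) (card \<Lambda>) (max_col m \<Lambda>)"
  define C0 where "C0 = exp (2 * 1 * (ln (num_cols m \<Lambda>) + ln (card \<Lambda>) + ln (max_col m \<Lambda>)))"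
  define T where "T = 12 * real (card (tails z))"
  \<comment> \<open>The number of pieces is O(1 + ln (R / r)). It is absorbed by a power of R / r
    with exponent \<delta>, the gap between \<alpha> and the dimension.\<close>
  define \<delta> where "\<delta> = \<alpha> - ?D"
  define C where "C = T * (5 + 4 / \<delta>) * C0 * 2 powr \<alpha>"
  note one = num_cols_real(1-3)
  have C0: "0 < C0" by (simp add: C0_def)
  have T: "0 < T" using card_tails_ge_1[of z] by (simp add: T_def)
  have \<delta>: "0 < \<delta>" using assms by (simp add: \<delta>_def)
  have "real (covering_number r {y \<in> orbit z. real_pt y \<in> ball (real_pt x) R}) \<le> C * (R / r) powr \<alpha>"
    if r: "1 \<le> r" "r < R" for x r R
  proof -
    define S where "S = {y \<in> orbit z. real_pt y \<in> ball (real_pt x) R}"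
    have R2: "1 \<le> 2 * R" "r \<le> 2 * R" using r by simp_all
    define a b K L where "a = lo m r" and "b = lo n r" and "K = Suc (lo m (2 * R))" and "L = Suc (lo n (2 * R))"
    have ab: "a \<le> b" "K \<le> L" using lo_base_mono[OF r(1)] lo_base_mono[OF R2(1)]
      by (simp_all add: a_def b_def L_def K_def)
    have aK: "a \<le> K" "b \<le> L"
      using lo_mono[OF two_le_m _ R2(2)] lo_mono[OF two_le_n _ R2(2)] r
      by (simp_all add: a_def b_def K_def L_def le_SucI)
    have bx: "2 * R \<le> real m ^ K" "2 * R \<le> real n ^ L"
      unfolding K_def L_def
      using lo_bounds(2)[OF two_le_m R2(1), THEN less_imp_le] lo_bounds(2)[OF two_le_n R2(1), THEN less_imp_le] .
    obtain X Y where XY: "cell K L ` {y. real_pt y \<in> box_around (real_pt x) R} \<subseteq> {X..X+1} \<times> {Y..Y+1}"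
      by (rule cell_box[OF bx])
    then have XY': "cell K L ` S \<subseteq> {X..X+1} \<times> {Y..Y+1}"
      using ball_subset_box[of x R] unfolding S_def by blast
    have SO: "S \<subseteq> orbit z" unfolding S_def by blast
    note bc = box_count[OF ab(1) aK(1) ab(2) aK(2) SO XY', folded T_def]
    have est: "?P a b K L \<le> C0 * (2 * R / r) powr ?D"
      using cprod_est(1)[OF one r(1) R2(2), of a 1 b K L, folded C0_def]
        lo_bounds(3)[OF two_le_m r(1)] lo_bounds(3)[OF two_le_n r(1)]
        lo_bounds(4)[OF two_le_m R2(1)] lo_bounds(4)[OF two_le_n R2(1)]
        max_absorb2[OF dimM_le_dimA]
      by (simp add: a_def b_def K_def L_def)
    define q where "q = 2 * R / r"
    have q: "1 \<le> q" using r by (simp add: q_def field_simps)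
    have lq: "0 \<le> ln q" using q by simp
    have lnq: "ln q \<le> q powr \<delta> / \<delta>" using ln_powr_bound[OF q \<delta>] .
    have q1: "1 \<le> q powr \<delta>" using q \<delta> by (simp add: ge_one_powr_ge_zero)
    have lg: "log c (2 * R) - log c r \<le> 2 * ln q" if "2 \<le> c" for c
    proof -
      have "log c (2 * R) - log c r = log c q" unfolding q_def using r by (simp add: log_divide)
      also have "\<dots> \<le> log 2 q" using that q by (intro log_base_mono) auto
      also have "\<dots> \<le> 2 * ln q"
      proof -
        have "1 / ln 2 \<le> (2::real)" using ln2_ge_two_thirds by (simp add: field_simps)
        then show ?thesis using mult_right_mono[of "1 / ln 2" 2 "ln q"] lq by (simp add: log_def)
      qed
      finally show ?thesis .
    qed
    have "real (L - b) \<le> 2 + 2 * ln q"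
    proof -
      have "real L \<le> log n (2 * R) + 1" "log n r \<le> real b + 1"
        unfolding L_def b_def
        using lo_bounds(4)[OF two_le_n R2(1)] lo_bounds(3)[OF two_le_n r(1)] by linarith+
      moreover have "log n (2 * R) - log n r \<le> 2 * ln q" by (rule lg) (use two_le_n in simp)
      ultimately show ?thesis unfolding of_nat_diff[OF aK(2)] by linarith
    qed
    moreover have "real (K - a) \<le> 2 + 2 * ln q"
    proof -
      have "real K \<le> log m (2 * R) + 1" "log m r \<le> real a + 1"
        unfolding K_def a_def
        using lo_bounds(4)[OF two_le_m R2(1)] lo_bounds(3)[OF two_le_m r(1)] by linarith+
      moreover have "log m (2 * R) - log m r \<le> 2 * ln q" by (rule lg) (use two_le_m in simp)
      ultimately show ?thesis unfolding of_nat_diff[OF aK(1)] by linarith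
    qed
    ultimately have "1 + real (L - b) + real (K - a) \<le> 5 + 4 * ln q" by linarith
    also have "\<dots> \<le> 5 * q powr \<delta> + 4 * (q powr \<delta> / \<delta>)" using lnq q1 by linarith
    also have "\<dots> = (5 + 4 / \<delta>) * q powr \<delta>" by (simp add: algebra_simps)
    finally have cnt: "1 + real (L - b) + real (K - a) \<le> (5 + 4 / \<delta>) * q powr \<delta>" .
    have "real (covering_number r S) \<le> card (cell a b ` S)"
      using covering_number_le[OF bc(1), of r] lo_bounds(1)[OF two_le_m r(1)] lo_bounds(1)[OF two_le_n r(1)]
      by (simp add: a_def b_def)
    also have "\<dots> \<le> (T * (1 + real (L - b) + real (K - a))) * ?P a b K L" by (rule bc(2))
    also have "\<dots> \<le> (T * ((5 + 4 / \<delta>) * q powr \<delta>)) * (C0 * q powr ?D)"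
    proof (rule mult_mono)
      show "T * (1 + real (L - b) + real (K - a)) \<le> T * ((5 + 4 / \<delta>) * q powr \<delta>)"
        using cnt T by (intro mult_left_mono) simp_all
      show "?P a b K L \<le> C0 * q powr ?D" using est by (simp add: q_def)
      show "0 \<le> ?P a b K L" using cprod_ge_1[OF one, of a b K L] by simp
      show "0 \<le> T * ((5 + 4 / \<delta>) * q powr \<delta>)" using T \<delta> by simp
    qed
    also have "\<dots> = T * (5 + 4 / \<delta>) * C0 * (q powr \<delta> * q powr ?D)" by simp
    also have "q powr \<delta> * q powr ?D = q powr \<alpha>" by (simp add: powr_add[symmetric] \<delta>_def)
    also have "q powr \<alpha> = 2 powr \<alpha> * (R / r) powr \<alpha>"
      unfolding q_def times_divide_eq_right[symmetric] using r by (intro powr_mult)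
    finally show ?thesis by (simp add: C_def S_def)
  qed
  moreover have "0 < C" using T \<delta> C0 by (simp add: C_def add_pos_pos)
  ultimately show ?thesis by blast
qed

text \<open>With the ratio R / r = m^t fixed, both scales are raised until log_m R <= log_n r; there
  the count is at least of order (R / r) to the power \<open>dimA\<close>. As t is arbitrary, a
  smaller exponent is impossible.\<close>

lemma assouad_lower:
  assumes C: "0 < C" and cov: "\<And>x r R. x \<in> orbit z \<Longrightarrow> 1 \<le> r \<Longrightarrow> r < R \<Longrightarrow>
       real (covering_number r {y \<in> orbit z. real_pt y \<in> ball (real_pt x) R}) \<le> C * (R / r) powr \<alpha>"
    and \<alpha>: "0 \<le> \<alpha>"
  shows "dimA (num_cols m \<Lambda>) (max_col m \<Lambda>) \<le> \<alpha>"
proof (rule ccontr)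
  let ?D = "dimA (num_cols m \<Lambda>) (max_col m \<Lambda>)"
  let ?P = "cprod (num_cols m \<Lambda>) (card \<Lambda>) (max_col m \<Lambda>)"
  assume "\<not> ?D \<le> \<alpha>"
  then have D: "\<alpha> < ?D" by simp
  define C0 where "C0 = exp (2 * 1 * (ln (num_cols m \<Lambda>) + ln (card \<Lambda>) + ln (max_col m \<Lambda>)))"
  note one = num_cols_real(1-3)
  define M where "M = C0 * (4 * (C * 3 powr \<alpha>))"
  have M: "(real m ^ t) powr (?D - \<alpha>) \<le> M" for t :: nat
  proof -
    define \<rho> where "\<rho> = ln (real m) / ln (real n)"
    have ln_n: "0 < ln (real n)" using two_le_n by simp
    have "ln (real n) < ln (real m)" using two_le_n n_less_m by simp
    then have \<rho>: "1 < \<rho>" using ln_n by (simp add: \<rho>_def)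
    \<comment> \<open>Yields \<open>a + t <= a * \<rho>\<close>, that is log_m R <= log_n r for r =
      m^a and R = m^(a+t).\<close>
    obtain a :: nat where a: "real t / (\<rho> - 1) \<le> a" "1 \<le> a"
      using real_arch_simple[of "max 1 (real t / (\<rho> - 1))"] by auto
    then have a': "real a + t \<le> a * \<rho>" using \<rho> by (simp add: field_simps)
    define r R where "r = real m ^ a" and "R = real m ^ (a + t)"
    have m1: "1 < real m" using two_le_m by simp
    have r1: "1 \<le> r" "r \<le> R" "1 \<le> R"
      unfolding r_def R_def using m1 by (simp_all add: one_le_power power_increasing del: power_add)
    have log_r: "log m r = a" "log m R = real a + t"
      unfolding r_def R_def using m1 by (simp_all add: log_nat_power)
    have log_n: "log n r = a * \<rho>"
      unfolding r_def \<rho>_def using m1 two_le_n by (simp add: log_def ln_realpow)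
    define b K L where "b = Suc (lo n r)" and "K = a + t" and "L = lo n R"
    have lo_eq: "lo m r = a" "lo m R = K" unfolding lo_def log_r K_def
      by (metis floor_of_nat nat_int, metis floor_of_nat nat_int of_nat_add)
    have ab: "a \<le> b" using lo_base_mono[OF r1(1)] unfolding lo_eq b_def by simp
    have KL: "K \<le> L" using lo_base_mono[OF r1(3)] unfolding lo_eq L_def .
    obtain e where e: "e \<in> cols" "col_count \<Lambda> e = max_col m \<Lambda>" by (rule max_col_cols)
    let ?E = "pt L z ` words K L e"
    obtain d0 where d0: "d0 \<in> words K L e" using words_nonempty[OF e(1)] by blast
    let ?x = "pt L z d0"
    \<comment> \<open>Points within R in each coordinate have Euclidean distance at most sqrt 2 * R,
      less than 3 * R; this is the 3 in \<open>M\<close>.\<close>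
    let ?S = "{y \<in> orbit z. real_pt y \<in> ball (real_pt ?x) (3 * R)}"
    have L1: "1 \<le> L" using KL a(2) by (simp add: K_def)
    have mn: "real m ^ K \<le> R" "real n ^ L \<le> R"
      unfolding K_def L_def R_def using lo_bounds(1)[OF two_le_n r1(3)] by (simp_all add: R_def)
    have "?E \<subseteq> ?S"
    proof (rule image_subsetI)
      fix d assume d: "d \<in> words K L e"
      have "\<bar>fst (pt L z d) - fst ?x\<bar> < int m ^ K" "\<bar>snd (pt L z d) - snd ?x\<bar> < int n ^ L"
        by (rule cell_eq_near[OF pt_same_cell[OF d d0 KL]])+
      then have "real_of_int \<bar>fst (pt L z d) - fst ?x\<bar> < real_of_int (int m ^ K)"
        "real_of_int \<bar>snd (pt L z d) - snd ?x\<bar> < real_of_int (int n ^ L)"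
        by (simp_all only: of_int_less_iff)
      then have "\<bar>real_of_int (fst (pt L z d)) - fst ?x\<bar> \<le> R"
        "\<bar>real_of_int (snd (pt L z d)) - snd ?x\<bar> \<le> R" using mn by simp_all
      then have "dist (real_pt ?x) (real_pt (pt L z d)) \<le> sqrt (R\<^sup>2 + R\<^sup>2)"
        unfolding real_pt_def dist_Pair_Pair dist_real_def
        by (intro real_sqrt_le_mono add_mono power2_le_iff_abs_le[THEN iffD2])
          (use r1 in \<open>simp_all add: abs_minus_commute\<close>)
      also have "\<dots> < 3 * R" using r1 by (intro real_less_lsqrt) (simp_all add: power2_eq_square)
      finally have "real_pt (pt L z d) \<in> ball (real_pt ?x) (3 * R)" by simp
      moreover have "pt L z d \<in> orbit z" by (rule pt_orbit[OF d L1])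
      ultimately show "pt L z d \<in> ?S" by blast
    qed
    then have sub: "cell a b ` ?E \<subseteq> cell a b ` ?S" by (rule image_mono)
    have finS: "finite ?S"
      by (rule finite_subset[OF _ finite_box_points[of "real_pt ?x" "3 * R"]]) (use ball_subset_box in blast)
    have "?P a b K L \<le> card (cell a b ` ?E)"
      using words_cell_count[OF ab KL e(1), of z] unfolding e(2) .
    also have "\<dots> \<le> card (cell a b ` ?S)" using card_mono[OF finite_imageI[OF finS] sub] by simp
    also have "card (cell a b ` ?S) \<le> 4 * covering_number r ?S"
    proof (rule covering_number_ge[OF finS])
      show "r \<le> real n ^ b" unfolding b_def using lo_bounds(2)[OF two_le_n r1(1)] by (rule less_imp_le)
    qed (use r1 in \<open>simp_all add: r_def\<close>)
    also have "\<dots> \<le> 4 * (C * (3 * R / r) powr \<alpha>)"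
    proof -
      have "?x \<in> orbit z" by (rule pt_orbit[OF d0 L1])
      from cov[OF this r1(1), of "3 * R"] r1 show ?thesis by simp
    qed
    finally have PC: "?P a b K L \<le> 4 * (C * (3 * R / r) powr \<alpha>)" by simp
    have "(R / r) powr ?D \<le> C0 * ?P a b K L"
      unfolding C0_def
    proof (rule cprod_est(6)[OF one r1(1,2)])
      show "log m R \<le> log n r" unfolding log_r log_n using a' .
      show "\<bar>real a - log m r\<bar> \<le> 1" "\<bar>real K - log m R\<bar> \<le> 1" by (simp_all add: log_r K_def)
      show "\<bar>real b - log n r\<bar> \<le> 1" unfolding b_def by (rule lo_bounds(4)[OF two_le_n r1(1)])
      show "real (max_col m \<Lambda>) = 1 \<or> \<bar>real L - log n R\<bar> \<le> 1"
        unfolding L_def using lo_bounds(3)[OF two_le_n r1(3)] by blast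
    qed
    also have "\<dots> \<le> C0 * (4 * (C * (3 * R / r) powr \<alpha>))"
      using PC by (intro mult_left_mono) (simp_all add: C0_def)
    also have "(3 * R / r) powr \<alpha> = 3 powr \<alpha> * (R / r) powr \<alpha>"
      unfolding times_divide_eq_right[symmetric] using r1 by (intro powr_mult)
    finally have fin: "(R / r) powr ?D \<le> M * (R / r) powr \<alpha>" by (simp add: M_def mult.assoc)
    have Rr: "R / r = real m ^ t" unfolding R_def r_def using m1 by (simp add: power_add)
    have "0 < (real m ^ t) powr \<alpha>" using m1 by simp
    then show ?thesis using fin unfolding Rr powr_diff by (simp add: divide_le_eq)
  qed
  have m1: "1 < real m" using two_le_m by simp
  have "1 < real m powr (?D - \<alpha>)" using D m1 by (intro gr_one_powr) simp_all
  then obtain t where "M < (real m powr (?D - \<alpha>)) ^ t" using real_arch_pow by blast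
  also have "(real m powr (?D - \<alpha>)) ^ t = (real m ^ t) powr (?D - \<alpha>)"
    using m1 by (simp add: powr_realpow[symmetric] powr_powr mult.commute)
  finally show False using M[of t] by simp
qed

theorem assouad_dim_orbit:
  "assouad_dim (orbit z) = ereal (log m (num_cols m \<Lambda>) + log n (max_col m \<Lambda>))"
  unfolding assouad_dim_def dimA_def[symmetric]
proof (rule Inf_ereal_image_eqI)
  fix \<alpha> assume \<open>\<alpha> \<in> {\<alpha>. \<alpha> \<ge> 0 \<and> (\<exists>C>0. \<forall>x\<in>orbit z. \<forall>r R :: real. 1 \<le> r \<and> r < R \<longrightarrow>
       real (covering_number r {y \<in> orbit z. real_pt y \<in> ball (real_pt x) R}) \<le> C * (R / r) powr \<alpha>)}\<close>
  then obtain C where C: "0 \<le> \<alpha>" "0 < C" "\<forall>x\<in>orbit z. \<forall>r R :: real. 1 \<le> r \<and> r < R \<longrightarrow>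
       real (covering_number r {y \<in> orbit z. real_pt y \<in> ball (real_pt x) R}) \<le> C * (R / r) powr \<alpha>" by blast
  show "dimA (num_cols m \<Lambda>) (max_col m \<Lambda>) \<le> \<alpha>"
    by (rule assouad_lower[OF C(2) _ C(1)]) (use C(3) in blast)
next
  fix \<alpha> assume "dimA (num_cols m \<Lambda>) (max_col m \<Lambda>) < \<alpha>"
  then show \<open>\<alpha> \<in> {\<alpha>. \<alpha> \<ge> 0 \<and> (\<exists>C>0. \<forall>x\<in>orbit z. \<forall>r R :: real. 1 \<le> r \<and> r < R \<longrightarrow>
       real (covering_number r {y \<in> orbit z. real_pt y \<in> ball (real_pt x) R}) \<le> C * (R / r) powr \<alpha>)}\<close>
    using assouad_upper[of \<alpha> z] dimA_nonneg[OF num_cols_real(1,3)] by simp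
qed

end

section \<open>Words inside a dyadic shell\<close>

lemma ex_pow2:
  assumes "1 \<le> (q::int)"
  obtains j where "2 ^ j \<le> q" "q < 2 ^ Suc j"
proof -
  define j where "j = lo 2 (real_of_int q)"
  have q: "1 \<le> real_of_int q" using assms by simp
  have "real_of_int (2 ^ j) \<le> real_of_int q" "real_of_int q < real_of_int (2 ^ Suc j)"
    using lo_bounds(1)[OF order_refl q] lo_bounds(2)[OF order_refl q]
    unfolding j_def of_int_power of_int_numeral of_nat_numeral .
  then show ?thesis using that unfolding of_int_le_iff of_int_less_iff by blast
qed

text \<open>An interval that straddles a power of 2 is avoided by passing to its neighbour.\<close>

lemma dyadic_child:
  fixes b B c c1 c2 :: int
  assumes "0 < b" "1 \<le> B" "1 \<le> c" "c1 div b = c" "c2 div b = c" "c1 < c2"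
  obtains j c' where "c' \<in> {c1, c2}" "2 ^ j \<le> B * c'" "B * (c' + 1) \<le> 2 ^ Suc j"
proof -
  have c1: "b * c \<le> c1" and c2: "c2 < b * (c + 1)"
    using div_bounds(1)[OF assms(1,4)] div_bounds(2)[OF assms(1,5)] by simp_all
  have "b * 1 \<le> b * c" using assms(1,3) by (intro mult_left_mono) simp_all
  then have "1 \<le> c1" using c1 assms(1) by linarith
  then have "1 * 1 \<le> B * c1" using assms(2) by (intro mult_mono) simp_all
  then obtain j where j: "2 ^ j \<le> B * c1" "B * c1 < 2 ^ Suc j" using ex_pow2[of "B * c1"] by auto
  show ?thesis
  proof (cases "B * (c1 + 1) \<le> 2 ^ Suc j")
    case True
    then show ?thesis using that j by blast
  next
    case False
    have "B * (c1 + 1) \<le> B * c2" using assms(2,6) by (intro mult_left_mono) simp_all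
    then have 1: "2 ^ Suc j \<le> B * c2" using False by linarith
    \<comment> \<open>Both numbers lie in [b c, b (c + 1)) with c >= 1, so the second interval ends
      no later than twice the start of the first, hence before the next power of 2.\<close>
    have "c2 + 1 \<le> 2 * c1" 
    proof -
      have "b * (c + 1) \<le> b * (2 * c)" using assms(1,3) by (intro mult_left_mono) simp_all
      then show ?thesis using c1 c2 by simp
    qed
    then have "B * (c2 + 1) \<le> B * (2 * c1)" using assms(2) by (intro mult_left_mono) simp_all
    then have "B * (c2 + 1) \<le> 2 ^ Suc (Suc j)" using j(2) by simp
    then show ?thesis using that[of c2 "Suc j"] 1 by blast
  qed
qed

text \<open>In the shell of index j + 2 the larger \<open>nrm\<close> lies in [2^j, 2^(j+1)); the
  factor 4 bridges 2^j and the nominal size 2^(j+2).\<close>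

lemma near_log:
  assumes "2 \<le> b" "int b ^ K \<le> q" "q < int b ^ K * W" "2 ^ j \<le> q" "q < 2 ^ Suc j" "1 \<le> W"
  shows "\<bar>real K - log b (2 ^ (j + 2))\<bar> \<le> log 2 (4 * W)"
proof -
  have b: "1 < real b" using assms(1) by simp
  have b0: "0 < real b ^ K" using b by simp
  have "int b ^ K \<le> 2 ^ (j + 2)" 
  proof -
    have "0 \<le> (2::int) ^ j" "(2::int) ^ Suc j = 2 * 2 ^ j" "(2::int) ^ (j + 2) = 4 * 2 ^ j" by simp_all
    then show ?thesis using assms(2,5) by linarith
  qed
  then have "real_of_int (int b ^ K) \<le> real_of_int (2 ^ (j + 2))" by (simp only: of_int_le_iff)
  then have 1: "real b ^ K \<le> 2 ^ (j + 2)" by simp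
  have "2 ^ (j + 2) \<le> int b ^ K * (4 * W)" using assms(3,4) by simp
  then have "real_of_int (2 ^ (j + 2)) \<le> real_of_int (int b ^ K * (4 * W))" by (simp only: of_int_le_iff)
  then have 2: "2 ^ (j + 2) \<le> real b ^ K * (4 * W)" by simp
  have "real K \<le> log b (2 ^ (j + 2))"
    using log_mono[OF b b0 1] b by (simp add: log_nat_power)
  moreover have "log b (2 ^ (j + 2)) \<le> log b (real b ^ K * (4 * W))"
    using b by (intro log_mono 2) simp_all
  moreover have "log b (real b ^ K * (4 * W)) = K + log b (4 * W)"
    using b b0 assms(6) by (simp add: log_mult log_nat_power)
  moreover have "log b (4 * W) \<le> log 2 (4 * W)"
    using assms(1,6) by (intro log_base_mono) simp_all
  ultimately show ?thesis by linarith
qed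

lemma pow2_ge_imp:
  assumes "2 \<le> b" "int b ^ K < 2 ^ j"
  shows "K \<le> j"
proof -
  have "(2::int) ^ K \<le> int b ^ K" using assms(1) by (intro power_mono) simp_all
  then have "(2::int) ^ K < 2 ^ j" using assms(2) by linarith
  then show ?thesis by simp
qed

context carpet
begin

text \<open>As n < m, a coordinate of size V * n^K is eventually negligible against m^K.\<close>

lemma power_dominated:
  obtains K0 where "\<And>K. K0 \<le> K \<Longrightarrow> V * int n ^ K \<le> int m ^ K"
proof -
  have n0: "0 < real n" "real n \<le> m" using two_le_n n_less_m by simp_all
  have "1 < real m / n" using n0 n_less_m by (simp add: field_simps)
  then obtain K0 where K0: "real_of_int V < (real m / n) ^ K0" using real_arch_pow by blast
  have "V * int n ^ K \<le> int m ^ K" if "K0 \<le> K" for K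
  proof -
    have "(real m / n) ^ K0 \<le> (real m / n) ^ K"
      using that \<open>1 < real m / n\<close> by (intro power_increasing) simp_all
    then have "real_of_int V \<le> real m ^ K / real n ^ K" using K0 by (simp add: power_divide)
    then have "real_of_int V * real n ^ K \<le> real m ^ K" using n0 by (simp add: pos_le_divide_eq)
    then have "real_of_int (V * int n ^ K) \<le> real_of_int (int m ^ K)" by simp
    then show ?thesis unfolding of_int_le_iff .
  qed
  then show ?thesis by (rule that)
qed

text \<open>Shell \<open>i\<close> holds a full set of words, and the scales (K, L) agree with that
  of the shell up to \<open>c\<close>. In both constructions \<open>z\<close> is a descendant of (u,
  v).\<close>

definition shell_words :: "int \<Rightarrow> int \<Rightarrow> real \<Rightarrow> nat \<Rightarrow> nat \<Rightarrow> nat \<Rightarrow> int \<times> int \<Rightarrow> nat \<Rightarrow> bool" where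
  "shell_words u v c i K L z e \<longleftrightarrow> 2 \<le> i \<and> K \<le> L \<and> main_col u e \<and> (eta m \<Lambda> u = 1 \<longrightarrow> L = K)
     \<and> pt L z ` words K L e \<subseteq> orbit (u, v) \<inter> shell i
     \<and> \<bar>real K - log m (2 ^ i)\<bar> \<le> c \<and> (eta m \<Lambda> u = 1 \<or> \<bar>real L - log n (2 ^ i)\<bar> \<le> c)"

lemma level_one:
  assumes "(i, j) \<in> \<Lambda>"
  shows "(int m * u + int i, int n * v + int j) \<in> level (u, v) 1"
  using assms digits_less[OF assms] by (simp add: level_iff cell_def digits_def dig_def)

lemma pt_div:
  assumes "d \<in> words K L e"
  shows "fst (pt L z d) div int m ^ L = fst z" "snd (pt L z d) div int n ^ L = snd z"
  using arg_cong[OF cell_pt[OF assms, of z], of fst] arg_cong[OF cell_pt[OF assms, of z], of snd]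
  unfolding cell_def by simp_all

lemma level_orbit: "z' \<in> level z k \<Longrightarrow> 1 \<le> k \<Longrightarrow> d \<in> words K L e \<Longrightarrow> pt L z' d \<in> orbit z"
  unfolding mem_orbit_iff using level_trans[OF pt_level] by (metis le_add2 le_trans)

text \<open>For \<open>eta\<close> equal to 1 the first coordinate, of size m^K, decides the shell,
  the second being of size n^K only. A finite family of starting points is used because which of
  them avoids the powers of 2 depends on \<open>K\<close>.\<close>

lemma shell_words_x:
  assumes eta: "eta m \<Lambda> u = 1" and e: "e \<in> cols" and F: "finite F"
    "\<And>z'. z' \<in> F \<Longrightarrow> z' \<in> level (u, v) k \<and> 1 \<le> nrm (fst z')" and k: "1 \<le> k"
    and dy: "\<And>K. \<exists>z'\<in>F. \<exists>j. \<forall>d\<in>words K K e. 2 ^ j \<le> nrm (fst (pt K z' d)) \<and> nrm (fst (pt K z' d)) < 2 ^ Suc j"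
  shows "\<exists>c. \<forall>i0. \<exists>i\<ge>i0. \<exists>K L z' e. shell_words u v c i K L z' e"
proof -
  define W where "W = 2 + (\<Sum>z'\<in>F. nrm (fst z') + nrm (snd z'))"
  have W: "nrm (fst z') + 1 \<le> W \<and> nrm (snd z') + 1 \<le> W" if "z' \<in> F" for z'
  proof -
    have "nrm (fst z') + nrm (snd z') \<le> (\<Sum>z'\<in>F. nrm (fst z') + nrm (snd z'))"
      by (rule member_le_sum[OF that _ F(1)]) simp
    then show ?thesis using nrm_nonneg[of "fst z'"] nrm_nonneg[of "snd z'"] unfolding W_def by linarith
  qed
  have W1: "1 \<le> W" unfolding W_def by (simp add: sum_nonneg add_increasing2)
  obtain K0 where K0: "\<And>K. K0 \<le> K \<Longrightarrow> W * int n ^ K \<le> int m ^ K" by (rule power_dominated[of W]) (rule that)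
  have main: "main_col u e" using e eta by (simp add: main_col_def)
  have "\<exists>i\<ge>i0. \<exists>K L z' e. shell_words u v (log 2 (4 * W)) i K L z' e" for i0
  proof -
    define K where "K = max i0 K0"
    obtain z' j where z': "z' \<in> F" and j: "\<And>d. d \<in> words K K e \<Longrightarrow>
        2 ^ j \<le> nrm (fst (pt K z' d)) \<and> nrm (fst (pt K z' d)) < 2 ^ Suc j" using dy[of K] by blast
    have lev: "z' \<in> level (u, v) k" "1 \<le> nrm (fst z')" using F(2)[OF z'] by simp_all
    have nr: "int m ^ K \<le> nrm (fst (pt K z' d))" "nrm (fst (pt K z' d)) < int m ^ K * W"
      "nrm (snd (pt K z' d)) < int m ^ K" if d: "d \<in> words K K e" for d
    proof -
      have c: "fst (pt K z' d) div int m ^ K = fst z'" "snd (pt K z' d) div int n ^ K = snd z'"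
        by (rule pt_div[OF d])+
      have p: "0 < int m ^ K" "0 < int n ^ K" using m_pos n_pos by simp_all
      have x: "nrm (fst (pt K z' d)) div int m ^ K = nrm (fst z')"
        and y: "nrm (snd (pt K z' d)) div int n ^ K = nrm (snd z')"
        using nrm_div[OF p(1), of "fst (pt K z' d)"] nrm_div[OF p(2), of "snd (pt K z' d)"] unfolding c by simp_all
      have "int m ^ K * 1 \<le> int m ^ K * nrm (fst z')" using lev(2) p by (intro mult_left_mono) simp_all
      then show "int m ^ K \<le> nrm (fst (pt K z' d))" using div_bounds(1)[OF p(1) x] by simp
      have "int m ^ K * (nrm (fst z') + 1) \<le> int m ^ K * W" using W[OF z'] p by (intro mult_left_mono) simp_all
      then show "nrm (fst (pt K z' d)) < int m ^ K * W" using div_bounds(2)[OF p(1) x] by simp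
      have "int n ^ K * (nrm (snd z') + 1) \<le> int n ^ K * W" using W[OF z'] p by (intro mult_left_mono) simp_all
      then show "nrm (snd (pt K z' d)) < int m ^ K"
        using div_bounds(2)[OF p(2) y] K0[of K] by (simp add: K_def mult.commute)
    qed
    obtain d0 where d0: "d0 \<in> words K K e" using words_nonempty[OF e] by blast
    have mj: "int m ^ K < 2 ^ Suc j" using nr(1)[OF d0] j[OF d0] by linarith
    have i: "i0 \<le> j + 2" using pow2_ge_imp[OF two_le_m mj] by (simp add: K_def)
    have "\<bar>real K - log m (2 ^ (j + 2))\<bar> \<le> log 2 (4 * W)"
      by (rule near_log[OF two_le_m nr(1)[OF d0] nr(2)[OF d0]]) (use j[OF d0] W1 in auto)
    moreover have "pt K z' ` words K K e \<subseteq> orbit (u, v) \<inter> shell (j + 2)"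
    proof (rule image_subsetI)
      fix d assume d: "d \<in> words K K e"
      have "pt K z' d \<in> orbit (u, v)" by (rule level_orbit[OF lev(1) k d])
      moreover have "pt K z' d \<in> shell (Suc (Suc j))"
        unfolding mem_shell_iff using j[OF d] nr(3)[OF d] mj by linarith
      ultimately show "pt K z' d \<in> orbit (u, v) \<inter> shell (j + 2)" by simp
    qed
    ultimately have "shell_words u v (log 2 (4 * W)) (j + 2) K K z' e"
      using eta main by (simp add: shell_words_def)
    then show ?thesis using i by blast
  qed
  then show ?thesis by blast
qed

text \<open>Here \<open>u\<close> is a fixed point and the first coordinate has no lower bound, so
  the second one, of size n^L, decides the shell.\<close>

lemma shell_words_y:
  assumes eta: "eta m \<Lambda> u \<noteq> 1" and e: "main_col u e" and F: "finite F"
    "\<And>z'. z' \<in> F \<Longrightarrow> z' \<in> level (u, v) k \<and> 1 \<le> nrm (snd z') \<and> fst z' = u" and k: "1 \<le> k"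
    and dy: "\<And>L. \<exists>z'\<in>F. \<exists>j. 2 ^ j \<le> int n ^ L * nrm (snd z') \<and> int n ^ L * (nrm (snd z') + 1) \<le> 2 ^ Suc j"
  shows "\<exists>c. \<forall>i0. \<exists>i\<ge>i0. \<exists>K L z' e. shell_words u v c i K L z' e"
proof -
  define W where "W = 2 + (\<Sum>z'\<in>F. nrm (snd z'))"
  have W: "nrm (snd z') + 1 \<le> W" if "z' \<in> F" for z'
  proof -
    have "nrm (snd z') \<le> (\<Sum>z'\<in>F. nrm (snd z'))"
      by (rule member_le_sum[OF that _ F(1)]) simp
    then show ?thesis unfolding W_def by linarith
  qed
  have W1: "1 \<le> W" unfolding W_def by (simp add: sum_nonneg add_increasing2)
  \<comment> \<open>The factor 2 * W gives 2^(j+1) < m^(L+1) below and thereby K <= L.\<close>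
  obtain K0 where K0: "\<And>K. K0 \<le> K \<Longrightarrow> (2 * W) * int n ^ K \<le> int m ^ K" by (rule power_dominated[of "2 * W"]) (rule that)
  have ecols: "e \<in> cols" and u: "u \<in> {-1, 0}" using e eta by (simp_all add: main_col_def)
  define c where "c = max 2 (log 2 (4 * W))"
  have "\<exists>i\<ge>i0. \<exists>K L z' e. shell_words u v c i K L z' e" for i0
  proof -
    define L where "L = max i0 K0"
    obtain z' j where z': "z' \<in> F"
      and j: "2 ^ j \<le> int n ^ L * nrm (snd z')" "int n ^ L * (nrm (snd z') + 1) \<le> 2 ^ Suc j"
      using dy[of L] by blast
    have lev: "z' \<in> level (u, v) k" "1 \<le> nrm (snd z')" "fst z' = u" using F(2)[OF z'] by simp_all
    \<comment> \<open>The largest exponent for which the first coordinate, with \<open>nrm\<close>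
      below m^K, is sure to stay in the cube of the shell.\<close>
    define K where "K = lo m (2 ^ Suc j)"
    have p: "0 < int n ^ L" using n_pos by simp
    have R1: "(1::real) \<le> 2 ^ Suc j" by (rule one_le_power) simp
    have "real m ^ K \<le> 2 ^ Suc j" unfolding K_def by (rule lo_bounds(1)[OF two_le_m R1])
    then have "real_of_int (int m ^ K) \<le> real_of_int (2 ^ Suc j)" by simp
    then have mK: "int m ^ K \<le> 2 ^ Suc j" unfolding of_int_le_iff .
    have "int n ^ L * nrm (snd z') < int n ^ L * W" using W[OF z'] p by (intro mult_strict_left_mono) simp_all
    then have jW: "2 ^ j < int n ^ L * W" using j(1) by linarith
    then have "2 ^ Suc j < int m ^ Suc L"
    proof -
      have "2 ^ Suc j < (2 * W) * int n ^ L" using jW by (simp add: mult_ac)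
      also have "\<dots> \<le> int m ^ L" by (rule K0) (simp add: L_def)
      also have "\<dots> \<le> int m ^ Suc L" using m_pos by simp
      finally show ?thesis .
    qed
    then have "int m ^ K < int m ^ Suc L" using mK by linarith
    then have KL: "K \<le> L" using two_le_m by (simp del: power_Suc)
    have nL: "int n ^ L * 1 \<le> int n ^ L * nrm (snd z')" using lev(2) p by (intro mult_left_mono) simp_all
    have n2: "int n ^ L * nrm (snd z') < 2 ^ Suc j" 
      using j(2) p by (simp only: distrib_left mult_1_right)
    have "int n ^ L < 2 ^ Suc j" using nL n2 by linarith
    then have i: "i0 \<le> j + 2" using pow2_ge_imp[OF two_le_n] by (fastforce simp: L_def)
    have "\<bar>real L - log n (2 ^ (j + 2))\<bar> \<le> log 2 (4 * W)"
      by (rule near_log[OF two_le_n _ _ j(1) n2 W1]) (use nL \<open>int n ^ L * nrm (snd z') < int n ^ L * W\<close> in simp_all)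
    moreover have "\<bar>real K - log m (2 ^ (j + 2))\<bar> \<le> 2"
    proof -
      have "(2::real) ^ (j + 2) = 2 * 2 ^ Suc j" by simp
      then have "log m (2 ^ (j + 2)) = log m 2 + log m (2 ^ Suc j)" using two_le_m by (simp only: log_mult) simp
      moreover have "log m 2 \<le> 1" "0 \<le> log m 2" using two_le_m by simp_all
      moreover have "\<bar>real K - log m (2 ^ Suc j)\<bar> \<le> 1"
        unfolding K_def by (rule lo_bounds(3)[OF two_le_m R1])
      ultimately show ?thesis by linarith
    qed
    moreover have "pt L z' ` words K L e \<subseteq> orbit (u, v) \<inter> shell (j + 2)"
    proof (rule image_subsetI)
      fix d assume d: "d \<in> words K L e"
      have "pt L z' d \<in> orbit (u, v)" by (rule level_orbit[OF lev(1) k d])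
      moreover have "nrm (snd (pt L z' d)) div int n ^ L = nrm (snd z')"
        using words_origin_nrm(2)[OF KL e _ d, of "snd z'"] eta lev(3) by (metis prod.collapse)
      then have "int n ^ L * nrm (snd z') \<le> nrm (snd (pt L z' d))"
        "nrm (snd (pt L z' d)) < int n ^ L * (nrm (snd z') + 1)" using div_bounds[OF p] by blast+
      moreover have "nrm (fst (pt L z' d)) div int m ^ K = 0"
        using words_origin_nrm(1)[OF KL e _ d, of "snd z'"] eta lev(3) u nrm_eq_0_iff[of u] by (metis prod.collapse)
      then have "nrm (fst (pt L z' d)) < int m ^ K * (0 + 1)" by (rule div_bounds(2)[rotated]) (use m_pos in simp)
      ultimately show "pt L z' d \<in> orbit (u, v) \<inter> shell (j + 2)"
        using j mK mem_shell_iff[of "pt L z' d" j] by simp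
    qed
    ultimately have "shell_words u v c (j + 2) K L z' e"
      using eta e KL by (simp add: shell_words_def c_def le_max_iff_disj)
    then show ?thesis using i by blast
  qed
  then show ?thesis by blast
qed

section \<open>Siblings and the existence of words in a shell\<close>

lemma nrm_eq_cases: "nrm x = nrm y \<Longrightarrow> x = y \<or> x = - y - 1"
  by (auto simp: nrm_def max_def split: if_splits)

text \<open>Distinct children with equal \<open>nrm\<close> would be mirror images with sum -1; but
  their sum is nonnegative for u >= 0 and at most -2 otherwise.\<close>

lemma children_nrm:
  assumes "0 < b" "i < b" "j < b" "i \<noteq> j"
  shows "nrm (int b * u + int i) \<noteq> nrm (int b * u + int j)" "nrm (int b * u + int i) div int b = nrm u"
proof -
  have d: "(int b * u + int i) div int b = u" "(int b * u + int j) div int b = u"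
    using assms by simp_all
  show "nrm (int b * u + int i) div int b = nrm u" using nrm_div[of "int b" "int b * u + int i"] d assms by simp
  show "nrm (int b * u + int i) \<noteq> nrm (int b * u + int j)"
  proof
    assume "nrm (int b * u + int i) = nrm (int b * u + int j)"
    then have "int b * u + int i = - (int b * u + int j) - 1" using nrm_eq_cases assms(4) by fastforce
    then have "(int b * u + int i) + (int b * u + int j) = -1" by linarith
    then have "int b * (2 * u) + (int i + int j) = -1" by (simp add: algebra_simps)
    moreover have "0 \<le> u \<or> u \<le> -1" by linarith
    moreover have "0 \<le> u \<Longrightarrow> 0 \<le> int b * (2 * u)" by simp
    moreover have "u \<le> -1 \<Longrightarrow> int b * (2 * u) \<le> int b * (2 * (-1))" by (intro mult_left_mono) simp_all
    ultimately show False using assms(2-4) by linarith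
  qed
qed

lemma child_nontrivial:
  assumes "2 \<le> b" "i < b" "j < b" "i \<noteq> j"
  shows "\<exists>k\<in>{i, j}. 1 \<le> nrm (int b * u + int k)"
proof (rule ccontr)
  assume "\<not> ?thesis"
  then have "nrm (int b * u + int i) = 0" "nrm (int b * u + int j) = 0"
    using nrm_nonneg[of "int b * u + int i"] nrm_nonneg[of "int b * u + int j"] by (simp_all, linarith+)
  then show False using children_nrm(1)[of b i j u] assms by simp
qed

text \<open>In general two generations of descendants are used: the first leads away from the pair
  -1, 0, the second offers two siblings, one of which avoids the powers of 2. The siblings differ in
  the second coordinate if \<open>eta\<close> is not 1, and in the first if it is 1 and there are
  two columns.\<close>

lemma shell_words_exist:
  assumes "2 \<le> card \<Lambda>"
  shows "\<exists>c. \<forall>i0. \<exists>i\<ge>i0. \<exists>K L z' e. shell_words u v c i K L z' e"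
proof (cases "eta m \<Lambda> u = 1")
  case eta: False
  obtain e where e: "main_col u e" by (rule main_col_exists)
  then have u: "u \<in> {-1, 0}" "dig m 0 u = e" and ce: "col_count \<Lambda> e = eta m \<Lambda> u" 
    using eta by (auto simp: main_col_def)
  have "2 \<le> card {j. (e, j) \<in> \<Lambda>}" using ce eta eta_ge_1[of u] by (simp add: col_count_def)
  then obtain j1 j2 where j: "(e, j1) \<in> \<Lambda>" "(e, j2) \<in> \<Lambda>" "j1 \<noteq> j2"
    by (auto simp: numeral_2_eq_2 card_le_Suc_iff)
  have jn: "j1 < n" "j2 < n" using digits_less j by blast+
  obtain j0 where j0: "j0 \<in> {j1, j2}" "1 \<le> nrm (int n * v + int j0)"
    using child_nontrivial[OF two_le_n jn j(3)] by blast
  have ue: "int m * u + int e = u"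
  proof -
    have "u div int m = u" using u(1) two_le_m by (auto simp: div_eq_minus1)
    then show ?thesis using div_power_Suc_dig[OF m_pos, of u 0] u(2) by simp
  qed
  define v1 where "v1 = int n * v + int j0"
  have z1: "(u, v1) \<in> level (u, v) 1" using level_one[of e j0 u v] j j0(1) unfolding ue v1_def by blast
  have z2: "(u, int n * v1 + int j') \<in> level (u, v) 2" if "j' \<in> {j1, j2}" for j'
    using level_trans[OF level_one[of e j' u v1, unfolded ue] z1] that j by (auto simp: numeral_2_eq_2)
  let ?F = "(\<lambda>j'. (u, int n * v1 + int j')) ` {j1, j2}"
  let ?c = "\<lambda>j'. nrm (int n * v1 + int j')"
  have n0: "0 < int n" using n_pos by simp
  have c12: "?c j1 \<noteq> ?c j2" "?c j1 div int n = nrm v1" "?c j2 div int n = nrm v1"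
    using children_nrm[OF n_pos jn j(3), of v1] children_nrm(2)[OF n_pos jn(2,1) j(3)[symmetric], of v1] by blast+
  have v1: "1 \<le> nrm v1" using j0(2) by (simp add: v1_def)
  have dy: "\<exists>j'\<in>{j1, j2}. \<exists>j. 2 ^ j \<le> B * ?c j' \<and> B * (?c j' + 1) \<le> 2 ^ Suc j" if "1 \<le> B" for B
  proof (cases "?c j1 < ?c j2")
    case True
    show ?thesis by (rule dyadic_child[OF n0 that v1 c12(2,3) True]) blast
  next
    case False
    then have lt: "?c j2 < ?c j1" using c12(1) by linarith
    show ?thesis by (rule dyadic_child[OF n0 that v1 c12(3,2) lt]) blast
  qed
  show ?thesis
  proof (rule shell_words_y[OF eta e, of ?F v 2])
    fix z' assume "z' \<in> ?F"
    then obtain j' where j': "j' \<in> {j1, j2}" "z' = (u, int n * v1 + int j')" by blast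
    have "?c j' div int n = nrm v1" using j'(1) c12 by auto
    then have "int n * nrm v1 \<le> ?c j'" by (rule div_bounds(1)[OF n0])
    moreover have "1 * 1 \<le> int n * nrm v1" using v1 n0 by (intro mult_mono) simp_all
    ultimately show "z' \<in> level (u, v) 2 \<and> 1 \<le> nrm (snd z') \<and> fst z' = u" using z2 j' by simp
  next
    fix L
    have "1 \<le> int n ^ L" using n0 by (intro one_le_power) simp
    from dy[OF this] show "\<exists>z'\<in>?F. \<exists>j. 2 ^ j \<le> int n ^ L * nrm (snd z') \<and> int n ^ L * (nrm (snd z') + 1) \<le> 2 ^ Suc j"
      by auto
  qed simp_all
next
  case eta: True
  show ?thesis
  proof (cases "num_cols m \<Lambda> = 1")
    case True
    then obtain e where e: "cols = {e}" unfolding num_cols_def by (metis card_1_singletonE)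
    \<comment> \<open>With a single column all words of one length from one starting point have the
      same first coordinate, so no power of 2 can separate them and one starting point is
      enough.\<close>
    have "\<Lambda> = column e" using e unfolding cols_eq by auto
    then have ce: "2 \<le> col_count \<Lambda> e" using card_column[of e] assms by simp
    then obtain j where j: "(e, j) \<in> \<Lambda>" using col_count_pos_iff[of e] by auto
    define z1 where "z1 = (int m * u + int e, int n * v + int j)"
    have z1: "z1 \<in> level (u, v) 1" unfolding z1_def by (rule level_one[OF j])
    \<comment> \<open>Otherwise \<open>u\<close> would be a fixed point with recurring digit
      \<open>e\<close>, and \<open>eta\<close> would be at least 2.\<close>
    have "1 \<le> nrm (fst z1)"
    proof (rule ccontr)
      assume "\<not> 1 \<le> nrm (fst z1)"
      then have "nrm (fst z1) = 0" using nrm_nonneg[of "fst z1"] by linarith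
      then have z: "fst z1 \<in> {-1, 0}" using nrm_eq_0_iff by blast
      have em: "e < m" using digits_less(1)[OF j] .
      have "fst z1 div int m ^ 1 = u" using em by (simp add: z1_def)
      moreover have "fst z1 div int m ^ (0 + 1) = fst z1 div int m ^ 0"
        by (rule div_power_stable[OF m_pos]) (use z in simp)
      ultimately have "fst z1 = u" by simp
      moreover have "dig m 0 (fst z1) = e" using em by (simp add: z1_def dig_def)
      ultimately have "eta m \<Lambda> u = max 1 (col_count \<Lambda> e)" using eta_fixed[of u 0] z by simp
      then show False using eta ce by simp
    qed
    moreover have "\<exists>j. \<forall>d\<in>words K K e. 2 ^ j \<le> nrm (fst (pt K z1 d)) \<and> nrm (fst (pt K z1 d)) < 2 ^ Suc j" for K
    proof -
      have p: "0 < int m ^ K" using m_pos by simp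
      obtain d0 where d0: "d0 \<in> words K K e" using words_nonempty[of e] e by blast
      have same: "fst (pt K z1 d) = fst (pt K z1 d0)" if d: "d \<in> words K K e" for d
      proof -
        have "fst (d l) = fst (d0 l)" if "l < K" for l
          using imageI[OF words_digit(1)[OF d that], of fst] imageI[OF words_digit(1)[OF d0 that], of fst] e
          unfolding cols_eq by simp
        then show ?thesis unfolding pt_def fst_conv by (intro expand_cong) simp
      qed
      have "nrm (fst (pt K z1 d0)) div int m ^ K = nrm (fst z1)"
        using nrm_div[OF p, of "fst (pt K z1 d0)"] unfolding pt_div(1)[OF d0] by simp
      from div_bounds(1)[OF p this] have "1 * 1 \<le> nrm (fst (pt K z1 d0))"
        using mult_mono[of 1 "int m ^ K" 1 "nrm (fst z1)"] \<open>1 \<le> nrm (fst z1)\<close> p by linarith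
      then obtain j where "2 ^ j \<le> nrm (fst (pt K z1 d0))" "nrm (fst (pt K z1 d0)) < 2 ^ Suc j"
        using ex_pow2 by auto
      then show ?thesis using same by auto
    qed
    ultimately show ?thesis
      using e z1 by (intro shell_words_x[OF eta, of e "{z1}" v 1]) simp_all
  next
    case False
    then have "2 \<le> card cols" using num_cols_ge_1 unfolding num_cols_def by simp
    then obtain i1 i2 where i: "i1 \<in> cols" "i2 \<in> cols" "i1 \<noteq> i2"
      by (auto simp: numeral_2_eq_2 card_le_Suc_iff)
    then obtain j1 j2 where j: "(i1, j1) \<in> \<Lambda>" "(i2, j2) \<in> \<Lambda>" by (auto simp: cols_eq)
    have im: "i1 < m" "i2 < m" using digits_less j by blast+
    define s where "s i' = (if i' = i1 then j1 else j2)" for i'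
    have s: "(i', s i') \<in> \<Lambda>" if "i' \<in> {i1, i2}" for i' using that j by (auto simp: s_def)
    obtain i0 where i0: "i0 \<in> {i1, i2}" "1 \<le> nrm (int m * u + int i0)"
      using child_nontrivial[OF two_le_m im i(3)] by blast
    define u1 v1 where "u1 = int m * u + int i0" and "v1 = int n * v + int (s i0)"
    have z1: "(u1, v1) \<in> level (u, v) 1" unfolding u1_def v1_def by (rule level_one[OF s[OF i0(1)]])
    have z2: "(int m * u1 + int i', int n * v1 + int (s i')) \<in> level (u, v) 2" if "i' \<in> {i1, i2}" for i'
      using level_trans[OF level_one[OF s[OF that]] z1] by (simp add: numeral_2_eq_2)
    let ?F = "(\<lambda>i'. (int m * u1 + int i', int n * v1 + int (s i'))) ` {i1, i2}"
    let ?c = "\<lambda>i'. nrm (int m * u1 + int i')"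
    have m0: "0 < int m" using m_pos by simp
    have c12: "?c i1 \<noteq> ?c i2" "?c i1 div int m = nrm u1" "?c i2 div int m = nrm u1"
      using children_nrm[OF m_pos im i(3), of u1] children_nrm(2)[OF m_pos im(2,1) i(3)[symmetric], of u1] by blast+
    have u1: "1 \<le> nrm u1" using i0(2) by (simp add: u1_def)
    have dy: "\<exists>i'\<in>{i1, i2}. \<exists>j. 2 ^ j \<le> B * ?c i' \<and> B * (?c i' + 1) \<le> 2 ^ Suc j" if "1 \<le> B" for B
    proof (cases "?c i1 < ?c i2")
      case True
      show ?thesis by (rule dyadic_child[OF m0 that u1 c12(2,3) True]) blast
    next
      case False
      then have lt: "?c i2 < ?c i1" using c12(1) by linarith
      show ?thesis by (rule dyadic_child[OF m0 that u1 c12(3,2) lt]) blast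
    qed
    show ?thesis
    proof (rule shell_words_x[OF eta i(1), of ?F v 2])
      fix z' assume "z' \<in> ?F"
      then obtain i' where i': "i' \<in> {i1, i2}" "z' = (int m * u1 + int i', int n * v1 + int (s i'))" by blast
      have "?c i' div int m = nrm u1" using i'(1) c12 by auto
      then have "int m * nrm u1 \<le> ?c i'" by (rule div_bounds(1)[OF m0])
      moreover have "1 * 1 \<le> int m * nrm u1" using u1 m0 by (intro mult_mono) simp_all
      ultimately show "z' \<in> level (u, v) 2 \<and> 1 \<le> nrm (fst z')" using z2 i' by simp
    next
      fix K
      have p: "0 < int m ^ K" "1 \<le> int m ^ K" using m0 by simp_all
      obtain i' j' where ij: "i' \<in> {i1, i2}" "2 ^ j' \<le> int m ^ K * ?c i'" "int m ^ K * (?c i' + 1) \<le> 2 ^ Suc j'"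
        using dy[OF p(2)] by blast
      let ?z = "(int m * u1 + int i', int n * v1 + int (s i'))"
      have "2 ^ j' \<le> nrm (fst (pt K ?z d)) \<and> nrm (fst (pt K ?z d)) < 2 ^ Suc j'" if d: "d \<in> words K K i1" for d
      proof -
        have "nrm (fst (pt K ?z d)) div int m ^ K = ?c i'"
          using nrm_div[OF p(1), of "fst (pt K ?z d)"] unfolding pt_div(1)[OF d] by simp
        from div_bounds[OF p(1) this] show ?thesis using ij(2,3) by linarith
      qed
      then show "\<exists>z'\<in>?F. \<exists>j. \<forall>d\<in>words K K i1. 2 ^ j \<le> nrm (fst (pt K z' d)) \<and> nrm (fst (pt K z' d)) < 2 ^ Suc j"
        using ij(1) by blast
    qed simp_all
  qed
qed

end

section \<open>Discrete packing dimension and lower entropy index\<close>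

lemma packing_number_le_card:
  assumes "finite A"
  shows "packing_number r A \<le> card A"
proof -
  obtain X where "X \<subseteq> A" "card X = packing_number r A"
    by (rule packing_number_attained[OF assms, of r]) blast
  then show ?thesis using card_mono[OF assms, of X] by simp
qed

lemma not_tendsto_zeroI:
  fixes f :: "nat \<Rightarrow> real"
  assumes "0 < \<delta>" "\<And>i0. \<exists>i\<ge>i0. \<delta> \<le> f i" "f \<longlonglongrightarrow> 0"
  shows False
proof -
  have "\<forall>\<^sub>F i in sequentially. f i < \<delta>" using order_tendstoD(2)[OF assms(3,1)] .
  then obtain i0 where "\<And>i. i0 \<le> i \<Longrightarrow> f i < \<delta>" unfolding eventually_sequentially by blast
  then show False using assms(2)[of i0] by force
qed

lemma tendsto_zero_by_decay:
  fixes f :: "nat \<Rightarrow> real"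
  assumes "0 < s" "\<And>k. 2 \<le> k \<Longrightarrow> 0 \<le> f k" "\<And>k. 2 \<le> k \<Longrightarrow> f k \<le> C * (real k + 1) * 2 powr (- (real k * s))"
  shows "f \<longlonglongrightarrow> 0"
proof (rule tendsto_sandwich)
  show "\<forall>\<^sub>F k in sequentially. 0 \<le> f k" "\<forall>\<^sub>F k in sequentially. f k \<le> C * (real k + 1) * 2 powr (- (real k * s))"
    using assms(2,3) by (auto intro: eventually_sequentiallyI[of 2])
  show "(\<lambda>k. C * (real k + 1) * 2 powr (- (real k * s))) \<longlonglongrightarrow> 0"
    using assms(1) by real_asymp
qed simp

context carpet
begin

section \<open>Packing numbers of the shells\<close>

abbreviation dim1 :: "int \<Rightarrow> real" where "dim1 u \<equiv> dimM (card \<Lambda>) (eta m \<Lambda> u)"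
abbreviation dim2 :: "int \<Rightarrow> real" where "dim2 u \<equiv> dimA (num_cols m \<Lambda>) (eta m \<Lambda> u)"

lemma col_count_le: "col_count \<Lambda> i \<le> card \<Lambda>"
  unfolding card_column[symmetric] by (rule card_mono[OF finite_digits]) blast

lemma eta_le_card: "eta m \<Lambda> u \<le> card \<Lambda>"
  using col_count_le card_digits_ge_1 by (simp add: eta_def)

lemma dim1_nonneg: "0 \<le> dim1 u"
proof -
  have "log m (eta m \<Lambda> u) \<le> log m (card \<Lambda>)"
    using eta_le_card[of u] num_cols_real(4)[of u] two_le_m by (intro log_mono) simp_all
  moreover have "0 \<le> log n (eta m \<Lambda> u)" using num_cols_real(4)[of u] two_le_n by simp
  ultimately show ?thesis by (simp add: dimM_def)
qed

lemma dim2_nonneg: "0 \<le> dim2 u"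
  by (rule dimA_nonneg) (use num_cols_real in simp_all)

text \<open>A single digit pair may leave almost all shells empty, which rules out the lower bounds
  used otherwise; the case is settled by the exponents being 0.\<close>

lemma dims_trivial:
  assumes "card \<Lambda> < 2"
  shows "card \<Lambda> = 1" "num_cols m \<Lambda> = 1" "eta m \<Lambda> u = 1" "dim1 u = 0" "dim2 u = 0"
proof -
  show c: "card \<Lambda> = 1" using assms card_digits_ge_1 by simp
  then show e: "eta m \<Lambda> u = 1" using eta_le_card[of u] eta_ge_1[of u] by simp
  have "num_cols m \<Lambda> \<le> 1" unfolding num_cols_def cols_eq using card_image_le[OF finite_digits, of fst] c by simp
  then show n: "num_cols m \<Lambda> = 1" using num_cols_ge_1 by simp
  show "dim1 u = 0" "dim2 u = 0" by (simp_all add: dimM_def dimA_def c e n)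
qed

text \<open>Inner scales are rounded down and outer ones up: cells are no wider than
  \<open>r\<close>, and the shell lies in the box at the origin. The factor \<open>k + 1\<close>
  bounds the number of pieces.\<close>

lemma packing_upper:
  obtains C :: real where "0 < C" "\<And>k r. \<lbrakk>2 \<le> k; 1 \<le> r; r \<le> 2 ^ k\<rbrakk> \<Longrightarrow>
      real (packing_number r (orbit (u, v) \<inter> shell k)) \<le> C * (real k + 1) * (2 ^ k / r) powr max (dim1 u) (dim2 u)"
    "\<And>k r. \<lbrakk>2 \<le> k; r = 1\<rbrakk> \<Longrightarrow>
      real (packing_number r (orbit (u, v) \<inter> shell k)) \<le> C * (real k + 1) * (2 ^ k / r) powr dim1 u"
    "\<And>k r. \<lbrakk>2 \<le> k; 1 \<le> r; r \<le> 2 ^ k; log m (2 ^ k) \<le> log n r\<rbrakk> \<Longrightarrow>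
      real (packing_number r (orbit (u, v) \<inter> shell k)) \<le> C * (real k + 1) * (2 ^ k / r) powr dim2 u"
proof -
  note one = num_cols_real(1,2) num_cols_real(4)[of u]
  let ?P = "cprod (num_cols m \<Lambda>) (card \<Lambda>) (eta m \<Lambda> u)"
  define C where "C = exp (2 * 1 * (ln (num_cols m \<Lambda>) + ln (card \<Lambda>) + ln (eta m \<Lambda> u)))"
  have main: "real (packing_number r (orbit (u, v) \<inter> shell k))
        \<le> (real k + 1) * ?P (lo m r) (lo n r) (Suc (lo m (2 ^ k))) (Suc (lo n (2 ^ k)))"
    if k: "2 \<le> k" and r: "1 \<le> r" "r \<le> 2 ^ k" for k r
  proof -
    define a b K L where "a = lo m r" and "b = lo n r" and "K = Suc (lo m (2 ^ k))" and "L = Suc (lo n (2 ^ k))"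
    have R1: "(1::real) \<le> 2 ^ k" by simp
    have ab: "a \<le> b" "K \<le> L" using lo_base_mono[OF r(1)] lo_base_mono[OF R1]
      by (simp_all add: a_def b_def L_def K_def)
    have aK: "a \<le> K" "b \<le> L"
      using lo_mono[OF two_le_m _ r(2)] lo_mono[OF two_le_n _ r(2)] r(1)
      by (simp_all add: a_def b_def K_def L_def le_SucI)
    let ?S = "orbit (u, v) \<inter> shell k"
    have fin: "finite ?S" using finite_shell by blast
    obtain j where j: "k = Suc (Suc j)" using k by (metis add_2_eq_Suc le_Suc_ex)
    have mn: "2 ^ k < int m ^ K" "2 ^ k < int n ^ L"
    proof -
      have "real_of_int (2 ^ k) < real_of_int (int m ^ K)" "real_of_int (2 ^ k) < real_of_int (int n ^ L)"
        using lo_bounds(2)[OF two_le_m R1] lo_bounds(2)[OF two_le_n R1] by (simp_all add: K_def L_def)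
      then show "2 ^ k < int m ^ K" "2 ^ k < int n ^ L" unfolding of_int_less_iff .
    qed
    have "nrm (fst p) < int m ^ K \<and> nrm (snd p) < int n ^ L" if "p \<in> ?S" for p
    proof -
      have "p \<in> shell (Suc (Suc j))" using that j by simp
      then have "nrm (fst p) < 2 ^ Suc j" "nrm (snd p) < 2 ^ Suc j" unfolding mem_shell_iff by blast+
      moreover have "(2::int) ^ Suc j \<le> 2 ^ k" unfolding j by simp
      ultimately show ?thesis using mn by linarith
    qed
    then have "real (card (cell a b ` ?S)) \<le> L * ?P a b K L"
      using origin_box_count(2)[OF order_refl[of 1], of ?S "(u, v)" K L a b] ab aK by (auto simp: L_def)
    moreover have "packing_number r ?S \<le> card (cell a b ` ?S)"
      unfolding a_def b_def
      by (rule packing_number_le[OF fin lo_bounds(1)[OF two_le_m r(1)] lo_bounds(1)[OF two_le_n r(1)]])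
    ultimately have "real (packing_number r ?S) \<le> L * ?P a b K L" by linarith
    also have "\<dots> \<le> (real k + 1) * ?P a b K L"
    proof (rule mult_right_mono)
      have "log n (2 ^ k) \<le> log 2 (2 ^ k)" using two_le_n by (intro log_base_mono) simp_all
      also have "\<dots> = k" by simp
      finally show "real L \<le> real k + 1"
        using lo_bounds(3)[OF two_le_n R1] lo_bounds(4)[OF two_le_n R1] unfolding L_def by linarith
      show "0 \<le> ?P a b K L" using cprod_ge_1[OF one, of a b K L] by simp
    qed
    finally show ?thesis unfolding a_def b_def K_def L_def .
  qed
  have est: "1 \<le> r \<Longrightarrow> r \<le> 2 ^ k \<Longrightarrow> \<bar>real (lo m r) - log m r\<bar> \<le> 1"
    "1 \<le> r \<Longrightarrow> r \<le> 2 ^ k \<Longrightarrow> \<bar>real (lo n r) - log n r\<bar> \<le> 1"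
    "\<bar>real (Suc (lo m (2 ^ k))) - log m (2 ^ k)\<bar> \<le> 1"
    "real (eta m \<Lambda> u) = 1 \<or> \<bar>real (Suc (lo n (2 ^ k))) - log n (2 ^ k)\<bar> \<le> 1" for k r
    by (intro lo_bounds disjI2 two_le_m two_le_n one_le_power; simp)+
  have step: "real (packing_number r (orbit (u, v) \<inter> shell k)) \<le> C * (real k + 1) * x"
    if "2 \<le> k" "1 \<le> r" "r \<le> 2 ^ k"
      "?P (lo m r) (lo n r) (Suc (lo m (2 ^ k))) (Suc (lo n (2 ^ k))) \<le> C * x" for k r x
  proof -
    have "(real k + 1) * ?P (lo m r) (lo n r) (Suc (lo m (2 ^ k))) (Suc (lo n (2 ^ k))) \<le> (real k + 1) * (C * x)"
      using that(4) by (intro mult_left_mono) simp_all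
    from order_trans[OF main[OF that(1-3)] this] show ?thesis by (simp only: mult_ac)
  qed
  show ?thesis
  proof (rule that)
    show "0 < C" by (simp add: C_def)
    show "real (packing_number r (orbit (u, v) \<inter> shell k)) \<le> C * (real k + 1) * (2 ^ k / r) powr max (dim1 u) (dim2 u)"
      if "2 \<le> k" "1 \<le> r" "r \<le> 2 ^ k" for k r
      by (rule step[OF that cprod_est(1)[OF one that(2,3) est(1)[OF that(2,3)] est(2)[OF that(2,3)] est(3,4), folded C_def]])
    show "real (packing_number r (orbit (u, v) \<inter> shell k)) \<le> C * (real k + 1) * (2 ^ k / r) powr dim1 u"
      if "2 \<le> k" "r = 1" for k r
    proof -
      have r: "1 \<le> r" "r \<le> 2 ^ k" using that(2) by simp_all
      show ?thesis
        using step[OF that(1) r cprod_est(3)[OF one r est(1)[OF r] est(2)[OF r] est(3,4) that(2), folded C_def]] that(2)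
        by simp
    qed
    show "real (packing_number r (orbit (u, v) \<inter> shell k)) \<le> C * (real k + 1) * (2 ^ k / r) powr dim2 u"
      if "2 \<le> k" "1 \<le> r" "r \<le> 2 ^ k" "log m (2 ^ k) \<le> log n r" for k r
      by (rule step[OF that(1-3) cprod_est(5)[OF one that(2,3) est(1)[OF that(2,3)] est(2)[OF that(2,3)] est(3,4) that(4), folded C_def]])
  qed
qed

text \<open>Inner scales are rounded up, since cells must be at least \<open>r\<close> wide. Only
  shells that contain a full set of words are treated; there are infinitely many of them.\<close>

lemma packing_lower:
  assumes "2 \<le> card \<Lambda>"
  obtains C :: real where "0 < C" "\<And>k0. \<exists>k\<ge>k0. \<forall>r. 1 \<le> r \<longrightarrow> r \<le> 2 ^ k \<longrightarrow>
      (2 ^ k / r) powr min (dim1 u) (dim2 u) \<le> C * packing_number r (orbit (u, v) \<inter> shell k)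
      \<and> (r = 1 \<longrightarrow> (2 ^ k / r) powr dim1 u \<le> C * packing_number r (orbit (u, v) \<inter> shell k))
      \<and> (log m (2 ^ k) \<le> log n r \<longrightarrow> (2 ^ k / r) powr dim2 u \<le> C * packing_number r (orbit (u, v) \<inter> shell k))"
proof -
  note one = num_cols_real(1,2) num_cols_real(4)[of u]
  let ?P = "cprod (num_cols m \<Lambda>) (card \<Lambda>) (eta m \<Lambda> u)"
  obtain c0 where c0: "\<And>i0. \<exists>i\<ge>i0. \<exists>K L z' e. shell_words u v c0 i K L z' e"
    using shell_words_exist[OF assms, of u v] by blast
  define c where "c = max 1 c0"
  define C where "C = exp (2 * c * (ln (num_cols m \<Lambda>) + ln (card \<Lambda>) + ln (eta m \<Lambda> u)))"
  have C: "0 < C" by (simp add: C_def)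
  have "\<exists>k\<ge>k0. \<forall>r. 1 \<le> r \<longrightarrow> r \<le> 2 ^ k \<longrightarrow>
      (2 ^ k / r) powr min (dim1 u) (dim2 u) \<le> (9 * C) * packing_number r (orbit (u, v) \<inter> shell k)
      \<and> (r = 1 \<longrightarrow> (2 ^ k / r) powr dim1 u \<le> (9 * C) * packing_number r (orbit (u, v) \<inter> shell k))
      \<and> (log m (2 ^ k) \<le> log n r \<longrightarrow> (2 ^ k / r) powr dim2 u \<le> (9 * C) * packing_number r (orbit (u, v) \<inter> shell k))" for k0
  proof -
    obtain k K L z' e where k: "k \<ge> k0" and sw: "shell_words u v c0 k K L z' e" using c0[of k0] by blast
    have s: "K \<le> L" "main_col u e" "eta m \<Lambda> u = 1 \<Longrightarrow> L = K"
      "pt L z' ` words K L e \<subseteq> orbit (u, v) \<inter> shell k"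
      and n: "\<bar>real K - log m (2 ^ k)\<bar> \<le> c" "real (eta m \<Lambda> u) = 1 \<or> \<bar>real L - log n (2 ^ k)\<bar> \<le> c"
      using sw by (auto simp: shell_words_def c_def)
    have "(2 ^ k / r) powr min (dim1 u) (dim2 u) \<le> (9 * C) * packing_number r (orbit (u, v) \<inter> shell k)
      \<and> (r = 1 \<longrightarrow> (2 ^ k / r) powr dim1 u \<le> (9 * C) * packing_number r (orbit (u, v) \<inter> shell k))
      \<and> (log m (2 ^ k) \<le> log n r \<longrightarrow> (2 ^ k / r) powr dim2 u \<le> (9 * C) * packing_number r (orbit (u, v) \<inter> shell k))"
      if r: "1 \<le> r" "r \<le> 2 ^ k" for r
    proof -
      define a b where "a = Suc (lo m r)" and "b = Suc (lo n r)"
      have ab: "a \<le> b" using lo_base_mono[OF r(1)] by (simp add: a_def b_def)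
      let ?S = "orbit (u, v) \<inter> shell k"
      have fin: "finite ?S" using finite_shell by blast
      have "?P a b K L \<le> card (cell a b ` pt L z' ` words K L e)"
        by (rule words_origin_count[OF ab s(1,2,3)])
      moreover have "card (cell a b ` pt L z' ` words K L e) \<le> card (cell a b ` ?S)"
        by (rule card_mono[OF finite_imageI[OF fin] image_mono[OF s(4)]])
      moreover have "card (cell a b ` ?S) \<le> 9 * packing_number r ?S"
        unfolding a_def b_def using r(1)
        by (intro packing_number_ge[OF fin _ lo_bounds(2)[OF two_le_m r(1), THEN less_imp_le]
              lo_bounds(2)[OF two_le_n r(1), THEN less_imp_le]]) simp
      ultimately have "?P a b K L \<le> 9 * real (packing_number r ?S)" by linarith
      then have "C * ?P a b K L \<le> C * (9 * real (packing_number r ?S))"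
        using C by (intro mult_left_mono) simp_all
      then have CP: "C * ?P a b K L \<le> (9 * C) * packing_number r ?S" by (simp only: mult_ac)
      have step: "x \<le> (9 * C) * packing_number r ?S" if "x \<le> C * ?P a b K L" for x
        using order_trans[OF that CP] .
      have near: "\<bar>real a - log m r\<bar> \<le> c" "\<bar>real b - log n r\<bar> \<le> c"
        using lo_bounds(4)[OF two_le_m r(1)] lo_bounds(4)[OF two_le_n r(1)] by (simp_all add: a_def b_def c_def)
      note est = cprod_est[OF one r near n, folded C_def]
      show ?thesis
        using step[OF est(2)] step[OF est(4)] step[OF est(6)] by auto
    qed
    then show ?thesis using k by blast
  qed
  then show ?thesis using that[of "9 * C"] C by auto
qed

section \<open>Normalised packing numbers over the range of scales\<close>

definition pack_val :: "int \<times> int \<Rightarrow> real \<Rightarrow> nat \<Rightarrow> real \<Rightarrow> real" where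
  "pack_val z \<alpha> k r = (r / 2 ^ k) powr \<alpha> * real (packing_number r (orbit z \<inter> shell k))"

lemma pack_val_nonneg: "0 \<le> pack_val z \<alpha> k r"
  by (simp add: pack_val_def)

lemma scale_le: "1 \<le> r \<Longrightarrow> 0 \<le> \<epsilon> \<Longrightarrow> r \<le> 2 powr (real k * (1 - \<epsilon>)) \<Longrightarrow> r \<le> 2 ^ k"
proof -
  assume "1 \<le> r" "0 \<le> \<epsilon>" "r \<le> 2 powr (real k * (1 - \<epsilon>))"
  moreover have "(2::real) powr (real k * (1 - \<epsilon>)) \<le> 2 powr real k"
    using \<open>0 \<le> \<epsilon>\<close> by (intro powr_mono) (simp_all add: mult_left_le)
  ultimately show ?thesis by (simp add: powr_realpow)
qed

text \<open>The supremum over real scales is meaningful only for a bounded family; the cardinality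
  of the shell is bound enough.\<close>

lemma pack_val_bdd:
  assumes "0 \<le> \<alpha>" "0 \<le> \<epsilon>"
  shows "bdd_above (pack_val z \<alpha> k ` {1..2 powr (real k * (1 - \<epsilon>))})"
proof (rule bdd_aboveI2)
  fix r :: real assume "r \<in> {1..2 powr (real k * (1 - \<epsilon>))}"
  then have r: "1 \<le> r" "r \<le> 2 ^ k" using scale_le assms(2) by auto
  have "(r / 2 ^ k) powr \<alpha> \<le> 1" using r assms(1) by (intro powr_le1) simp_all
  moreover have "packing_number r (orbit z \<inter> shell k) \<le> card (orbit z \<inter> shell k)"
    by (rule packing_number_le_card) (use finite_shell in blast)
  ultimately have "(r / 2 ^ k) powr \<alpha> * real (packing_number r (orbit z \<inter> shell k))
      \<le> 1 * real (card (orbit z \<inter> shell k))"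
    by (intro mult_mono) simp_all
  then show "pack_val z \<alpha> k r \<le> real (card (orbit z \<inter> shell k))" unfolding pack_val_def by simp
qed

text \<open>The cut-off keeps r / 2^k below 2^(-k \<epsilon>), so a gap between \<alpha> and D gives
  an exponential decay that beats the factor k + 1.\<close>

lemma pack_val_le:
  assumes "real (packing_number r (orbit z \<inter> shell k)) \<le> C * (real k + 1) * (2 ^ k / r) powr D"
    "1 \<le> r" "r \<le> 2 powr (real k * (1 - \<epsilon>))" "D \<le> \<alpha>" "0 < C"
  shows "pack_val z \<alpha> k r \<le> C * (real k + 1) * 2 powr (- (real k * (\<epsilon> * (\<alpha> - D))))"
proof -
  have "pack_val z \<alpha> k r \<le> (r / 2 ^ k) powr \<alpha> * (C * (real k + 1) * (2 ^ k / r) powr D)"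
    unfolding pack_val_def by (intro mult_left_mono assms(1)) simp
  also have "\<dots> = C * (real k + 1) * ((r / 2 ^ k) powr (\<alpha> - D))"
  proof -
    have "(2 ^ k / r) powr D = inverse ((r / 2 ^ k) powr D)"
      using assms(2) by (simp add: powr_divide)
    then show ?thesis by (simp add: powr_diff divide_inverse mult_ac)
  qed
  also have "\<dots> \<le> C * (real k + 1) * 2 powr (- (real k * (\<epsilon> * (\<alpha> - D))))"
  proof (rule mult_left_mono)
    have "r / 2 ^ k \<le> 2 powr (real k * (1 - \<epsilon>)) / 2 powr real k"
      using assms(3) by (simp add: powr_realpow divide_right_mono)
    also have "\<dots> = 2 powr (- (real k * \<epsilon>))" by (simp add: powr_diff[symmetric] algebra_simps)
    finally have "(r / 2 ^ k) powr (\<alpha> - D) \<le> (2 powr (- (real k * \<epsilon>))) powr (\<alpha> - D)"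
      using assms(2,4) by (intro powr_mono2) simp_all
    then show "(r / 2 ^ k) powr (\<alpha> - D) \<le> 2 powr (- (real k * (\<epsilon> * (\<alpha> - D))))"
      by (simp add: powr_powr mult.assoc)
  qed (use assms(5) in simp)
  finally show ?thesis .
qed

lemma pack_val_ge:
  fixes C :: real
  assumes "(2 ^ k / r) powr D \<le> C * packing_number r (orbit z \<inter> shell k)"
    "1 \<le> r" "r \<le> 2 ^ k" "\<alpha> \<le> D" "0 < C"
  shows "1 / C \<le> pack_val z \<alpha> k r"
proof -
  have "1 \<le> (2 ^ k / r) powr (D - \<alpha>)" using assms(2-4) by (intro ge_one_powr_ge_zero) simp_all
  also have "\<dots> = (r / 2 ^ k) powr \<alpha> * (2 ^ k / r) powr D"
  proof -
    have "(r / 2 ^ k) powr \<alpha> = inverse ((2 ^ k / r) powr \<alpha>)"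
      using assms(2) by (simp add: powr_divide)
    then show ?thesis by (simp add: powr_diff divide_inverse mult_ac)
  qed
  also have "\<dots> \<le> (r / 2 ^ k) powr \<alpha> * (C * packing_number r (orbit z \<inter> shell k))"
    by (intro mult_left_mono assms(1)) simp
  also have "\<dots> = C * pack_val z \<alpha> k r" by (simp add: pack_val_def)
  finally show ?thesis using assms(5) by (simp add: pos_divide_le_eq mult.commute)
qed

text \<open>The two extreme scales: \<open>r = 1\<close> and \<open>r = R\<^bsup>log n / log m\<^esup>\<close>, the first at which the second
  coordinate is not resolved beyond the digits that vary.\<close>

definition mid :: real where "mid = ln n / ln m"

lemma mid_bounds: "0 < mid" "mid < 1"
  using two_le_n n_less_m by (simp_all add: mid_def)

lemma mid_scale: "log n (2 powr (real k * mid)) = log m (2 ^ k)"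
  using two_le_n two_le_m by (simp add: mid_def log_def ln_powr ln_realpow)

lemma mid_range: "2 powr (real k * mid) \<in> {1..2 powr (real k * (1 - (1 - mid)))}"
  using mid_bounds by (simp add: ge_one_powr_ge_zero)

lemma one_range: "1 \<in> {1..2 powr (real k * (1 - \<epsilon>))}" if "\<epsilon> \<le> 1"
  using that by (simp add: ge_one_powr_ge_zero)

theorem discrete_packing_dim_orbit:
  "discrete_packing_dim (orbit (u, v)) = ereal (max (dim1 u) (dim2 u))"
  unfolding discrete_packing_dim_def pack_val_def[symmetric]
proof (rule Inf_ereal_image_eqI)
  fix \<alpha> assume "\<alpha> \<in> {\<alpha>. \<alpha> \<ge> 0 \<and> (\<forall>\<epsilon>\<in>{0<..<1}.
       (\<lambda>k. SUP r\<in>{1 .. 2 powr (real k * (1 - \<epsilon>))}. pack_val (u, v) \<alpha> k r) \<longlonglongrightarrow> 0)}"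
  then have \<alpha>: "0 \<le> \<alpha>" and lim: "\<And>\<epsilon>. 0 < \<epsilon> \<Longrightarrow> \<epsilon> < 1 \<Longrightarrow>
       (\<lambda>k. SUP r\<in>{1 .. 2 powr (real k * (1 - \<epsilon>))}. pack_val (u, v) \<alpha> k r) \<longlonglongrightarrow> 0" by auto
  show "max (dim1 u) (dim2 u) \<le> \<alpha>"
  proof (cases "card \<Lambda> < 2")
    case True
    then show ?thesis using dims_trivial(4,5)[OF True, of u] \<alpha> by simp
  next
    case False
    then have "2 \<le> card \<Lambda>" by simp
    then obtain C :: real where C: "0 < C" and low: "\<And>k0. \<exists>k\<ge>k0. \<forall>r. 1 \<le> r \<longrightarrow> r \<le> 2 ^ k \<longrightarrow>
      (2 ^ k / r) powr min (dim1 u) (dim2 u) \<le> C * packing_number r (orbit (u, v) \<inter> shell k)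
      \<and> (r = 1 \<longrightarrow> (2 ^ k / r) powr dim1 u \<le> C * packing_number r (orbit (u, v) \<inter> shell k))
      \<and> (log m (2 ^ k) \<le> log n r \<longrightarrow> (2 ^ k / r) powr dim2 u \<le> C * packing_number r (orbit (u, v) \<inter> shell k))"
      by (rule packing_lower[of u v]) (rule that)
    have "dim1 u \<le> \<alpha>"
    proof (rule ccontr)
      assume "\<not> dim1 u \<le> \<alpha>"
      then have a: "\<alpha> \<le> dim1 u" by simp
      show False
      \<comment> \<open>The scale r = 1 is admissible whatever \<epsilon> is, so any value
        serves.\<close>
      proof (rule not_tendsto_zeroI[OF _ _ lim[of "1/2"]])
        show "0 < 1 / C" using C by simp
        fix k0
        obtain k where k: "k0 \<le> k" "(2 ^ k / 1) powr dim1 u \<le> C * packing_number 1 (orbit (u, v) \<inter> shell k)"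
          using low[of k0] by force
        have "1 / C \<le> pack_val (u, v) \<alpha> k 1" by (rule pack_val_ge[OF k(2) _ _ a C]) simp_all
        also have "\<dots> \<le> (SUP r\<in>{1 .. 2 powr (real k * (1 - 1/2))}. pack_val (u, v) \<alpha> k r)"
          by (rule cSUP_upper[OF one_range pack_val_bdd[OF \<alpha>]]) simp_all
        finally show "\<exists>k\<ge>k0. 1 / C \<le> (SUP r\<in>{1 .. 2 powr (real k * (1 - 1/2))}. pack_val (u, v) \<alpha> k r)"
          using k(1) by blast
      qed simp_all
    qed
    moreover have "dim2 u \<le> \<alpha>"
    proof (rule ccontr)
      assume "\<not> dim2 u \<le> \<alpha>"
      then have a: "\<alpha> \<le> dim2 u" by simp
      show False
      \<comment> \<open>For this \<epsilon> the range of scales ends exactly at the critical scale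
        2^(k mid).\<close>
      proof (rule not_tendsto_zeroI[OF _ _ lim[of "1 - mid"]])
        show "0 < 1 / C" using C by simp
        fix k0
        obtain k where k: "k0 \<le> k" and kr: "\<forall>r. 1 \<le> r \<longrightarrow> r \<le> 2 ^ k \<longrightarrow> log m (2 ^ k) \<le> log n r \<longrightarrow>
            (2 ^ k / r) powr dim2 u \<le> C * packing_number r (orbit (u, v) \<inter> shell k)"
          using low[of k0] by blast
        let ?r = "2 powr (real k * mid)"
        have r: "1 \<le> ?r" "?r \<le> 2 ^ k" using mid_range[of k] scale_le[of ?r "1 - mid" k] mid_bounds by simp_all
        have "1 / C \<le> pack_val (u, v) \<alpha> k ?r"
          by (rule pack_val_ge[OF _ r a C]) (use kr r mid_scale[of k] in simp)
        also have "\<dots> \<le> (SUP r\<in>{1 .. 2 powr (real k * (1 - (1 - mid)))}. pack_val (u, v) \<alpha> k r)"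
          by (rule cSUP_upper[OF mid_range pack_val_bdd[OF \<alpha>]]) (use mid_bounds in simp)
        finally show "\<exists>k\<ge>k0. 1 / C \<le> (SUP r\<in>{1 .. 2 powr (real k * (1 - (1 - mid)))}. pack_val (u, v) \<alpha> k r)"
          using k by blast
      qed (use mid_bounds in simp_all)
    qed
    ultimately show ?thesis by simp
  qed
next
  fix \<alpha> assume a: "max (dim1 u) (dim2 u) < \<alpha>"
  then have \<alpha>: "0 \<le> \<alpha>" using dim1_nonneg[of u] by simp
  obtain C :: real where C: "0 < C" and up: "\<And>k r. \<lbrakk>2 \<le> k; 1 \<le> r; r \<le> 2 ^ k\<rbrakk> \<Longrightarrow>
      real (packing_number r (orbit (u, v) \<inter> shell k)) \<le> C * (real k + 1) * (2 ^ k / r) powr max (dim1 u) (dim2 u)"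
    by (rule packing_upper[of u v]) (rule that)
  have "(\<lambda>k. SUP r\<in>{1 .. 2 powr (real k * (1 - \<epsilon>))}. pack_val (u, v) \<alpha> k r) \<longlonglongrightarrow> 0"
    if e: "0 < \<epsilon>" "\<epsilon> < 1" for \<epsilon>
  proof (rule tendsto_zero_by_decay)
    show "0 < \<epsilon> * (\<alpha> - max (dim1 u) (dim2 u))" using a e by simp
    fix k :: nat assume k: "2 \<le> k"
    show "0 \<le> (SUP r\<in>{1 .. 2 powr (real k * (1 - \<epsilon>))}. pack_val (u, v) \<alpha> k r)"
      by (rule order_trans[OF pack_val_nonneg cSUP_upper[OF one_range pack_val_bdd[OF \<alpha>]]]) (use e in simp_all)
    show "(SUP r\<in>{1 .. 2 powr (real k * (1 - \<epsilon>))}. pack_val (u, v) \<alpha> k r)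
        \<le> C * (real k + 1) * 2 powr (- (real k * (\<epsilon> * (\<alpha> - max (dim1 u) (dim2 u)))))"
    proof (rule cSUP_least)
      show "{1 .. 2 powr (real k * (1 - \<epsilon>))} \<noteq> {}" using one_range[of \<epsilon> k] e by auto
      fix r assume r: "r \<in> {1 .. 2 powr (real k * (1 - \<epsilon>))}"
      then have r': "1 \<le> r" "r \<le> 2 powr (real k * (1 - \<epsilon>))" by simp_all
      have "r \<le> 2 ^ k" by (rule scale_le[OF r'(1) _ r'(2)]) (use e in simp)
      from pack_val_le[OF up[OF k r'(1) this] r' _ C] a
      show "pack_val (u, v) \<alpha> k r \<le> C * (real k + 1) * 2 powr (- (real k * (\<epsilon> * (\<alpha> - max (dim1 u) (dim2 u)))))"
        by simp
    qed
  qed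
  then show "\<alpha> \<in> {\<alpha>. \<alpha> \<ge> 0 \<and> (\<forall>\<epsilon>\<in>{0<..<1}.
       (\<lambda>k. SUP r\<in>{1 .. 2 powr (real k * (1 - \<epsilon>))}. pack_val (u, v) \<alpha> k r) \<longlonglongrightarrow> 0)}"
    using \<alpha> by simp
qed

lemma INF_pack_val_tendsto:
  assumes "\<And>k. r k \<in> {1 .. 2 powr (real k * (1 - \<epsilon>))}" "D < \<alpha>" "0 < C" "0 < \<epsilon>"
    "\<And>k. 2 \<le> k \<Longrightarrow> real (packing_number (r k) (orbit z \<inter> shell k)) \<le> C * (real k + 1) * (2 ^ k / r k) powr D"
  shows "(\<lambda>k. INF r\<in>{1 .. 2 powr (real k * (1 - \<epsilon>))}. pack_val z \<alpha> k r) \<longlonglongrightarrow> 0"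
proof (rule tendsto_zero_by_decay)
  show "0 < \<epsilon> * (\<alpha> - D)" using assms(2,4) by simp
  fix k :: nat assume k: "2 \<le> k"
  show "0 \<le> (INF r\<in>{1 .. 2 powr (real k * (1 - \<epsilon>))}. pack_val z \<alpha> k r)"
    by (rule cINF_greatest) (use assms(1)[of k] pack_val_nonneg in auto)
  have "(INF r\<in>{1 .. 2 powr (real k * (1 - \<epsilon>))}. pack_val z \<alpha> k r) \<le> pack_val z \<alpha> k (r k)"
    by (rule cINF_lower[OF _ assms(1)]) (rule bdd_belowI2[OF pack_val_nonneg])
  also have "\<dots> \<le> C * (real k + 1) * 2 powr (- (real k * (\<epsilon> * (\<alpha> - D))))"
    by (rule pack_val_le[OF assms(5)[OF k] _ _ _ assms(3)]) (use assms(1)[of k] assms(2) in simp_all)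
  finally show "(INF r\<in>{1 .. 2 powr (real k * (1 - \<epsilon>))}. pack_val z \<alpha> k r)
      \<le> C * (real k + 1) * 2 powr (- (real k * (\<epsilon> * (\<alpha> - D))))" .
qed

text \<open>For the upper bound one good scale per shell is enough, r = 1 or the critical one. For
  the lower bound the estimate with the smaller exponent holds at all scales at once.\<close>

theorem lower_entropy_index_orbit:
  "lower_entropy_index (orbit (u, v)) = ereal (min (dim1 u) (dim2 u))"
  unfolding lower_entropy_index_def pack_val_def[symmetric]
proof (rule Inf_ereal_image_eqI)
  fix \<alpha> assume "\<alpha> \<in> {\<alpha>. \<alpha> \<ge> 0 \<and> (\<exists>\<epsilon>\<in>{0<..<1}.
       (\<lambda>k. INF r\<in>{1 .. 2 powr (real k * (1 - \<epsilon>))}. pack_val (u, v) \<alpha> k r) \<longlonglongrightarrow> 0)}"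
  then obtain \<epsilon> where \<alpha>: "0 \<le> \<alpha>" and e: "0 < \<epsilon>" "\<epsilon> < 1"
    and lim: "(\<lambda>k. INF r\<in>{1 .. 2 powr (real k * (1 - \<epsilon>))}. pack_val (u, v) \<alpha> k r) \<longlonglongrightarrow> 0" by auto
  show "min (dim1 u) (dim2 u) \<le> \<alpha>"
  proof (cases "card \<Lambda> < 2")
    case True
    then show ?thesis using dims_trivial(4,5)[OF True, of u] \<alpha> by simp
  next
    case False
    then have "2 \<le> card \<Lambda>" by simp
    then obtain C :: real where C: "0 < C" and low: "\<And>k0. \<exists>k\<ge>k0. \<forall>r. 1 \<le> r \<longrightarrow> r \<le> 2 ^ k \<longrightarrow>
      (2 ^ k / r) powr min (dim1 u) (dim2 u) \<le> C * packing_number r (orbit (u, v) \<inter> shell k)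
      \<and> (r = 1 \<longrightarrow> (2 ^ k / r) powr dim1 u \<le> C * packing_number r (orbit (u, v) \<inter> shell k))
      \<and> (log m (2 ^ k) \<le> log n r \<longrightarrow> (2 ^ k / r) powr dim2 u \<le> C * packing_number r (orbit (u, v) \<inter> shell k))"
      by (rule packing_lower[of u v]) (rule that)
    show ?thesis
    proof (rule ccontr)
      assume "\<not> min (dim1 u) (dim2 u) \<le> \<alpha>"
      then have a: "\<alpha> \<le> min (dim1 u) (dim2 u)" by linarith
      show False
      proof (rule not_tendsto_zeroI[OF _ _ lim])
        show "0 < 1 / C" using C by simp
        fix k0
        obtain k where k: "k0 \<le> k" and kr: "\<forall>r. 1 \<le> r \<longrightarrow> r \<le> 2 ^ k \<longrightarrow>
            (2 ^ k / r) powr min (dim1 u) (dim2 u) \<le> C * packing_number r (orbit (u, v) \<inter> shell k)"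
          using low[of k0] by blast
        have "1 / C \<le> (INF r\<in>{1 .. 2 powr (real k * (1 - \<epsilon>))}. pack_val (u, v) \<alpha> k r)"
        proof (rule cINF_greatest)
          show "{1 .. 2 powr (real k * (1 - \<epsilon>))} \<noteq> {}" using one_range[of \<epsilon> k] e by auto
          fix r assume "r \<in> {1 .. 2 powr (real k * (1 - \<epsilon>))}"
          then have r: "1 \<le> r" "r \<le> 2 powr (real k * (1 - \<epsilon>))" by simp_all
          have r2: "r \<le> 2 ^ k" by (rule scale_le[OF r(1) _ r(2)]) (use e in simp)
          show "1 / C \<le> pack_val (u, v) \<alpha> k r"
            by (rule pack_val_ge[OF _ r(1) r2 a C]) (use kr r(1) r2 in blast)
        qed
        then show "\<exists>k\<ge>k0. 1 / C \<le> (INF r\<in>{1 .. 2 powr (real k * (1 - \<epsilon>))}. pack_val (u, v) \<alpha> k r)"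
          using k by blast
      qed
    qed
  qed
next
  fix \<alpha> assume a: "min (dim1 u) (dim2 u) < \<alpha>"
  then have \<alpha>: "0 \<le> \<alpha>" using dim1_nonneg[of u] dim2_nonneg[of u] by simp
  obtain C :: real where C: "0 < C" and up1: "\<And>k r. \<lbrakk>2 \<le> k; r = 1\<rbrakk> \<Longrightarrow>
      real (packing_number r (orbit (u, v) \<inter> shell k)) \<le> C * (real k + 1) * (2 ^ k / r) powr dim1 u"
    and up2: "\<And>k r. \<lbrakk>2 \<le> k; 1 \<le> r; r \<le> 2 ^ k; log m (2 ^ k) \<le> log n r\<rbrakk> \<Longrightarrow>
      real (packing_number r (orbit (u, v) \<inter> shell k)) \<le> C * (real k + 1) * (2 ^ k / r) powr dim2 u"
    by (rule packing_upper[of u v]) (rule that)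
  have "\<exists>\<epsilon>\<in>{0<..<1}. (\<lambda>k. INF r\<in>{1 .. 2 powr (real k * (1 - \<epsilon>))}. pack_val (u, v) \<alpha> k r) \<longlonglongrightarrow> 0"
  proof (cases "dim1 u < \<alpha>")
    case True
    have "(\<lambda>k. INF r\<in>{1 .. 2 powr (real k * (1 - 1/2))}. pack_val (u, v) \<alpha> k r) \<longlonglongrightarrow> 0"
      by (rule INF_pack_val_tendsto[where r = "\<lambda>_. 1", OF one_range True C _ up1]) simp_all
    then show ?thesis by (intro bexI[of _ "1/2"]) simp_all
  next
    case False
    then have d: "dim2 u < \<alpha>" using a by simp
    have "(\<lambda>k. INF r\<in>{1 .. 2 powr (real k * (1 - (1 - mid)))}. pack_val (u, v) \<alpha> k r) \<longlonglongrightarrow> 0"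
    proof (rule INF_pack_val_tendsto[where r = "\<lambda>k. 2 powr (real k * mid)", OF mid_range d C])
      show "0 < 1 - mid" using mid_bounds by simp
      fix k :: nat assume k: "2 \<le> k"
      let ?r = "2 powr (real k * mid)"
      have r: "1 \<le> ?r" "?r \<le> 2 ^ k" using mid_range[of k] scale_le[of ?r "1 - mid" k] mid_bounds by simp_all
      show "real (packing_number ?r (orbit (u, v) \<inter> shell k)) \<le> C * (real k + 1) * (2 ^ k / ?r) powr dim2 u"
        by (rule up2[OF k r]) (simp add: mid_scale)
    qed
    then show ?thesis using mid_bounds by (intro bexI[of _ "1 - mid"]) simp_all
  qed
  then show "\<alpha> \<in> {\<alpha>. \<alpha> \<ge> 0 \<and> (\<exists>\<epsilon>\<in>{0<..<1}.
       (\<lambda>k. INF r\<in>{1 .. 2 powr (real k * (1 - \<epsilon>))}. pack_val (u, v) \<alpha> k r) \<longlonglongrightarrow> 0)}"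
    using \<alpha> by simp
qed

end

section \<open>Discrete Hausdorff dimension: upper bound\<close>

lemma sum_UN_le:
  fixes f :: "'a \<Rightarrow> real"
  assumes "finite I" "\<And>i. i \<in> I \<Longrightarrow> finite (A i)" "\<And>x. 0 \<le> f x"
  shows "sum f (\<Union>i\<in>I. A i) \<le> (\<Sum>i\<in>I. sum f (A i))"
  using assms(1,2)
proof (induction I rule: finite_induct)
  case (insert i I)
  have fin: "finite (A i)" "finite (\<Union>i\<in>I. A i)" using insert by auto
  have "sum f (\<Union>i\<in>insert i I. A i) = sum f (A i) + sum f ((\<Union>i\<in>I. A i) - A i)"
    using sum.union_disjoint[of "A i" "(\<Union>i\<in>I. A i) - A i" f] fin by (simp add: Un_Diff_cancel)
  also have "sum f ((\<Union>i\<in>I. A i) - A i) \<le> sum f (\<Union>i\<in>I. A i)"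
    by (rule sum_mono2[OF fin(2)]) (use assms(3) in auto)
  also have "\<dots> \<le> (\<Sum>i\<in>I. sum f (A i))" using insert by simp
  finally show ?case using insert by simp
qed simp

lemma prod_exp_if:
  fixes y :: "nat \<Rightarrow> real"
  shows "(\<Prod>l<k. exp ((if a \<le> l \<and> l < K then t * y l else 0) - (if b \<le> l \<and> l < K then y l else 0)))
    = exp (t * (\<Sum>l\<in>{a..<min K k}. y l) - (\<Sum>l\<in>{b..<min K k}. y l))"
proof -
  have *: "(\<Sum>l<k. if a \<le> l \<and> l < K then y l else 0) = (\<Sum>l\<in>{a..<min K k}. y l)" for a and y :: "nat \<Rightarrow> real"
    by (rule sum.mono_neutral_cong_right) auto
  show ?thesis
    unfolding exp_sum[OF finite_lessThan, symmetric] sum_subtractf * sum_distrib_left ..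
qed

text \<open>Scaling by \<open>t \<le> 1\<close> cannot keep up with a constant loss in each step.\<close>

lemma chain_step:
  fixes g :: "nat \<Rightarrow> real"
  assumes "g 0 = 0" "\<bar>g J\<bar> \<le> Q" "0 \<le> t" "t \<le> 1" "0 < \<delta>" "Q < J * \<delta>"
  shows "\<exists>j<J. - \<delta> \<le> t * g (Suc j) - g j"
proof (rule ccontr)
  assume no: "\<not> ?thesis"
  \<comment> \<open>If every step fails, \<open>t * g (Suc j)\<close> is negative, and
    \<open>g (Suc j)\<close> is no larger because t <= 1. So the loss of \<delta> accumulates over
    the steps until it exceeds \<open>Q\<close>.\<close>
  have "g j \<le> - (real j * \<delta>)" if "j \<le> J" for j
    using that
  proof (induction j)
    case (Suc j)
    have "j < J" using Suc.prems by simp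
    then have "\<not> - \<delta> \<le> t * g (Suc j) - g j" using no by blast
    then have 1: "t * g (Suc j) < - (real (Suc j) * \<delta>)" using Suc by (simp add: distrib_right)
    moreover have "0 \<le> real (Suc j) * \<delta>" using assms(5) by simp
    ultimately have neg: "t * g (Suc j) < 0" by linarith
    then have "g (Suc j) < 0" using assms(3) by (simp add: mult_less_0_iff)
    then have "g (Suc j) \<le> t * g (Suc j)" using assms(4) mult_right_mono_neg[of t 1 "g (Suc j)"] by simp
    then show ?case using 1 by linarith
  qed (use assms(1) in simp)
  from this[of J] show False using assms(2,6) by linarith
qed

context carpet
begin

section \<open>Column weights and the cover by approximate squares\<close>

definition rcol :: "int \<Rightarrow> nat \<Rightarrow> real" where "rcol u i = real (col_count \<Lambda> i) / real (eta m \<Lambda> u)"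

definition Zs :: "int \<Rightarrow> real \<Rightarrow> real" where "Zs u t = (\<Sum>i\<in>cols. rcol u i powr t)"

definition dimH :: "int \<Rightarrow> real \<Rightarrow> real" where "dimH u t = log m (Zs u t) + log n (eta m \<Lambda> u)"

lemma rcol_pos: "i \<in> cols \<Longrightarrow> 0 < rcol u i"
  using num_cols_real(4)[of u] by (simp add: rcol_def nonempty_cols_def)

text \<open>A main column has at least \<open>eta\<close> digits and contributes a term of at least
  1.\<close>

lemma Zs_ge_1:
  assumes "0 \<le> t"
  shows "1 \<le> Zs u t"
proof -
  obtain e where e: "main_col u e" by (rule main_col_exists)
  then have ec: "e \<in> cols" by (simp add: main_col_def)
  have "1 \<le> rcol u e"
  proof (cases "eta m \<Lambda> u = 1")
    case True
    then show ?thesis using ec by (simp add: rcol_def nonempty_cols_def)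
  next
    case False
    then have "col_count \<Lambda> e = eta m \<Lambda> u" using e by (simp add: main_col_def)
    then show ?thesis using num_cols_real(4)[of u] by (simp add: rcol_def)
  qed
  then have "1 \<le> rcol u e powr t" using assms by (rule ge_one_powr_ge_zero)
  also have "\<dots> \<le> Zs u t" unfolding Zs_def by (rule member_le_sum[OF ec _ finite_cols]) simp
  finally show ?thesis .
qed

text \<open>The weight \<open>rcol u i powr t\<close> of a column is divided evenly among its
  digits, up to the factor \<open>eta\<close>. These weights belong to the positions where both
  digits are seen.\<close>

lemma sum_rcol_digits:
  "(\<Sum>c\<in>\<Lambda>. rcol u (fst c) powr (t - 1)) = eta m \<Lambda> u * Zs u t"
proof -
  have "(\<Sum>c\<in>\<Lambda>. rcol u (fst c) powr (t - 1)) = (\<Sum>i\<in>cols. real (col_count \<Lambda> i) * rcol u i powr (t - 1))"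
    by (rule sum_digits_by_column)
  also have "\<dots> = (\<Sum>i\<in>cols. eta m \<Lambda> u * rcol u i powr t)"
  proof (rule sum.cong[OF refl])
    fix i assume "i \<in> cols"
    then have p: "0 < rcol u i" by (rule rcol_pos)
    have "real (col_count \<Lambda> i) = eta m \<Lambda> u * rcol u i"
      using num_cols_real(4)[of u] by (simp add: rcol_def)
    moreover have "rcol u i powr t = rcol u i * rcol u i powr (t - 1)"
      using p by (simp add: powr_diff)
    ultimately show "real (col_count \<Lambda> i) * rcol u i powr (t - 1) = eta m \<Lambda> u * rcol u i powr t" by simp
  qed
  finally show ?thesis by (simp add: Zs_def sum_distrib_left)
qed

text \<open>With the column weights the two exponents of the count coincide, so the weighted count
  is a pure power of R / r at every scale.\<close>

lemma dimH_dims: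
  assumes "0 \<le> t"
  shows "dimM (eta m \<Lambda> u * Zs u t) (eta m \<Lambda> u) = dimH u t" "dimA (Zs u t) (eta m \<Lambda> u) = dimH u t"
  using Zs_ge_1[OF assms, of u] num_cols_real(4)[of u]
  by (simp_all add: dimM_def dimA_def dimH_def log_mult)

text \<open>Birkhoff sums of \<open>ln (rcol u i)\<close> along the first digits; as a function of
  the scale they are the \<open>g\<close> of \<open>chain_step\<close>.\<close>

definition colsum :: "int \<Rightarrow> nat \<Rightarrow> nat \<Rightarrow> int \<times> int \<Rightarrow> nat \<Rightarrow> real" where
  "colsum u K k p a = (\<Sum>l\<in>{a..<min K k}. ln (rcol u (dig m l (fst p))))"

lemma prod_colw:
  assumes "a \<le> b" "b \<le> K" "\<And>l. l < k \<Longrightarrow> digits p l \<in> \<Lambda>"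
  shows "(\<Prod>l<k. colw (\<lambda>i. rcol u i powr t) (\<lambda>i. rcol u i powr (t - 1)) a b K l (code a b K p l))
    = exp (t * colsum u K k p a - colsum u K k p b)"
  unfolding colsum_def prod_exp_if[symmetric]
proof (rule prod.cong[OF refl])
  fix l assume "l \<in> {..<k}"
  then have "digits p l \<in> \<Lambda>" using assms(3) by simp
  then have "dig m l (fst p) \<in> cols" unfolding cols_eq digits_def by force
  then have p: "0 < rcol u (dig m l (fst p))" by (rule rcol_pos)
  then show "colw (\<lambda>i. rcol u i powr t) (\<lambda>i. rcol u i powr (t - 1)) a b K l (code a b K p l) =
    exp ((if a \<le> l \<and> l < K then t * ln (rcol u (dig m l (fst p))) else 0)
       - (if b \<le> l \<and> l < K then ln (rcol u (dig m l (fst p))) else 0))"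
    using assms(1,2) by (auto simp: colw_def code_def digits_def powr_def algebra_simps)
qed

text \<open>The cells at scale \<open>(steps K (Suc j), steps K j)\<close> are squares up to a bounded factor. The
  index \<open>j\<close> that is used to cover a point is the one provided by \<open>chain_step\<close>.\<close>

fun steps :: "nat \<Rightarrow> nat \<Rightarrow> nat" where
  "steps K 0 = K" | "steps K (Suc j) = Suc (lo m (real n ^ steps K j))"

lemma steps_bounds:
  assumes "1 \<le> K"
  shows "1 \<le> steps K j" "steps K (Suc j) \<le> steps K j" "steps K j \<le> K"
    "real n ^ steps K j \<le> real m ^ steps K (Suc j)" "real m ^ steps K (Suc j) \<le> m * real n ^ steps K j"
proof -
  show 1: "1 \<le> steps K j" for j using assms by (cases j) simp_all
  have p1: "1 \<le> real n ^ steps K j" for j using two_le_n by (intro one_le_power) simp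
  show 2: "steps K (Suc j) \<le> steps K j" for j
  proof -
    have "real m ^ lo m (real n ^ steps K j) \<le> real n ^ steps K j" by (rule lo_bounds(1)[OF two_le_m p1])
    also have "\<dots> < real m ^ steps K j" using n_less_m 1[of j] by (intro power_strict_mono) simp_all
    finally have "lo m (real n ^ steps K j) < steps K j" using two_le_m by simp
    then show ?thesis by simp
  qed
  show "steps K j \<le> K" by (induction j) (use 2 order_trans in \<open>auto simp del: steps.simps(2)\<close>)
  show "real n ^ steps K j \<le> real m ^ steps K (Suc j)"
    using lo_bounds(2)[OF two_le_m p1, of j] by simp
  show "real m ^ steps K (Suc j) \<le> m * real n ^ steps K j"
    using mult_left_mono[OF lo_bounds(1)[OF two_le_m p1, of j], of "real m"] by simp
qed

lemma steps_Suc_le: "1 \<le> K \<Longrightarrow> steps K (Suc j) \<le> steps K 1"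
proof (induction j)
  case (Suc j)
  then show ?case using steps_bounds(2)[of K "Suc j"] by linarith
qed simp

text \<open>For n^b <= m^a, as for consecutive \<open>steps\<close>, one cube of side m^a holds the
  whole cell.\<close>

definition cell_cube :: "nat \<Rightarrow> nat \<Rightarrow> int \<times> int \<Rightarrow> (int \<times> int) set" where
  "cell_cube a b q = cube (int m ^ a * fst q, int n ^ b * snd q) (m ^ a)"

lemma mem_cell_cube:
  assumes "real n ^ b \<le> real m ^ a"
  shows "p \<in> cell_cube a b (cell a b p)"
proof -
  have p: "0 < int m ^ a" "0 < int n ^ b" using m_pos n_pos by simp_all
  have "real_of_int (int n ^ b) \<le> real_of_int (int m ^ a)" using assms by simp
  then have nm: "int n ^ b \<le> int m ^ a" unfolding of_int_le_iff .
  show ?thesis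
    using div_bounds[OF p(1) refl, of "fst p"] div_bounds[OF p(2) refl, of "snd p"] nm
    by (simp add: cell_cube_def cube_def cell_def distrib_left)
qed

lemma cell_cube_diam: "cell_cube a b q \<in> cubes" "cube_diam (cell_cube a b q) = m ^ a"
proof -
  have p: "0 < m ^ a" using m_pos by simp
  show "cell_cube a b q \<in> cubes" unfolding cell_cube_def cubes_def using p by blast
  show "cube_diam (cell_cube a b q) = m ^ a" unfolding cell_cube_def by (rule cube_diam_cube[OF p])
qed

text \<open>By \<open>chain_step\<close> every point has, at one of \<open>J\<close> scales, a cell
  of weight at least exp (-\<epsilon> K). \<open>origin_piece_count\<close> allows few such cells,
  and the cubes around them form the cover.\<close>

lemma nu_orbit_upper:
  assumes t: "0 \<le> t" "t \<le> 1" and \<alpha>: "dimH u t < \<alpha>" "0 < \<alpha>"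
  obtains C s i0 where "0 < s" "\<And>i. i0 \<le> i \<Longrightarrow>
    nu \<alpha> (orbit (u, v)) (shell i) \<le> C * (real i + 1) * 2 powr (- (real i * s))"
proof -
  let ?D = "dimH u t" and ?\<eta> = "real (eta m \<Lambda> u)"
  \<comment> \<open>Cells of side r <= mn * R^mid make \<open>(r / R) powr (\<alpha> - ?D)\<close>
    at most a constant times R^(-\<sigma>).\<close>
  define \<sigma> where "\<sigma> = (1 - mid) * (\<alpha> - ?D)"
  have \<sigma>: "0 < \<sigma>" using mid_bounds \<alpha> by (simp add: \<sigma>_def)
  \<comment> \<open>Since K <= i + 1, the loss exp (\<epsilon> K) then uses up only half of that
    gain 2^(-\<sigma> i).\<close>
  define \<epsilon> where "\<epsilon> = \<sigma> * ln 2 / 2"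
  have \<epsilon>: "0 < \<epsilon>" using \<sigma> by (simp add: \<epsilon>_def)
  define Q where "Q = (\<Sum>i\<in>cols. \<bar>ln (rcol u i)\<bar>)"
  \<comment> \<open>All Birkhoff sums are bounded by K * Q, so with more than Q / \<epsilon> scales
    one of them loses at most \<epsilon> * K.\<close>
  obtain J :: nat where J: "Q / \<epsilon> < J" using reals_Archimedean2 by blast
  then have QJ: "Q < J * \<epsilon>" using \<epsilon> by (simp add: field_simps)
  have Q0: "0 \<le> Q" unfolding Q_def by (simp add: sum_nonneg)
  \<comment> \<open>\<open>steps\<close> rounds by a factor of up to m, which is log_n m in the
    exponent of n.\<close>
  define c where "c = 1 + ln (real m) / ln (real n)"
  have ln_n: "0 < ln (real n)" "0 < ln (real m)" using two_le_n two_le_m by simp_all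
  have c1: "1 \<le> c" unfolding c_def using ln_n by simp
  define C0 where "C0 = exp (2 * c * (ln (Zs u t) + ln (?\<eta> * Zs u t) + ln ?\<eta>))"
  have C0: "0 < C0" by (simp add: C0_def)
  have Z1: "1 \<le> Zs u t" by (rule Zs_ge_1[OF t(1)])
  have \<eta>1: "1 \<le> ?\<eta>" by (rule num_cols_real(4))
  have \<eta>Z1: "1 \<le> ?\<eta> * Zs u t" using mult_mono[OF \<eta>1 Z1] \<eta>1 by simp
  define mn where "mn = real m * real n"
  have mn0: "0 < mn" using m_pos n_pos by (simp add: mn_def)
  \<comment> \<open>From here on mn * R^mid <= R, so no cell is wider than the shell.\<close>
  define i0 where "i0 = max 2 (nat \<lceil>log 2 mn / (1 - mid)\<rceil>)"
  define C where "C = J * (exp \<epsilon> * C0 * mn powr (\<alpha> - ?D))"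
  have main: "nu \<alpha> (orbit (u, v)) (shell i) \<le> C * (real i + 1) * 2 powr (- (real i * (\<sigma> / 2)))" if i: "i0 \<le> i" for i
  proof -
    define R where "R = (2::real) ^ i"
    have R1: "1 \<le> R" by (simp add: R_def)
    have i2: "2 \<le> i" using i by (simp add: i0_def)
    define K L where "K = Suc (lo m R)" and "L = Suc (lo n R)"
    have KL: "K \<le> L" "1 \<le> K" "1 \<le> L" using lo_base_mono[OF R1] by (simp_all add: K_def L_def)
    let ?a = "steps K"
    note sb = steps_bounds[OF KL(2)]
    define r where "r j = real m ^ ?a (Suc j)" for j
    have r1: "1 \<le> r j" for j unfolding r_def using two_le_m by (intro one_le_power) simp
    have rR: "r j \<le> mn * R powr mid" for j
    proof -
      have "r j \<le> real m ^ ?a 1"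
        unfolding r_def using steps_Suc_le[OF KL(2), of j] two_le_m by (intro power_increasing) simp_all
      also have "\<dots> \<le> m * real n ^ K" using sb(5)[of 0] by simp
      also have "\<dots> = mn * real n ^ lo m R" by (simp add: K_def mn_def)
      also have "real n ^ lo m R \<le> R powr mid"
      proof -
        have "0 \<le> log m R" using R1 two_le_m by simp
        then have "real (lo m R) \<le> log m R" by (simp add: lo_def)
        then have "real n powr real (lo m R) \<le> real n powr log m R"
          using two_le_n by (intro powr_mono) simp_all
        also have "real n powr log m R = R powr mid"
          using two_le_n R1 by (simp add: powr_def log_def mid_def mult_ac)
        finally show ?thesis using n_pos by (simp add: powr_realpow)
      qed
      finally show ?thesis using mn0 by simp
    qed
    have R2: "mn * R powr mid \<le> R"
    proof -
      have "log 2 mn / (1 - mid) \<le> real i" using i unfolding i0_def by linarith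
      then have "log 2 mn \<le> real i * (1 - mid)" using mid_bounds by (simp add: pos_divide_le_eq)
      then have "2 powr log 2 mn \<le> 2 powr (real i * (1 - mid))" by (intro powr_mono) simp_all
      then have "mn \<le> R powr (1 - mid)" using mn0 by (simp add: R_def powr_realpow[symmetric] powr_powr)
      then have "mn * R powr mid \<le> R powr (1 - mid) * R powr mid" by (intro mult_right_mono) simp_all
      also have "\<dots> = R" using R1 by (simp add: powr_add[symmetric])
      finally show ?thesis .
    qed
    have rR': "r j \<le> R" for j using rR[of j] R2 by linarith
    \<comment> \<open>The points of the \<open>k\<close>-th piece whose cell at the
      \<open>j\<close>-th scale is heavy.\<close>
    define S where "S k j = {p \<in> origin_piece (u, v) K L k. exp (- (\<epsilon> * K)) \<le>
        (\<Prod>l<k. colw (\<lambda>i. rcol u i powr t) (\<lambda>i. rcol u i powr (t - 1)) (?a (Suc j)) (?a j) K l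
          (code (?a (Suc j)) (?a j) K p l))}" for k j
    define x where "x = exp \<epsilon> * C0 * mn powr (\<alpha> - ?D) * 2 powr (- (real i * (\<sigma> / 2)))"
    have S: "finite (cell (?a (Suc j)) (?a j) ` S k j)"
      "card (cell (?a (Suc j)) (?a j) ` S k j) * (r j / R) powr \<alpha> \<le> x" if k: "k \<in> {1..L}" for k j
    proof -
      let ?P = "cprod (Zs u t) (?\<eta> * Zs u t) ?\<eta> (?a (Suc j)) (?a j) K L"
      have aK: "?a (Suc j) \<le> K" "?a j \<le> L" "k \<le> L" using sb(3)[of "Suc j"] sb(3)[of j] KL k by simp_all
      have "S k j \<subseteq> origin_piece (u, v) K L k" by (auto simp: S_def)
      note cnt = origin_piece_count[where \<phi> = "\<lambda>i. rcol u i powr t" and \<psi> = "\<lambda>i. rcol u i powr (t - 1)"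
          and \<theta> = "exp (- (\<epsilon> * K))" and A = "Zs u t" and B = "?\<eta> * Zs u t",
          OF sb(2) aK(1) KL(1) aK(2,3) this _ _ _ _ _ _ Z1 \<eta>Z1, unfolded fst_conv]
      show "finite (cell (?a (Suc j)) (?a j) ` S k j)"
        by (rule cnt(1)) (simp_all add: S_def Zs_def[symmetric] sum_rcol_digits)
      have "exp (- (\<epsilon> * K)) * card (cell (?a (Suc j)) (?a j) ` S k j) \<le> ?P"
        by (rule cnt(2)) (simp_all add: S_def Zs_def[symmetric] sum_rcol_digits)
      also have "?P \<le> C0 * (R / r j) powr ?D"
      proof -
        have near: "\<bar>real (?a (Suc j)) - log m (r j)\<bar> \<le> c"
          unfolding r_def using two_le_m c1 by (simp add: log_nat_power del: steps.simps)
        have "log n (real n ^ ?a j) \<le> log n (r j)" unfolding r_def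
          by (rule log_mono) (use sb(4)[of j] two_le_n in \<open>simp_all del: steps.simps\<close>)
        then have 1: "real (?a j) \<le> log n (r j)" using two_le_n by (simp add: log_nat_power)
        have "log n (r j) \<le> log n (m * real n ^ ?a j)" unfolding r_def
          by (rule log_mono) (use sb(5)[of j] two_le_n two_le_m in \<open>simp_all del: steps.simps\<close>)
        also have "\<dots> = log n m + real (?a j)" using two_le_n two_le_m by (simp add: log_mult log_nat_power)
        finally have "log n (r j) \<le> real (?a j) + (c - 1)" by (simp add: c_def log_def)
        then have near2: "\<bar>real (?a j) - log n (r j)\<bar> \<le> c" using 1 by linarith
        have near3: "\<bar>real K - log m R\<bar> \<le> c" "?\<eta> = 1 \<or> \<bar>real L - log n R\<bar> \<le> c"
          using lo_bounds(4)[OF two_le_m R1] lo_bounds(4)[OF two_le_n R1] c1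
          unfolding K_def L_def by linarith+
        have "?P \<le> C0 * (R / r j) powr max (dimM (?\<eta> * Zs u t) ?\<eta>) (dimA (Zs u t) ?\<eta>)"
          unfolding C0_def by (rule cprod_est(1)[OF Z1 \<eta>Z1 \<eta>1 r1 rR' near near2 near3])
        then show ?thesis unfolding dimH_dims[OF t(1)] by simp
      qed
      finally have "card (cell (?a (Suc j)) (?a j) ` S k j) \<le> exp (\<epsilon> * K) * (C0 * (R / r j) powr ?D)"
        by (simp add: exp_minus field_simps)
      then have "card (cell (?a (Suc j)) (?a j) ` S k j) * (r j / R) powr \<alpha>
          \<le> exp (\<epsilon> * K) * (C0 * (R / r j) powr ?D) * (r j / R) powr \<alpha>" by (rule mult_right_mono) simp
      also have "\<dots> = exp (\<epsilon> * K) * C0 * (r j / R) powr (\<alpha> - ?D)"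
      proof -
        have "(R / r j) powr ?D = inverse ((r j / R) powr ?D)" using r1[of j] R1 by (simp add: powr_divide)
        then show ?thesis by (simp add: powr_diff divide_inverse mult_ac)
      qed
      also have "\<dots> \<le> (exp \<epsilon> * 2 powr (real i * (\<sigma> / 2))) * C0 * (mn powr (\<alpha> - ?D) * 2 powr (- (real i * \<sigma>)))"
      proof (intro mult_mono)
        have "real (lo m R) \<le> real i"
        proof -
          have "real m ^ lo m R \<le> 2 ^ i" using lo_bounds(1)[OF two_le_m R1] by (simp add: R_def)
          moreover have "(2::real) ^ lo m R \<le> real m ^ lo m R" using two_le_m by (intro power_mono) simp_all
          ultimately have "(2::real) ^ lo m R \<le> 2 ^ i" by linarith
          then show ?thesis by simp
        qed
        then have "\<epsilon> * K \<le> \<epsilon> * (1 + real i)" using \<epsilon> by (intro mult_left_mono) (simp_all add: K_def)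
        then have "exp (\<epsilon> * K) \<le> exp (\<epsilon> + real i * (\<sigma> / 2) * ln 2)"
          by (simp add: \<epsilon>_def algebra_simps)
        also have "\<dots> = exp \<epsilon> * 2 powr (real i * (\<sigma> / 2))" by (simp add: exp_add powr_def)
        finally show "exp (\<epsilon> * K) \<le> exp \<epsilon> * 2 powr (real i * (\<sigma> / 2))" .
        have "r j / R \<le> mn * R powr mid / R" using rR[of j] R1 by (intro divide_right_mono) simp_all
        also have "\<dots> = mn * R powr (mid - 1)" using R1 by (simp add: powr_diff)
        finally have "(r j / R) powr (\<alpha> - ?D) \<le> (mn * R powr (mid - 1)) powr (\<alpha> - ?D)"
          using r1[of j] R1 \<alpha> by (intro powr_mono2) simp_all
        also have "\<dots> = mn powr (\<alpha> - ?D) * 2 powr (- (real i * \<sigma>))"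
          using mn0 by (simp add: powr_mult R_def powr_realpow[symmetric] powr_powr \<sigma>_def algebra_simps)
        finally show "(r j / R) powr (\<alpha> - ?D) \<le> mn powr (\<alpha> - ?D) * 2 powr (- (real i * \<sigma>))" .
      qed (use C0 in simp_all)
      also have "\<dots> = x"
      proof -
        have "2 powr (real i * (\<sigma> / 2)) * 2 powr (- (real i * \<sigma>)) = (2::real) powr (- (real i * (\<sigma> / 2)))"
          by (simp add: powr_add[symmetric] algebra_simps)
        then show ?thesis unfolding x_def by (simp add: mult_ac)
      qed
      finally show "card (cell (?a (Suc j)) (?a j) ` S k j) * (r j / R) powr \<alpha> \<le> x" .
    qed
    define U where "U k j = cell_cube (?a (Suc j)) (?a j) ` cell (?a (Suc j)) (?a j) ` S k j" for k j
    let ?I = "{1..L} \<times> {..<J}"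
    let ?\<U> = "\<Union>kj\<in>?I. U (fst kj) (snd kj)"
    have finU: "finite (U k j)" if "k \<in> {1..L}" for k j unfolding U_def using S(1)[OF that] by blast
    have cov: "orbit (u, v) \<inter> shell i \<subseteq> \<Union>?\<U>"
    proof
      fix p assume p: "p \<in> orbit (u, v) \<inter> shell i"
      obtain i' where i': "i = Suc (Suc i')" using i2 by (metis add_2_eq_Suc le_Suc_ex)
      have "nrm (fst p) < 2 ^ Suc i'" "nrm (snd p) < 2 ^ Suc i'"
        using p unfolding i' by (auto simp: mem_shell_iff simp del: power_Suc)
      moreover have "(2::int) ^ Suc i' \<le> 2 ^ i" unfolding i' by simp
      moreover have "2 ^ i < int m ^ K" "2 ^ i < int n ^ L"
      proof -
        have "real_of_int (2 ^ i) < real_of_int (int m ^ K)" "real_of_int (2 ^ i) < real_of_int (int n ^ L)"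
          using lo_bounds(2)[OF two_le_m R1] lo_bounds(2)[OF two_le_n R1] by (simp_all add: K_def L_def R_def)
        then show "2 ^ i < int m ^ K" "2 ^ i < int n ^ L" unfolding of_int_less_iff .
      qed
      ultimately have "nrm (fst p) < int m ^ K" "nrm (snd p) < int n ^ L" by linarith+
      then have "fst p div int m ^ K \<in> {-1, 0}" "snd p div int n ^ L \<in> {-1, 0}"
        using nrm_div_eq_0_iff[of "int m ^ K" "fst p"] nrm_div_eq_0_iff[of "int n ^ L" "snd p"] m_pos n_pos
        by simp_all
      then have "cell K L p \<in> {-1, 0} \<times> {-1, 0}" by (simp only: cell_def mem_Times_iff fst_conv snd_conv)
      then have "p \<in> {p \<in> orbit (u, v). cell K L p \<in> {-1, 0} \<times> {-1, 0}}"
        using p by (intro CollectI conjI) simp_all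
      from subsetD[OF origin_cover[OF KL(3)] this] obtain k where
        k: "k \<in> {1..L}" "p \<in> origin_piece (u, v) K L k" by (rule UN_E)
      have d: "digits p l \<in> \<Lambda>" if "l < k" for l using k(2) that by (auto simp: origin_piece_def level_iff)
      have "\<bar>colsum u K k p (?a J)\<bar> \<le> K * Q"
      proof -
        have "\<bar>colsum u K k p (?a J)\<bar> \<le> (\<Sum>l\<in>{?a J..<min K k}. \<bar>ln (rcol u (dig m l (fst p)))\<bar>)"
          unfolding colsum_def by (rule sum_abs)
        also have "\<dots> \<le> (\<Sum>l\<in>{?a J..<min K k}. Q)"
        proof (rule sum_mono)
          fix l assume "l \<in> {?a J..<min K k}"
          then have "digits p l \<in> \<Lambda>" using d by simp
          then have "dig m l (fst p) \<in> cols" unfolding cols_eq digits_def by force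
          then show "\<bar>ln (rcol u (dig m l (fst p)))\<bar> \<le> Q"
            unfolding Q_def by (rule member_le_sum[OF _ _ finite_cols]) simp
        qed
        also have "\<dots> = real (min K k - ?a J) * Q" by simp
        also have "\<dots> \<le> K * Q" using Q0 by (intro mult_right_mono) simp_all
        finally show ?thesis .
      qed
      moreover have "colsum u K k p (?a 0) = 0" by (simp add: colsum_def)
      moreover have "K * Q < J * (\<epsilon> * K)" using QJ KL(2) by (simp add: mult_ac)
      moreover have "0 < \<epsilon> * K" using \<epsilon> KL(2) by simp
      ultimately obtain j where j: "j < J" "- (\<epsilon> * K) \<le> t * colsum u K k p (?a (Suc j)) - colsum u K k p (?a j)"
        using chain_step[of "\<lambda>j. colsum u K k p (?a j)" J "K * Q" t "\<epsilon> * K"] t by blast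
      have "p \<in> S k j"
        unfolding S_def using k(2) j(2) prod_colw[OF sb(2)[of j] sb(3)[of j] d, of k u t]
        by (simp del: steps.simps)
      moreover have "p \<in> cell_cube (?a (Suc j)) (?a j) (cell (?a (Suc j)) (?a j) p)"
        by (rule mem_cell_cube[OF sb(4)])
      ultimately have "p \<in> \<Union>(U k j)" unfolding U_def by blast
      moreover have "(k, j) \<in> ?I" using k(1) j(1) by simp
      ultimately show "p \<in> \<Union>?\<U>" by force
    qed
    have "nu \<alpha> (orbit (u, v)) (shell i) \<le> (\<Sum>U\<in>?\<U>. (real (cube_diam U) / real (cube_diam (shell i))) powr \<alpha>)"
    proof (rule nu_le[OF _ _ cov])
      show "finite ?\<U>" by (rule finite_UN_I) (use finU in auto)
      show "?\<U> \<subseteq> cubes" unfolding U_def using cell_cube_diam(1) by blast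
    qed
    also have "\<dots> \<le> (\<Sum>kj\<in>?I. \<Sum>U\<in>U (fst kj) (snd kj). (real (cube_diam U) / real (cube_diam (shell i))) powr \<alpha>)"
      by (rule sum_UN_le) (use finU in auto)
    also have "\<dots> \<le> (\<Sum>kj\<in>?I. x)"
    proof (rule sum_mono)
      fix kj assume kj: "kj \<in> ?I"
      obtain k j where kj': "kj = (k, j)" by fastforce
      have k: "k \<in> {1..L}" using kj kj' by simp
      obtain i' where i': "i = Suc (Suc i')" using i2 by (metis add_2_eq_Suc le_Suc_ex)
      have dF: "real (cube_diam (shell i)) = R" unfolding i' cube_diam_shell R_def by simp
      have "(\<Sum>U\<in>U k j. (real (cube_diam U) / real (cube_diam (shell i))) powr \<alpha>) = (\<Sum>U\<in>U k j. (r j / R) powr \<alpha>)"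
        unfolding dF by (rule sum.cong[OF refl]) (auto simp: U_def cell_cube_diam(2) r_def simp del: steps.simps)
      also have "\<dots> = card (U k j) * (r j / R) powr \<alpha>" by simp
      also have "\<dots> \<le> card (cell (?a (Suc j)) (?a j) ` S k j) * (r j / R) powr \<alpha>"
        unfolding U_def by (intro mult_right_mono of_nat_mono card_image_le S(1)[OF k]) simp
      also have "\<dots> \<le> x" by (rule S(2)[OF k])
      finally show "(\<Sum>U\<in>U (fst kj) (snd kj). (real (cube_diam U) / real (cube_diam (shell i))) powr \<alpha>) \<le> x"
        unfolding kj' by simp
    qed
    also have "\<dots> = real L * J * x" by simp
    also have "\<dots> \<le> (real i + 1) * J * x"
    proof (intro mult_right_mono)
      have "log n (2 ^ i) \<le> log 2 (2 ^ i)" using two_le_n by (intro log_base_mono) simp_all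
      also have "\<dots> = i" by simp
      finally show "real L \<le> real i + 1"
        using lo_bounds(4)[OF two_le_n R1] unfolding L_def R_def by linarith
      show "0 \<le> x" unfolding x_def using C0 by simp
    qed simp_all
    also have "\<dots> = C * (real i + 1) * 2 powr (- (real i * (\<sigma> / 2)))" by (simp add: C_def x_def)
    finally show ?thesis .
  qed
  show ?thesis by (rule that[of "\<sigma> / 2" i0 C]) (use \<sigma> main in simp_all)
qed

end

section \<open>Discrete Hausdorff dimension: lower bound\<close>

text \<open>At \<tau> = 0 the sum is 1 and its derivative is -\<epsilon>, so it drops below 1 for
  small positive \<tau>.\<close>

lemma exponential_tilt:
  fixes p g :: "'a \<Rightarrow> real"
  assumes "(\<Sum>c\<in>A. p c) = 1" "(\<Sum>c\<in>A. p c * g c) = 0" "0 < \<epsilon>"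
  obtains \<tau> where "0 < \<tau>" "(\<Sum>c\<in>A. p c * exp (\<tau> * (g c - \<epsilon>))) < 1"
proof -
  let ?f = "\<lambda>\<tau>. \<Sum>c\<in>A. p c * exp (\<tau> * (g c - \<epsilon>))"
  have "(\<Sum>c\<in>A. p c * (g c - \<epsilon>)) = - \<epsilon>"
    using assms(1,2) by (simp add: right_diff_distrib sum_subtractf sum_distrib_right[symmetric])
  moreover have "(?f has_real_derivative (\<Sum>c\<in>A. p c * (g c - \<epsilon>))) (at 0)"
    by (auto intro!: derivative_eq_intros sum.cong)
  ultimately have "(?f has_real_derivative - \<epsilon>) (at 0)" by simp
  from DERIV_neg_dec_right[OF this] assms(3) obtain d where
    d: "0 < d" "\<And>h. 0 < h \<Longrightarrow> h < d \<Longrightarrow> ?f (0 + h) < ?f 0" by auto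
  show ?thesis by (rule that[of "d / 2"]) (use d(1) d(2)[of "d / 2"] assms(1) in simp_all)
qed

lemma prod_exp_interval:
  fixes y :: "nat \<Rightarrow> real"
  assumes "K \<le> L"
  shows "(\<Prod>l<L. if a \<le> l \<and> l < K then exp (y l) else 1) = exp (\<Sum>l\<in>{a..<K}. y l)"
proof -
  have "(\<Prod>l<L. if a \<le> l \<and> l < K then exp (y l) else 1) = (\<Prod>l\<in>{a..<K}. exp (y l))"
    using assms by (intro prod.mono_neutral_cong_right) auto
  then show ?thesis by (simp add: exp_sum)
qed

text \<open>A Chernoff bound for each starting position a, then a union bound over a <= K. The
  bounds decay like \<rho>^(K-a), so one constant \<open>C0\<close>, independent of K and L,
  controls all positions together.\<close>

lemma large_deviation:
  fixes p g :: "'a \<Rightarrow> real"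
  assumes p: "\<And>c. 0 \<le> p c" "(\<Sum>c\<in>A. p c) = 1" "(\<Sum>c\<in>A. p c * g c) = 0" and \<epsilon>: "0 < \<epsilon>"
  shows "\<exists>C0\<ge>0. \<forall>K L B v. K \<le> L \<longrightarrow> (\<forall>l<L. finite (B l)) \<longrightarrow> (\<forall>l c. 0 \<le> v l c) \<longrightarrow>
      (\<forall>l<L. (\<Sum>c\<in>B l. v l c) = 1) \<longrightarrow> (\<forall>l<K. B l = A \<and> v l = p) \<longrightarrow>
    (\<Sum>d\<in>{d \<in> PiE {..<L} B. \<exists>a\<le>K. \<epsilon> * real (K - a) + C0 < (\<Sum>l\<in>{a..<K}. g (d l))}. \<Prod>l<L. v l (d l)) \<le> 1 / 4"
proof -
  obtain \<tau> where \<tau>: "0 < \<tau>" "(\<Sum>c\<in>A. p c * exp (\<tau> * (g c - \<epsilon>))) < 1"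
    by (rule exponential_tilt[OF p(2,3) \<epsilon>])
  define \<rho> where "\<rho> = (\<Sum>c\<in>A. p c * exp (\<tau> * (g c - \<epsilon>)))"
  have \<rho>: "0 \<le> \<rho>" "\<rho> < 1" unfolding \<rho>_def using \<tau>(2) p(1) by (auto intro: sum_nonneg)
  \<comment> \<open>Gives exp (-\<tau> C0) = (1 - \<rho>) / 4, which makes the geometric series sum
    to at most 1 / 4.\<close>
  define C0 where "C0 = ln (4 / (1 - \<rho>)) / \<tau>"
  have C0: "exp (- (\<tau> * C0)) = (1 - \<rho>) / 4" using \<tau>(1) \<rho> by (simp add: C0_def exp_minus)
  have "1 \<le> 4 / (1 - \<rho>)" using \<rho> by (simp add: field_simps)
  then have C00: "0 \<le> C0" unfolding C0_def using \<tau>(1) by simp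
  have main: "(\<Sum>d\<in>{d \<in> PiE {..<L} B. \<exists>a\<le>K. \<epsilon> * real (K - a) + C0 < (\<Sum>l\<in>{a..<K}. g (d l))}. \<Prod>l<L. v l (d l)) \<le> 1 / 4"
    if KL: "K \<le> L" and finB: "\<And>l. l < L \<Longrightarrow> finite (B l)" and v0: "\<And>l c. 0 \<le> v l c"
      and v1: "\<And>l. l < L \<Longrightarrow> (\<Sum>c\<in>B l. v l c) = 1" and vp: "\<And>l. l < K \<Longrightarrow> B l = A \<and> v l = p"
    for K L B v
  proof -
    let ?W = "\<lambda>d. \<Prod>l<L. v l (d l)"
    let ?P = "PiE {..<L} B"
    define bad where "bad a = {d \<in> ?P. \<epsilon> * real (K - a) + C0 < (\<Sum>l\<in>{a..<K}. g (d l))}" for a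
    have finP: "finite ?P" by (intro finite_PiE) (auto intro: finB)
    have W0: "0 \<le> ?W d" for d by (intro prod_nonneg) (simp add: v0)
    have each: "sum ?W (bad a) \<le> (1 - \<rho>) / 4 * \<rho> ^ (K - a)" if a: "a \<le> K" for a
    proof -
      have "sum ?W (bad a) \<le> (\<Sum>d\<in>bad a. exp (- (\<tau> * C0)) *
          (\<Prod>l<L. v l (d l) * (if a \<le> l \<and> l < K then exp (\<tau> * (g (d l) - \<epsilon>)) else 1)))"
      proof (rule sum_mono)
        fix d assume "d \<in> bad a"
        then have "\<epsilon> * real (K - a) + C0 < (\<Sum>l\<in>{a..<K}. g (d l))" by (simp add: bad_def)
        then have "C0 < (\<Sum>l\<in>{a..<K}. g (d l)) - \<epsilon> * real (K - a)" by simp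
        then have "\<tau> * C0 < \<tau> * ((\<Sum>l\<in>{a..<K}. g (d l)) - \<epsilon> * real (K - a))"
          using \<tau>(1) by (rule mult_strict_left_mono)
        also have "(\<Sum>l\<in>{a..<K}. g (d l)) - \<epsilon> * real (K - a) = (\<Sum>l\<in>{a..<K}. g (d l) - \<epsilon>)"
          by (simp add: sum_subtractf)
        also have "\<tau> * (\<Sum>l\<in>{a..<K}. g (d l) - \<epsilon>) = (\<Sum>l\<in>{a..<K}. \<tau> * (g (d l) - \<epsilon>))"
          by (rule sum_distrib_left)
        finally have "0 \<le> - (\<tau> * C0) + (\<Sum>l\<in>{a..<K}. \<tau> * (g (d l) - \<epsilon>))" by linarith
        then have "1 \<le> exp (- (\<tau> * C0) + (\<Sum>l\<in>{a..<K}. \<tau> * (g (d l) - \<epsilon>)))" by (simp only: one_le_exp_iff)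
        then have "?W d * 1 \<le> ?W d * exp (- (\<tau> * C0) + (\<Sum>l\<in>{a..<K}. \<tau> * (g (d l) - \<epsilon>)))"
          using W0 by (rule mult_left_mono)
        also have "\<dots> = exp (- (\<tau> * C0)) * (?W d * exp (\<Sum>l\<in>{a..<K}. \<tau> * (g (d l) - \<epsilon>)))"
          unfolding exp_add by (simp only: mult_ac)
        also have "?W d * exp (\<Sum>l\<in>{a..<K}. \<tau> * (g (d l) - \<epsilon>)) =
            (\<Prod>l<L. v l (d l) * (if a \<le> l \<and> l < K then exp (\<tau> * (g (d l) - \<epsilon>)) else 1))"
          unfolding prod.distrib prod_exp_interval[OF KL] ..
        finally show "?W d \<le> exp (- (\<tau> * C0)) *
          (\<Prod>l<L. v l (d l) * (if a \<le> l \<and> l < K then exp (\<tau> * (g (d l) - \<epsilon>)) else 1))" by simp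
      qed
      also have "\<dots> \<le> (\<Sum>d\<in>?P. exp (- (\<tau> * C0)) *
          (\<Prod>l<L. v l (d l) * (if a \<le> l \<and> l < K then exp (\<tau> * (g (d l) - \<epsilon>)) else 1)))"
      proof (rule sum_mono2[OF finP])
        show "bad a \<subseteq> ?P" unfolding bad_def by blast
        show "0 \<le> exp (- (\<tau> * C0)) *
          (\<Prod>l<L. v l (d l) * (if a \<le> l \<and> l < K then exp (\<tau> * (g (d l) - \<epsilon>)) else 1))" for d
          by (intro mult_nonneg_nonneg prod_nonneg) (simp_all add: v0)
      qed
      also have "\<dots> = exp (- (\<tau> * C0)) * (\<Prod>l<L. \<Sum>c\<in>B l. v l c * (if a \<le> l \<and> l < K then exp (\<tau> * (g c - \<epsilon>)) else 1))"
        unfolding sum_distrib_left[symmetric]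
        by (subst prod_sum_PiE) (auto intro: finB)
      also have "(\<Prod>l<L. \<Sum>c\<in>B l. v l c * (if a \<le> l \<and> l < K then exp (\<tau> * (g c - \<epsilon>)) else 1)) =
          (\<Prod>l<L. if l \<in> {a..<K} then \<rho> else 1)"
        by (rule prod.cong[OF refl]) (use vp v1 in \<open>auto simp: \<rho>_def\<close>)
      also have "\<dots> = \<rho> ^ (K - a)" using prod_if_mem[of "{..<L}" "{a..<K}" \<rho>] KL by (simp add: subset_iff)
      finally show ?thesis unfolding C0 .
    qed
    have "{d \<in> ?P. \<exists>a\<le>K. \<epsilon> * real (K - a) + C0 < (\<Sum>l\<in>{a..<K}. g (d l))} = (\<Union>a\<in>{..K}. bad a)"
      by (auto simp: bad_def)
    then have "sum ?W {d \<in> ?P. \<exists>a\<le>K. \<epsilon> * real (K - a) + C0 < (\<Sum>l\<in>{a..<K}. g (d l))} = sum ?W (\<Union>a\<in>{..K}. bad a)"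
      by (rule arg_cong)
    also have "\<dots> \<le> (\<Sum>a\<in>{..K}. sum ?W (bad a))"
      by (rule sum_UN_le) (use W0 finP in \<open>auto simp: bad_def\<close>)
    also have "\<dots> \<le> (\<Sum>a\<in>{..K}. (1 - \<rho>) / 4 * \<rho> ^ (K - a))" by (intro sum_mono each) simp
    also have "\<dots> = (1 - \<rho>) / 4 * (\<Sum>q\<in>{..K}. \<rho> ^ q)"
      unfolding sum_distrib_left[symmetric]
      by (rule arg_cong[where f = "(*) ((1 - \<rho>) / 4)"], rule sum.reindex_bij_witness[of _ "\<lambda>q. K - q" "\<lambda>q. K - q"]) auto
    also have "\<dots> = (1 - \<rho> ^ Suc K) / 4"
    proof -
      have gp: "(\<Sum>q\<in>{..K}. \<rho> ^ q) = (1 - \<rho> ^ Suc K) / (1 - \<rho>)" using \<rho> by (simp only: sum_gp0) simp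
      have "w / 4 * (y / w) = y / 4" if "w \<noteq> 0" for w y :: real using that by simp
      from this[of "1 - \<rho>"] show ?thesis unfolding gp using \<rho>(2) by (simp only:)
    qed
    also have "\<dots> \<le> 1 / 4" using \<rho>(1) by simp
    finally show ?thesis .
  qed
  show ?thesis
    by (intro exI[of _ C0] conjI allI impI C00, rule main) blast+
qed

context carpet
begin

section \<open>The product measure on words and the mass of cells\<close>

definition dprob :: "int \<Rightarrow> real \<Rightarrow> nat \<times> nat \<Rightarrow> real" where
  "dprob u t c = rcol u (fst c) powr t / (Zs u t * col_count \<Lambda> (fst c))"

text \<open>The logarithmic derivative Z'(t) / Z(t), and at the same time the mean of
  \<open>ln (rcol u i)\<close> under the column measure.\<close>

definition drift :: "int \<Rightarrow> real \<Rightarrow> real" where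
  "drift u t = (\<Sum>i\<in>cols. rcol u i powr t / Zs u t * ln (rcol u i))"

lemma sum_dprob:
  "(\<Sum>c\<in>\<Lambda>. dprob u t c * f (fst c)) = (\<Sum>i\<in>cols. rcol u i powr t / Zs u t * f i)"
proof -
  have "(\<Sum>c\<in>\<Lambda>. dprob u t c * f (fst c)) =
      (\<Sum>c\<in>\<Lambda>. (\<lambda>i. rcol u i powr t / (Zs u t * col_count \<Lambda> i) * f i) (fst c))"
    by (simp add: dprob_def)
  also have "\<dots> = (\<Sum>i\<in>cols. real (col_count \<Lambda> i) * (rcol u i powr t / (Zs u t * col_count \<Lambda> i) * f i))"
    by (rule sum_digits_by_column)
  also have "\<dots> = (\<Sum>i\<in>cols. rcol u i powr t / Zs u t * f i)"
    by (rule sum.cong[OF refl]) (simp add: nonempty_cols_def)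
  finally show ?thesis .
qed

lemma dprob_nonneg: "0 \<le> t \<Longrightarrow> 0 \<le> dprob u t c"
  using Zs_ge_1[of t u] by (simp add: dprob_def)

lemma sum_dprob_1: "0 \<le> t \<Longrightarrow> (\<Sum>c\<in>\<Lambda>. dprob u t c) = 1"
  using sum_dprob[of u t "\<lambda>_. 1"] Zs_ge_1[of t u]
  by (simp add: Zs_def[symmetric] sum_divide_distrib[symmetric])

definition word_weight :: "int \<Rightarrow> real \<Rightarrow> nat \<Rightarrow> nat \<Rightarrow> nat \<times> nat \<Rightarrow> real" where
  "word_weight u t K l c = (if l < K then dprob u t c else 1 / eta m \<Lambda> u)"

definition letters :: "nat \<Rightarrow> nat \<Rightarrow> nat \<Rightarrow> (nat \<times> nat) set" where
  "letters K e l = (if l < K then \<Lambda> else column e)"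

lemma words_letters: "words K L e = PiE {..<L} (letters K e)"
  unfolding words_def letters_def ..

lemma finite_letters: "finite (letters K e l)"
  by (simp add: letters_def finite_digits)

lemma word_weight_nonneg: "0 \<le> t \<Longrightarrow> 0 \<le> word_weight u t K l c"
  by (simp add: word_weight_def dprob_nonneg)

lemma sum_word_weight:
  assumes "0 \<le> t" "main_col u e" "eta m \<Lambda> u = 1 \<Longrightarrow> L = K" "l < L"
  shows "(\<Sum>c\<in>letters K e l. word_weight u t K l c) = 1"
proof (cases "l < K")
  case True
  then show ?thesis using sum_dprob_1[OF assms(1)] by (simp add: letters_def word_weight_def)
next
  case False
  then have "eta m \<Lambda> u \<noteq> 1" using assms(3,4) by auto
  then have "col_count \<Lambda> e = eta m \<Lambda> u" using assms(2) by (simp add: main_col_def)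
  then show ?thesis using False num_cols_real(4)[of u]
    by (simp add: letters_def word_weight_def card_column)
qed

lemma word_deviation:
  assumes t: "0 \<le> t" and mean: "(\<Sum>c\<in>\<Lambda>. dprob u t c * g c) = 0" and "0 < \<epsilon>"
  shows "\<exists>C0\<ge>0. \<forall>K L e. K \<le> L \<longrightarrow> main_col u e \<longrightarrow> (eta m \<Lambda> u = 1 \<longrightarrow> L = K) \<longrightarrow>
    (\<Sum>d\<in>{d \<in> words K L e. \<exists>a\<le>K. \<epsilon> * real (K - a) + C0 < (\<Sum>l\<in>{a..<K}. g (d l))}. \<Prod>l<L. word_weight u t K l (d l)) \<le> 1 / 4"
proof -
  obtain C0 where C0: "0 \<le> C0" and ld: "\<forall>K L B v. K \<le> L \<longrightarrow> (\<forall>l<L. finite (B l)) \<longrightarrow> (\<forall>l c. 0 \<le> v l c) \<longrightarrow>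
      (\<forall>l<L. (\<Sum>c\<in>B l. v l c) = 1) \<longrightarrow> (\<forall>l<K. B l = \<Lambda> \<and> v l = dprob u t) \<longrightarrow>
    (\<Sum>d\<in>{d \<in> PiE {..<L} B. \<exists>a\<le>K. \<epsilon> * real (K - a) + C0 < (\<Sum>l\<in>{a..<K}. g (d l))}. \<Prod>l<L. v l (d l)) \<le> 1 / 4"
    using large_deviation[OF dprob_nonneg[OF t] sum_dprob_1[OF t] mean assms(3)] by (elim exE conjE) (rule that)
  have "(\<Sum>d\<in>{d \<in> words K L e. \<exists>a\<le>K. \<epsilon> * real (K - a) + C0 < (\<Sum>l\<in>{a..<K}. g (d l))}. \<Prod>l<L. word_weight u t K l (d l)) \<le> 1 / 4"
    if "K \<le> L" "main_col u e" "eta m \<Lambda> u = 1 \<longrightarrow> L = K" for K L e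
    unfolding words_letters
  proof (rule ld[rule_format, OF that(1) finite_letters word_weight_nonneg[OF t]])
    show "(\<Sum>c\<in>letters K e l. word_weight u t K l c) = 1" if "l < L" for l
      by (rule sum_word_weight[OF t \<open>main_col u e\<close> _ that]) (use \<open>eta m \<Lambda> u = 1 \<longrightarrow> L = K\<close> in blast)
    show "letters K e l = \<Lambda> \<and> word_weight u t K l = dprob u t" if "l < K" for l
      using that by (auto simp: letters_def word_weight_def)
  qed
  then show ?thesis using C0 by blast
qed

text \<open>The mass factorises over the positions, with a column mass where the first digit is seen
  and a digit mass where both are. Up to the fluctuation of the Birkhoff sums, the same expression
  as in \<open>prod_colw\<close>, it is the reciprocal of the count.\<close>

lemma cell_mass:
  assumes t: "0 \<le> t" and ab: "a \<le> b" "K \<le> L" and e: "main_col u e" "eta m \<Lambda> u = 1 \<Longrightarrow> L = K"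
    and d1: "d1 \<in> words K L e"
  shows "(\<Sum>d\<in>{d \<in> words K L e. cell a b (pt L z d) = cell a b (pt L z d1)}. \<Prod>l<L. word_weight u t K l (d l))
    \<le> exp (t * (\<Sum>l\<in>{a..<K}. ln (rcol u (fst (d1 l)))) - (\<Sum>l\<in>{b..<K}. ln (rcol u (fst (d1 l)))))
      / cprod (Zs u t) (eta m \<Lambda> u * Zs u t) (eta m \<Lambda> u) a b K L"
proof -
  let ?w = "word_weight u t K" and ?\<eta> = "real (eta m \<Lambda> u)"
  define D where "D l = {c \<in> letters K e l. (a \<le> l \<longrightarrow> fst c = fst (d1 l)) \<and> (b \<le> l \<longrightarrow> snd c = snd (d1 l))}" for l
  let ?S = "{d \<in> words K L e. cell a b (pt L z d) = cell a b (pt L z d1)}"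
  define x where "x l = ln (rcol u (fst (d1 l)))" for l
  define ex where "ex l = exp ((if a \<le> l \<and> l < K then t * x l else 0) - (if b \<le> l \<and> l < K then x l else 0))" for l
  have Z1: "1 \<le> Zs u t" by (rule Zs_ge_1[OF t])
  have \<eta>1: "1 \<le> ?\<eta>" by (rule num_cols_real(4))
  have finD: "finite (D l)" for l unfolding D_def using finite_letters by simp
  have w0: "0 \<le> ?w l c" for l c by (rule word_weight_nonneg[OF t])
  have "?S \<subseteq> PiE {..<L} D"
  proof
    fix d assume "d \<in> ?S"
    then have d: "d \<in> words K L e" "cell a b (pt L z d) = cell a b (pt L z d1)" by simp_all
    have "d l \<in> D l" if l: "l < L" for l
    proof -
      have fs: "dig m l (fst (pt L z d')) = fst (d' l)" "dig n l (snd (pt L z d')) = snd (d' l)"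
        if "d' \<in> words K L e" for d'
        using arg_cong[OF digits_pt[OF that l, of z], of fst] arg_cong[OF digits_pt[OF that l, of z], of snd]
        unfolding digits_def by simp_all
      have ce: "fst (pt L z d) div int m ^ a = fst (pt L z d1) div int m ^ a"
        "snd (pt L z d) div int n ^ b = snd (pt L z d1) div int n ^ b"
        using d(2) unfolding cell_def by simp_all
      have "a \<le> l \<longrightarrow> fst (d l) = fst (d1 l)"
        using dig_eq_if_div_eq[OF ce(1), of l] unfolding fs[OF d(1)] fs[OF d1] by blast
      moreover have "b \<le> l \<longrightarrow> snd (d l) = snd (d1 l)"
        using dig_eq_if_div_eq[OF ce(2), of l] unfolding fs[OF d(1)] fs[OF d1] by blast
      moreover have "d l \<in> letters K e l" using words_mem[OF d(1) l] by (simp add: letters_def)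
      ultimately show ?thesis by (simp add: D_def)
    qed
    then show "d \<in> PiE {..<L} D" using d(1) unfolding words_def PiE_iff by auto
  qed
  moreover have "finite (PiE {..<L} D)" by (intro finite_PiE) (auto intro: finD)
  ultimately have "(\<Sum>d\<in>?S. \<Prod>l<L. ?w l (d l)) \<le> (\<Sum>d\<in>PiE {..<L} D. \<Prod>l<L. ?w l (d l))"
    by (intro sum_mono2) (auto intro!: prod_nonneg w0)
  also have "\<dots> = (\<Prod>l<L. \<Sum>c\<in>D l. ?w l c)"
    by (subst prod_sum_PiE) (auto intro: finD)
  also have "\<dots> \<le> (\<Prod>l<L. ex l / cfactor (Zs u t) (?\<eta> * Zs u t) ?\<eta> a b K l)"
  proof (intro prod_mono conjI)
    fix l assume "l \<in> {..<L}"
    then have l: "l < L" by simp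
    show "0 \<le> (\<Sum>c\<in>D l. ?w l c)" by (intro sum_nonneg w0)
    have le1: "(\<Sum>c\<in>D l. ?w l c) \<le> 1"
    proof -
      have "(\<Sum>c\<in>D l. ?w l c) \<le> (\<Sum>c\<in>letters K e l. ?w l c)"
        by (intro sum_mono2 finite_letters w0) (auto simp: D_def)
      also have "\<dots> = 1" by (rule sum_word_weight[OF t e l])
      finally show ?thesis .
    qed
    have d1l: "d1 l \<in> \<Lambda>" by (rule words_digit(1)[OF d1 l])
    then have ic: "fst (d1 l) \<in> cols" unfolding cols_eq by (rule imageI)
    have rp: "0 < rcol u (fst (d1 l))" by (rule rcol_pos[OF ic])
    have N: "real (col_count \<Lambda> (fst (d1 l))) = ?\<eta> * rcol u (fst (d1 l))" using \<eta>1 by (simp add: rcol_def)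
    have single: "(\<Sum>c\<in>D l. ?w l c) \<le> ?w l (d1 l)" if "b \<le> l"
    proof -
      have "D l \<subseteq> {d1 l}" using that ab(1) by (auto simp: D_def prod_eq_iff)
      then have "(\<Sum>c\<in>D l. ?w l c) \<le> (\<Sum>c\<in>{d1 l}. ?w l c)" by (intro sum_mono2 w0) simp_all
      then show ?thesis by simp
    qed
    \<comment> \<open>Free positions with nothing, the first digit or both digits seen; then frozen
      positions without and with the second digit seen.\<close>
    consider "l < K" "l < a" | "l < K" "a \<le> l" "l < b" | "l < K" "b \<le> l" | "K \<le> l" "l < b" | "K \<le> l" "b \<le> l"
      by linarith
    then show "(\<Sum>c\<in>D l. ?w l c) \<le> ex l / cfactor (Zs u t) (?\<eta> * Zs u t) ?\<eta> a b K l"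
    proof cases
      case 1
      then show ?thesis using le1 ab(1) by (simp add: ex_def cfactor_def)
    next
      case 2
      have "D l = column (fst (d1 l))" using 2 by (auto simp: D_def letters_def)
      then have "(\<Sum>c\<in>D l. ?w l c) = (\<Sum>c\<in>column (fst (d1 l)). rcol u (fst (d1 l)) powr t / (Zs u t * col_count \<Lambda> (fst (d1 l))))"
        using 2 by (intro sum.cong) (auto simp: word_weight_def dprob_def)
      also have "\<dots> = rcol u (fst (d1 l)) powr t / Zs u t"
        using rp \<eta>1 by (simp add: card_column N)
      also have "\<dots> = ex l / Zs u t" using 2 rp by (simp add: ex_def x_def powr_def)
      finally show ?thesis using 2 by (simp add: cfactor_def)
    next
      case 3
      have "(\<Sum>c\<in>D l. ?w l c) \<le> ?w l (d1 l)" by (rule single[OF 3(2)])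
      also have "\<dots> = rcol u (fst (d1 l)) powr t / (Zs u t * (?\<eta> * rcol u (fst (d1 l))))"
        using 3 by (simp add: word_weight_def dprob_def N)
      also have "\<dots> = ex l / (?\<eta> * Zs u t)"
      proof -
        have "exp (t * x l - x l) = rcol u (fst (d1 l)) powr t / rcol u (fst (d1 l))"
          using rp by (simp add: exp_diff x_def powr_def)
        then show ?thesis using 3 ab(1) by (simp add: ex_def mult_ac)
      qed
      finally show ?thesis using 3 ab(1) by (simp add: cfactor_def)
    next
      case 4
      then show ?thesis using le1 by (simp add: ex_def cfactor_def)
    next
      case 5
      then show ?thesis using single[OF 5(2)] by (simp add: ex_def cfactor_def word_weight_def)
    qed
  qed
  also have "\<dots> = exp (t * (\<Sum>l\<in>{a..<K}. x l) - (\<Sum>l\<in>{b..<K}. x l)) / cprod (Zs u t) (?\<eta> * Zs u t) ?\<eta> a b K L"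
    unfolding prod_dividef prod_cfactor[OF ab] ex_def prod_exp_if min_absorb1[OF ab(2)] ..
  finally show ?thesis unfolding x_def .
qed

lemma cube_cells:
  assumes "int r \<le> int m ^ a" "int r \<le> int n ^ b" "p \<in> cube x r"
  shows "cell a b p \<in> {fst x div int m ^ a..fst x div int m ^ a + 1} \<times> {snd x div int n ^ b..snd x div int n ^ b + 1}"
proof -
  have p: "0 < int m ^ a" "0 < int n ^ b" using m_pos n_pos by simp_all
  have "fst x \<le> fst p" "fst p \<le> fst x + int m ^ a" "snd x \<le> snd p" "snd p \<le> snd x + int n ^ b"
    using assms unfolding cube_def mem_Collect_eq by linarith+
  then show ?thesis
    using zdiv_mono1[OF _ p(1), of "fst x" "fst p"] zdiv_mono1[OF _ p(2), of "snd x" "snd p"]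
      div_near[OF p(1), of "fst p" "fst x"] div_near[OF p(2), of "snd p" "snd x"]
    by (simp add: cell_def)
qed

text \<open>For a minimizer the mean part t X E0 - Y E0 is never positive: at t = 0 the drift is
  nonnegative, at t = 1 it is nonpositive and X >= Y, in between it vanishes. What is left are the
  deviations.\<close>

lemma drift_estimate:
  fixes t E0 X Y sa sb \<epsilon> C0 :: real
  assumes "0 \<le> t" "t \<le> 1" "0 < t \<Longrightarrow> E0 \<le> 0" "t < 1 \<Longrightarrow> 0 \<le> E0" "0 \<le> Y" "Y \<le> X" "0 < \<epsilon>" "0 \<le> C0"
    "\<bar>sa - X * E0\<bar> \<le> \<epsilon> * X + C0" "\<bar>sb - Y * E0\<bar> \<le> \<epsilon> * Y + C0"
  shows "t * sa - sb \<le> 2 * \<epsilon> * X + 2 * C0"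
proof -
  have "t * (X * E0) - Y * E0 \<le> 0"
  proof -
    consider "t = 0" | "t = 1" | "0 < t" "t < 1" using assms(1,2) by linarith
    then show ?thesis
    proof cases
      case 1
      then show ?thesis using assms(4,5) by simp
    next
      case 2
      then have "E0 * (X - Y) \<le> 0" using assms(3,6) by (intro mult_nonpos_nonneg) simp_all
      then show ?thesis using 2 by (simp add: algebra_simps)
    next
      case 3
      then have "E0 = 0" using assms(3,4) by fastforce
      then show ?thesis by simp
    qed
  qed
  moreover have "t * sa \<le> t * (X * E0) + (\<epsilon> * X + C0)"
  proof -
    have "0 \<le> \<epsilon> * X + C0" using assms(5-8) by simp
    then have "t * (\<epsilon> * X + C0) \<le> 1 * (\<epsilon> * X + C0)" using assms(2) by (intro mult_right_mono) simp_all
    moreover have "t * sa \<le> t * (X * E0 + (\<epsilon> * X + C0))" using assms(1,9) by (intro mult_left_mono) (simp_all add: abs_le_iff)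
    ultimately show ?thesis by (simp add: distrib_left)
  qed
  moreover have "\<epsilon> * Y \<le> \<epsilon> * X" using assms(6,7) by simp
  moreover have "- sb \<le> - (Y * E0) + (\<epsilon> * Y + C0)" using assms(10) by (simp add: abs_le_iff)
  ultimately show ?thesis by linarith
qed

text \<open>The mass distribution principle: half of the measure sits on words whose cells have mass
  at most M (r / R)^\<alpha> at all scales, so the cubes of a cover cannot be too cheap.\<close>

lemma nu_orbit_lower:
  assumes card2: "2 \<le> card \<Lambda>" and t: "0 \<le> t" "t \<le> 1"
    and dr: "0 < t \<Longrightarrow> drift u t \<le> 0" "t < 1 \<Longrightarrow> 0 \<le> drift u t" and \<alpha>: "0 < \<alpha>" "\<alpha> < dimH u t"
  shows "\<exists>c>0. \<forall>i0. \<exists>i\<ge>i0. c \<le> nu \<alpha> (orbit (u, v)) (shell i)"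
proof -
  let ?D = "dimH u t" and ?\<eta> = "real (eta m \<Lambda> u)" and ?E0 = "drift u t"
  define \<delta> where "\<delta> = ?D - \<alpha>"
  \<comment> \<open>As K - a is about log_m (R / r), the deviation factor exp (2 \<epsilon> (K - a))
    is about (R / r)^\<delta>, just the gap between \<open>?D\<close> and \<alpha>.\<close>
  define \<epsilon> where "\<epsilon> = \<delta> * ln m / 2"
  have ln_m: "0 < ln (real m)" using two_le_m by simp
  have \<delta>: "0 < \<delta>" and \<epsilon>: "0 < \<epsilon>" using \<alpha> ln_m by (simp_all add: \<delta>_def \<epsilon>_def)
  have Z1: "1 \<le> Zs u t" by (rule Zs_ge_1[OF t(1)])
  have \<eta>1: "1 \<le> ?\<eta>" by (rule num_cols_real(4))
  have \<eta>Z1: "1 \<le> ?\<eta> * Zs u t" using mult_mono[OF \<eta>1 Z1] \<eta>1 by simp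
  define g where "g c = ln (rcol u (fst c)) - ?E0" for c :: "nat \<times> nat"
  have mean: "(\<Sum>c\<in>\<Lambda>. dprob u t c * g c) = 0"
    using sum_dprob[of u t "\<lambda>i. ln (rcol u i)"] sum_dprob_1[OF t(1), of u]
    by (simp add: g_def right_diff_distrib sum_subtractf sum_distrib_right[symmetric] drift_def)
  then have mean': "(\<Sum>c\<in>\<Lambda>. dprob u t c * (- g c)) = 0" by (simp add: sum_negf)
  obtain C1 where C1: "0 \<le> C1" and ld1: "\<And>K L e. \<lbrakk>K \<le> L; main_col u e; eta m \<Lambda> u = 1 \<Longrightarrow> L = K\<rbrakk> \<Longrightarrow>
    (\<Sum>d\<in>{d \<in> words K L e. \<exists>a\<le>K. \<epsilon> * real (K - a) + C1 < (\<Sum>l\<in>{a..<K}. g (d l))}. \<Prod>l<L. word_weight u t K l (d l)) \<le> 1 / 4"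
    using word_deviation[OF t(1) mean \<epsilon>] by blast
  obtain C2 where C2: "0 \<le> C2" and ld2: "\<And>K L e. \<lbrakk>K \<le> L; main_col u e; eta m \<Lambda> u = 1 \<Longrightarrow> L = K\<rbrakk> \<Longrightarrow>
    (\<Sum>d\<in>{d \<in> words K L e. \<exists>a\<le>K. \<epsilon> * real (K - a) + C2 < (\<Sum>l\<in>{a..<K}. - g (d l))}. \<Prod>l<L. word_weight u t K l (d l)) \<le> 1 / 4"
    using word_deviation[OF t(1) mean' \<epsilon>] by blast
  define C0 where "C0 = max C1 C2"
  have C0: "0 \<le> C0" "C1 \<le> C0" "C2 \<le> C0" using C1 by (simp_all add: C0_def)
  obtain c0 where c0: "\<And>i0. \<exists>i\<ge>i0. \<exists>K L z' e. shell_words u v c0 i K L z' e"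
    using shell_words_exist[OF card2, of u v] by blast
  define c where "c = max 1 c0"
  define CC where "CC = exp (2 * c * (ln (Zs u t) + ln (?\<eta> * Zs u t) + ln ?\<eta>))"
  define M where "M = exp (2 * \<epsilon> * c + 2 * C0) * CC"
  have M: "0 < M" by (simp add: M_def CC_def)
  \<comment> \<open>The 1 is for covers with a cube wider than the shell, whose single term is at
    least 1. The 8 combines the 2 * 2 cells met by a cube with the mass 1 / 2 to be covered.\<close>
  have "\<exists>i\<ge>i0. min 1 (1 / (8 * M)) \<le> nu \<alpha> (orbit (u, v)) (shell i)" for i0
  proof -
    obtain i K L z' e where i: "i \<ge> i0" and sw: "shell_words u v c0 i K L z' e" using c0[of i0] by blast
    have i2: "2 \<le> i" and s: "K \<le> L" "main_col u e" "eta m \<Lambda> u = 1 \<Longrightarrow> L = K"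
      "pt L z' ` words K L e \<subseteq> orbit (u, v) \<inter> shell i"
      and near: "\<bar>real K - log m (2 ^ i)\<bar> \<le> c" "?\<eta> = 1 \<or> \<bar>real L - log n (2 ^ i)\<bar> \<le> c"
      using sw by (auto simp: shell_words_def c_def)
    define R where "R = (2::real) ^ i"
    have R1: "1 \<le> R" by (simp add: R_def)
    let ?W = "\<lambda>d. \<Prod>l<L. word_weight u t K l (d l)"
    have W0: "0 \<le> ?W d" for d by (intro prod_nonneg) (simp add: word_weight_nonneg[OF t(1)])
    define bad1 bad2 where "bad1 = {d \<in> words K L e. \<exists>a\<le>K. \<epsilon> * real (K - a) + C1 < (\<Sum>l\<in>{a..<K}. g (d l))}"
      and "bad2 = {d \<in> words K L e. \<exists>a\<le>K. \<epsilon> * real (K - a) + C2 < (\<Sum>l\<in>{a..<K}. - g (d l))}"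
    \<comment> \<open>The exceptional sets for deviations in the two directions have mass at most 1
      / 4 each.\<close>
    define good where "good = words K L e - (bad1 \<union> bad2)"
    have sw1: "(\<Sum>c\<in>letters K e l. word_weight u t K l c) = 1" if "l < L" for l
      by (rule sum_word_weight[OF t(1) s(2,3) that])
    have b1: "sum ?W bad1 \<le> 1 / 4"
      unfolding bad1_def by (rule ld1[OF s(1-3)])
    have b2: "sum ?W bad2 \<le> 1 / 4"
      unfolding bad2_def by (rule ld2[OF s(1-3)])
    have total: "sum ?W (words K L e) = 1"
    proof -
      have "sum ?W (words K L e) = (\<Prod>l<L. \<Sum>c\<in>letters K e l. word_weight u t K l c)"
        unfolding words_letters by (rule prod_sum_PiE[symmetric]) (auto intro: finite_letters)
      also have "\<dots> = 1" by (rule prod.neutral) (use sw1 in simp)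
      finally show ?thesis .
    qed
    have fin_good: "finite good" unfolding good_def using finite_words by blast
    have half: "1 / 2 \<le> sum ?W good"
    proof -
      have fin: "finite bad1" "finite bad2" unfolding bad1_def bad2_def using finite_words by simp_all
      have "sum ?W (words K L e) = sum ?W good + sum ?W (bad1 \<union> bad2)"
        unfolding good_def by (rule sum.subset_diff) (auto simp: finite_words bad1_def bad2_def)
      moreover have "sum ?W (bad1 \<union> bad2) \<le> sum ?W bad1 + sum ?W bad2"
      proof -
        have "sum ?W (bad1 \<union> bad2) = sum ?W bad1 + sum ?W (bad2 - bad1)"
          using sum.union_disjoint[of bad1 "bad2 - bad1" ?W] fin by (simp add: Un_Diff_cancel)
        moreover have "sum ?W (bad2 - bad1) \<le> sum ?W bad2" by (rule sum_mono2[OF fin(2)]) (auto simp: W0)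
        ultimately show ?thesis by linarith
      qed
      ultimately show ?thesis using total b1 b2 by linarith
    qed
    define sm where "sm d a = (\<Sum>l\<in>{a..<K}. ln (rcol u (fst (d l))))" for d :: "nat \<Rightarrow> nat \<times> nat" and a
    have dev: "\<bar>sm d a - real (K - a) * ?E0\<bar> \<le> \<epsilon> * real (K - a) + C0" if d: "d \<in> good" for d a
    proof (cases "a \<le> K")
      case True
      have "(\<Sum>l\<in>{a..<K}. g (d l)) = sm d a - real (K - a) * ?E0" by (simp add: g_def sm_def sum_subtractf)
      moreover have "\<not> \<epsilon> * real (K - a) + C1 < (\<Sum>l\<in>{a..<K}. g (d l))"
        "\<not> \<epsilon> * real (K - a) + C2 < (\<Sum>l\<in>{a..<K}. - g (d l))"
        using d True by (auto simp: good_def bad1_def bad2_def)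
      ultimately show ?thesis using C0 unfolding sum_negf abs_le_iff by linarith
    next
      case False
      then show ?thesis using C0 by (simp add: sm_def)
    qed
    have mass: "(\<Sum>d\<in>{d \<in> good. cell (Suc (lo m r)) (Suc (lo n r)) (pt L z' d) = q}. ?W d) \<le> M * (r / R) powr \<alpha>"
      if r: "1 \<le> r" "r \<le> R" for r q
    proof (cases "\<exists>d1\<in>good. cell (Suc (lo m r)) (Suc (lo n r)) (pt L z' d1) = q")
      case False
      then have none: "{d \<in> good. cell (Suc (lo m r)) (Suc (lo n r)) (pt L z' d) = q} = {}" by blast
      show ?thesis unfolding none using M by simp
    next
      case True
      define a b where "a = Suc (lo m r)" and "b = Suc (lo n r)"
      have ab: "a \<le> b" using lo_base_mono[OF r(1)] by (simp add: a_def b_def)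
      obtain d1 where d1: "d1 \<in> good" "cell a b (pt L z' d1) = q" using True unfolding a_def b_def by blast
      have d1w: "d1 \<in> words K L e" using d1(1) by (simp add: good_def)
      let ?P = "cprod (Zs u t) (?\<eta> * Zs u t) ?\<eta> a b K L"
      have P1: "1 \<le> ?P" by (rule cprod_ge_1[OF Z1 \<eta>Z1 \<eta>1])
      have "(\<Sum>d\<in>{d \<in> good. cell a b (pt L z' d) = q}. ?W d) \<le>
          (\<Sum>d\<in>{d \<in> words K L e. cell a b (pt L z' d) = cell a b (pt L z' d1)}. ?W d)"
        by (rule sum_mono2) (auto simp: finite_words W0 good_def d1(2))
      also have "\<dots> \<le> exp (t * sm d1 a - sm d1 b) / ?P"
        unfolding sm_def by (rule cell_mass[OF t(1) ab s(1-3) d1w])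
      also have "\<dots> \<le> exp (2 * \<epsilon> * real (K - a) + 2 * C0) / ?P"
      proof -
        have "t * sm d1 a - sm d1 b \<le> 2 * \<epsilon> * real (K - a) + 2 * C0"
          by (rule drift_estimate[OF t dr _ _ \<epsilon> C0(1) dev[OF d1(1)] dev[OF d1(1)]]) (use ab in simp_all)
        then show ?thesis using P1 by (intro divide_right_mono) simp_all
      qed
      also have "\<dots> \<le> (exp (2 * \<epsilon> * c + 2 * C0) * (R / r) powr \<delta>) / ?P"
      proof (rule divide_right_mono)
        have "0 \<le> log m (R / r)" using r two_le_m by simp
        moreover have "log m (R / r) = log m R - log m r" using r by (simp add: log_divide)
        moreover have "log m r \<le> real a"
          using lo_bounds(2)[OF two_le_m r(1)] lo_bounds(3)[OF two_le_m r(1)] unfolding a_def by linarith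
        ultimately have "real (K - a) \<le> log m (R / r) + c"
          using near(1) unfolding real_nat_diff R_def[symmetric] c_def by linarith
        then have "2 * \<epsilon> * real (K - a) \<le> 2 * \<epsilon> * (log m (R / r) + c)" using \<epsilon> by (intro mult_left_mono) simp_all
        also have "\<dots> = \<delta> * ln (R / r) + 2 * \<epsilon> * c"
          using ln_m by (simp add: \<epsilon>_def log_def distrib_left)
        finally have "exp (2 * \<epsilon> * real (K - a) + 2 * C0) \<le> exp ((2 * \<epsilon> * c + 2 * C0) + \<delta> * ln (R / r))" by simp
        also have "\<dots> = exp (2 * \<epsilon> * c + 2 * C0) * (R / r) powr \<delta>"
          using r R1 by (simp add: exp_add powr_def)
        finally show "exp (2 * \<epsilon> * real (K - a) + 2 * C0) \<le> exp (2 * \<epsilon> * c + 2 * C0) * (R / r) powr \<delta>" .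
      qed (use P1 in simp)
      also have "\<dots> \<le> (exp (2 * \<epsilon> * c + 2 * C0) * (R / r) powr \<delta>) * (CC / (R / r) powr ?D)"
      proof -
        have na: "\<bar>real a - log m r\<bar> \<le> c" "\<bar>real b - log n r\<bar> \<le> c"
          using lo_bounds(4)[OF two_le_m r(1)] lo_bounds(4)[OF two_le_n r(1)]
          unfolding a_def b_def c_def by linarith+
        have "(R / r) powr min (dimM (?\<eta> * Zs u t) ?\<eta>) (dimA (Zs u t) ?\<eta>) \<le> CC * ?P"
          unfolding CC_def by (rule cprod_est(2)[OF Z1 \<eta>Z1 \<eta>1 r na near[folded R_def]])
        then have "(R / r) powr ?D \<le> CC * ?P" unfolding dimH_dims[OF t(1)] by simp
        moreover have "0 < (R / r) powr ?D" using r by simp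
        ultimately have "1 / ?P \<le> CC / (R / r) powr ?D" using P1 by (simp add: field_simps)
        from mult_left_mono[OF this, of "exp (2 * \<epsilon> * c + 2 * C0) * (R / r) powr \<delta>"] show ?thesis by simp
      qed
      also have "\<dots> = M * ((R / r) powr \<delta> / (R / r) powr ?D)" by (simp add: M_def)
      also have "(R / r) powr \<delta> / (R / r) powr ?D = (R / r) powr (- \<alpha>)"
        by (simp add: powr_diff[symmetric] \<delta>_def)
      also have "(R / r) powr (- \<alpha>) = (r / R) powr \<alpha>"
        using r R1 by (simp add: powr_minus powr_divide)
      finally show ?thesis unfolding a_def b_def .
    qed
    obtain i' where i': "i = Suc (Suc i')" using i2 by (metis add_2_eq_Suc le_Suc_ex)
    have dF: "real (cube_diam (shell i)) = R" unfolding i' cube_diam_shell R_def by simp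
    have "min 1 (1 / (8 * M)) \<le> nu \<alpha> (orbit (u, v)) (shell i)"
      unfolding i'
    proof (rule nu_ge[OF _ shell_subset_cube], unfold i'[symmetric])
      fix \<U> assume U: "finite \<U>" "\<U> \<subseteq> cubes" "orbit (u, v) \<inter> shell i \<subseteq> \<Union>\<U>"
      let ?f = "\<lambda>U. (real (cube_diam U) / real (cube_diam (shell i))) powr \<alpha>"
      show "min 1 (1 / (8 * M)) \<le> sum ?f \<U>"
      proof (cases "\<exists>U\<in>\<U>. R < real (cube_diam U)")
        case True
        then obtain U where UU: "U \<in> \<U>" "R < real (cube_diam U)" by blast
        have "1 \<le> real (cube_diam U) / R" using UU(2) R1 by simp
        then have "1 \<le> ?f U" unfolding dF using \<alpha>(1) by (intro ge_one_powr_ge_zero) simp_all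
        also have "\<dots> \<le> sum ?f \<U>" by (rule member_le_sum[OF UU(1) _ U(1)]) simp
        finally show ?thesis by simp
      next
        case False
        have each: "sum ?W {d \<in> good. pt L z' d \<in> U'} \<le> 4 * M * ?f U'" if U': "U' \<in> \<U>" for U'
        proof -
          obtain x q where xq: "U' = cube x q" "0 < q" using U(2) U' by (auto simp: cubes_def)
          have dq: "cube_diam U' = q" unfolding xq(1) by (rule cube_diam_cube[OF xq(2)])
          have q: "1 \<le> real q" "real q \<le> R" using xq(2) False U' dq by auto
          define a b where "a = Suc (lo m q)" and "b = Suc (lo n q)"
          have "real_of_int (int q) \<le> real_of_int (int m ^ a)" "real_of_int (int q) \<le> real_of_int (int n ^ b)"
            using lo_bounds(2)[OF two_le_m q(1)] lo_bounds(2)[OF two_le_n q(1)] unfolding a_def b_def by simp_all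
          then have qm: "int q \<le> int m ^ a" "int q \<le> int n ^ b" unfolding of_int_le_iff .
          let ?Q = "{fst x div int m ^ a..fst x div int m ^ a + 1} \<times> {snd x div int n ^ b..snd x div int n ^ b + 1}"
          have sub: "{d \<in> good. pt L z' d \<in> U'} \<subseteq> (\<Union>q'\<in>?Q. {d \<in> good. cell a b (pt L z' d) = q'})"
            using cube_cells[OF qm] unfolding xq(1) by blast
          have "sum ?W {d \<in> good. pt L z' d \<in> U'} \<le> sum ?W (\<Union>q'\<in>?Q. {d \<in> good. cell a b (pt L z' d) = q'})"
            by (rule sum_mono2[OF _ sub]) (use fin_good W0 in auto)
          also have "\<dots> \<le> (\<Sum>q'\<in>?Q. sum ?W {d \<in> good. cell a b (pt L z' d) = q'})"
            by (rule sum_UN_le) (use fin_good W0 in auto)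
          also have "\<dots> \<le> (\<Sum>q'\<in>?Q. M * (real q / R) powr \<alpha>)"
            unfolding a_def b_def by (intro sum_mono mass q)
          also have "\<dots> = 4 * M * (real q / R) powr \<alpha>" by (simp add: card_cartesian_product)
          finally show ?thesis unfolding dF dq .
        qed
        have "good \<subseteq> (\<Union>U'\<in>\<U>. {d \<in> good. pt L z' d \<in> U'})"
        proof
          fix d assume d: "d \<in> good"
          then have "pt L z' d \<in> pt L z' ` words K L e" by (simp add: good_def)
          then have "pt L z' d \<in> \<Union>\<U>" using s(4) U(3) by blast
          then show "d \<in> (\<Union>U'\<in>\<U>. {d \<in> good. pt L z' d \<in> U'})" using d by blast
        qed
        then have "sum ?W good \<le> sum ?W (\<Union>U'\<in>\<U>. {d \<in> good. pt L z' d \<in> U'})"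
          by (rule sum_mono2[rotated]) (use fin_good U(1) W0 in auto)
        also have "\<dots> \<le> (\<Sum>U'\<in>\<U>. sum ?W {d \<in> good. pt L z' d \<in> U'})"
          by (rule sum_UN_le) (use fin_good U(1) W0 in auto)
        also have "\<dots> \<le> (\<Sum>U'\<in>\<U>. 4 * M * ?f U')" by (intro sum_mono each)
        also have "\<dots> = 4 * M * sum ?f \<U>" by (simp add: sum_distrib_left)
        finally have "1 / 2 \<le> 4 * M * sum ?f \<U>" using half by linarith
        then have "1 / (8 * M) \<le> sum ?f \<U>" using M by (simp add: field_simps)
        then show ?thesis by simp
      qed
    qed simp
    then show ?thesis using i by blast
  qed
  moreover have "0 < min 1 (1 / (8 * M))" using M by simp
  ultimately show ?thesis by blast
qed

end

section \<open>The minimizer of \<open>Zs\<close> and the discrete Hausdorff dimensions\<close>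

lemma summable_decay:
  fixes f :: "nat \<Rightarrow> real"
  assumes "0 < s" "\<And>k. k0 \<le> k \<Longrightarrow> 0 \<le> f k"
    "\<And>k. k0 \<le> k \<Longrightarrow> f k \<le> C * (real k + 1) * 2 powr (- (real k * s))"
  shows "summable f"
proof (rule summable_comparison_test_ev)
  show "\<forall>\<^sub>F k in sequentially. norm (f k) \<le> C * (real k + 1) * 2 powr (- (real k * s))"
    using assms(2,3) by (auto intro!: eventually_sequentiallyI[of k0])
  show "summable (\<lambda>k. C * (real k + 1) * 2 powr (- (real k * s)))"
  proof (rule summable_comparison_test_bigo)
    have "summable (\<lambda>k. inverse (real k ^ 2))" by (rule inverse_power_summable) simp
    then show "summable (\<lambda>k. norm (inverse (real k ^ 2)))" by simp
    show "(\<lambda>k. C * (real k + 1) * 2 powr (- (real k * s))) \<in> O(\<lambda>k. inverse (real k ^ 2))"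
      using assms(1) by real_asymp
  qed
qed

context carpet
begin

lemma Zs_deriv:
  "(Zs u has_real_derivative (\<Sum>i\<in>cols. rcol u i powr t * ln (rcol u i))) (at t)"
proof -
  have "((\<lambda>t. \<Sum>i\<in>cols. rcol u i powr t) has_real_derivative (\<Sum>i\<in>cols. rcol u i powr t * ln (rcol u i))) (at t)"
    by (rule DERIV_sum) (use rcol_pos in \<open>auto intro!: derivative_eq_intros\<close>)
  then show ?thesis unfolding Zs_def[abs_def] .
qed

text \<open>The two sign conditions are the one-sided first-order conditions of a minimum on [0, 1];
  at an interior minimizer both hold and the drift is 0.\<close>

lemma Zs_minimizer:
  obtains t0 where "0 \<le> t0" "t0 \<le> 1" "\<And>t. 0 \<le> t \<Longrightarrow> t \<le> 1 \<Longrightarrow> Zs u t0 \<le> Zs u t"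
    "0 < t0 \<Longrightarrow> drift u t0 \<le> 0" "t0 < 1 \<Longrightarrow> 0 \<le> drift u t0"
proof -
  have "continuous_on {0..1} (Zs u)"
    by (rule DERIV_continuous_on) (rule has_field_derivative_at_within[OF Zs_deriv])
  then obtain t0 where t0: "t0 \<in> {0..1}" and min: "\<And>t. t \<in> {0..1} \<Longrightarrow> Zs u t0 \<le> Zs u t"
    using continuous_attains_inf[of "{0..1::real}" "Zs u"] by auto
  have Z1: "1 \<le> Zs u t0" using Zs_ge_1 t0 by simp
  define D where "D = (\<Sum>i\<in>cols. rcol u i powr t0 * ln (rcol u i))"
  have drift: "drift u t0 = D / Zs u t0" by (simp add: drift_def D_def sum_divide_distrib)
  note der = Zs_deriv[of u t0, folded D_def]
  show ?thesis
  proof (rule that)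
    show "0 \<le> t0" "t0 \<le> 1" using t0 by simp_all
    show "Zs u t0 \<le> Zs u t" if "0 \<le> t" "t \<le> 1" for t using min that by simp
    show "drift u t0 \<le> 0" if "0 < t0"
    proof (rule ccontr)
      assume "\<not> drift u t0 \<le> 0"
      then have "0 < D" using Z1 unfolding drift by (simp add: not_le zero_less_divide_iff)
      from DERIV_pos_inc_left[OF der this] obtain d where
        d: "0 < d" "\<And>h. 0 < h \<Longrightarrow> h < d \<Longrightarrow> Zs u (t0 - h) < Zs u t0" by auto
      \<comment> \<open>The step is capped at \<open>t0\<close> so as not to leave the interval
        [0, 1].\<close>
      define h where "h = min (d / 2) t0"
      have "Zs u (t0 - h) < Zs u t0" by (rule d(2)) (use d(1) that in \<open>auto simp: h_def\<close>)
      moreover have "Zs u t0 \<le> Zs u (t0 - h)" by (rule min) (use d(1) that t0 in \<open>auto simp: h_def\<close>)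
      ultimately show False by simp
    qed
    show "0 \<le> drift u t0" if "t0 < 1"
    proof (rule ccontr)
      assume "\<not> 0 \<le> drift u t0"
      then have "D < 0" using Z1 unfolding drift by (simp add: not_le divide_less_0_iff)
      from DERIV_neg_dec_right[OF der this] obtain d where
        d: "0 < d" "\<And>h. 0 < h \<Longrightarrow> h < d \<Longrightarrow> Zs u (t0 + h) < Zs u t0" by auto
      define h where "h = min (d / 2) (1 - t0)"
      have "Zs u (t0 + h) < Zs u t0" by (rule d(2)) (use d(1) that in \<open>auto simp: h_def\<close>)
      moreover have "Zs u t0 \<le> Zs u (t0 + h)" by (rule min) (use d(1) that t0 in \<open>auto simp: h_def\<close>)
      ultimately show False by simp
    qed
  qed
qed

lemma dimH_nonneg: "0 \<le> t \<Longrightarrow> 0 \<le> dimH u t"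
  using dimA_nonneg[OF Zs_ge_1 num_cols_real(4), of t u u] dimH_dims(2)[of t u] by simp

lemma dimH_trivial:
  assumes "card \<Lambda> < 2" "0 \<le> t"
  shows "dimH u t = 0"
proof -
  have e: "real (eta m \<Lambda> u) = 1" using dims_trivial(3)[OF assms(1)] by simp
  have "rcol u i = 1" if "i \<in> cols" for i
  proof -
    have "col_count \<Lambda> i \<le> 1" using col_count_le[of i] dims_trivial(1)[OF assms(1)] by simp
    moreover have "0 < col_count \<Lambda> i" using that by (simp add: nonempty_cols_def)
    ultimately show ?thesis by (simp add: rcol_def e)
  qed
  then have "Zs u t = (\<Sum>i\<in>cols. 1)" unfolding Zs_def by (intro sum.cong) simp_all
  also have "\<dots> = 1" using dims_trivial(2)[OF assms(1)] by (simp add: num_cols_def)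
  finally show ?thesis by (simp add: dimH_def e)
qed

text \<open>Above the value the series converges, below it the terms do not even tend to 0. As
  summability implies null convergence, both infima have this value.\<close>

theorem discrete_hausdorff_dims_orbit:
  "lower_discrete_hausdorff_dim (orbit (u, v)) = discrete_hausdorff_dim (orbit (u, v))"
  "discrete_hausdorff_dim (orbit (u, v)) =
     ereal ((INF t\<in>{0..1}. log m (\<Sum>i\<in>cols. (col_count \<Lambda> i / eta m \<Lambda> u) powr t)) + log n (eta m \<Lambda> u))"
proof -
  obtain t0 where t0: "0 \<le> t0" "t0 \<le> 1" and min: "\<And>t. 0 \<le> t \<Longrightarrow> t \<le> 1 \<Longrightarrow> Zs u t0 \<le> Zs u t"
    and dr: "0 < t0 \<Longrightarrow> drift u t0 \<le> 0" "t0 < 1 \<Longrightarrow> 0 \<le> drift u t0"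
    by (rule Zs_minimizer[of u]) (rule that)
  let ?D = "dimH u t0" and ?A = "orbit (u, v)"
  have up: "summable (\<lambda>k. nu \<alpha> ?A (shell (Suc k)))" if \<alpha>: "?D < \<alpha>" for \<alpha>
  proof -
    have "0 < \<alpha>" using \<alpha> dimH_nonneg[OF t0(1), of u] by linarith
    then obtain C s i0 where s: "0 < s" and nu: "\<And>i. i0 \<le> i \<Longrightarrow>
        nu \<alpha> ?A (shell i) \<le> C * (real i + 1) * 2 powr (- (real i * s))"
      using nu_orbit_upper[OF t0 \<alpha>, of v] by metis
    have "summable (\<lambda>k. nu \<alpha> ?A (shell k))"
    proof (rule summable_decay[OF s, of "max 1 i0"])
      fix k assume k: "max 1 i0 \<le> k"
      then obtain j where "k = Suc j" by (cases k) auto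
      then show "0 \<le> nu \<alpha> ?A (shell k)" using nu_shell_nonneg by simp
      show "nu \<alpha> ?A (shell k) \<le> C * (real k + 1) * 2 powr (- (real k * s))" by (rule nu) (use k in simp)
    qed
    then show ?thesis by (subst summable_Suc_iff)
  qed
  have low: "?D \<le> \<alpha>" if \<alpha>: "0 < \<alpha>" "(\<lambda>k. nu \<alpha> ?A (shell k)) \<longlonglongrightarrow> 0" for \<alpha>
  proof (rule ccontr)
    assume n: "\<not> ?D \<le> \<alpha>"
    then have "\<not> card \<Lambda> < 2" using dimH_trivial[OF _ t0(1), of u] \<alpha>(1) by auto
    then have "2 \<le> card \<Lambda>" by simp
    from nu_orbit_lower[OF this t0 dr \<alpha>(1), of v] n obtain c where
      c: "0 < c" "\<And>i0. \<exists>i\<ge>i0. c \<le> nu \<alpha> ?A (shell i)" by auto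
    show False by (rule not_tendsto_zeroI[OF c \<alpha>(2)])
  qed
  have tend: "(\<lambda>k. nu \<alpha> ?A (shell k)) \<longlonglongrightarrow> 0" if "summable (\<lambda>k. nu \<alpha> ?A (shell (Suc k)))" for \<alpha>
    using summable_LIMSEQ_zero[OF that] by (rule LIMSEQ_imp_Suc)
  have pos: "0 < \<alpha>" if "?D < \<alpha>" for \<alpha> using that dimH_nonneg[OF t0(1), of u] by linarith
  have DH: "discrete_hausdorff_dim ?A = ereal ?D"
    unfolding discrete_hausdorff_dim_def
    by (rule Inf_ereal_image_eqI) (use low tend up pos in auto)
  have LH: "lower_discrete_hausdorff_dim ?A = ereal ?D"
    unfolding lower_discrete_hausdorff_dim_def
    by (rule Inf_ereal_image_eqI) (use low tend up pos in auto)
  show "lower_discrete_hausdorff_dim ?A = discrete_hausdorff_dim ?A" unfolding DH LH ..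
  have "(INF t\<in>{0..1}. log m (Zs u t)) = log m (Zs u t0)"
  proof (rule cInf_eq_minimum)
    show "log m (Zs u t0) \<in> (\<lambda>t. log m (Zs u t)) ` {0..1}" using t0 by simp
    fix x assume "x \<in> (\<lambda>t. log m (Zs u t)) ` {0..1}"
    then obtain t where t: "0 \<le> t" "t \<le> 1" "x = log m (Zs u t)" by auto
    show "log m (Zs u t0) \<le> x"
      unfolding t(3) using min[OF t(1,2)] Zs_ge_1[OF t0(1), of u] two_le_m by (intro log_mono) simp_all
  qed
  then have "?D = (INF t\<in>{0..1}. log m (Zs u t)) + log n (eta m \<Lambda> u)" by (simp add: dimH_def)
  then show "discrete_hausdorff_dim ?A =
     ereal ((INF t\<in>{0..1}. log m (\<Sum>i\<in>cols. (col_count \<Lambda> i / eta m \<Lambda> u) powr t)) + log n (eta m \<Lambda> u))"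
    unfolding DH Zs_def rcol_def by simp
qed

end

theorem theorem1p3:
  fixes m n :: nat and \<Lambda> :: "(nat \<times> nat) set" and u v :: int
  assumes "2 \<le> n" and "n < m"
    and "\<Lambda> \<subseteq> {0..<m} \<times> {0..<n}" and "\<Lambda> \<noteq> {}"
  shows "mass_dim_exists (pos_orbit m n \<Lambda> (u, v))
    \<and> mass_dim (pos_orbit m n \<Lambda> (u, v)) =
           ereal (log m (card \<Lambda> / eta m \<Lambda> u) + log n (eta m \<Lambda> u))
    \<and> beurling_dim (pos_orbit m n \<Lambda> (u, v)) =
           ereal (log m (card \<Lambda> / max_col m \<Lambda>) + log n (max_col m \<Lambda>))
    \<and> lower_entropy_index (pos_orbit m n \<Lambda> (u, v)) =
           ereal (min (log m (card \<Lambda> / eta m \<Lambda> u)) (log m (num_cols m \<Lambda>)) + log n (eta m \<Lambda> u))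
    \<and> discrete_packing_dim (pos_orbit m n \<Lambda> (u, v)) =
           ereal (max (log m (card \<Lambda> / eta m \<Lambda> u)) (log m (num_cols m \<Lambda>)) + log n (eta m \<Lambda> u))
    \<and> assouad_dim (pos_orbit m n \<Lambda> (u, v)) =
           ereal (log m (num_cols m \<Lambda>) + log n (max_col m \<Lambda>))
    \<and> lower_discrete_hausdorff_dim (pos_orbit m n \<Lambda> (u, v)) =
           discrete_hausdorff_dim (pos_orbit m n \<Lambda> (u, v))
    \<and> discrete_hausdorff_dim (pos_orbit m n \<Lambda> (u, v)) =
           ereal ((INF t\<in>{0..1}. log m (\<Sum>i\<in>nonempty_cols m \<Lambda>. (col_count \<Lambda> i / eta m \<Lambda> u) powr t))
                  + log n (eta m \<Lambda> u))"
proof -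
  interpret carpet m n \<Lambda> by unfold_locales (use assms in simp_all)
  have d1: "dim1 u = log m (card \<Lambda> / eta m \<Lambda> u) + log n (eta m \<Lambda> u)"
    by (rule dimM_eq) (use num_cols_real in simp_all)
  have d: "max (dim1 u) (dim2 u) = max (log m (card \<Lambda> / eta m \<Lambda> u)) (log m (num_cols m \<Lambda>)) + log n (eta m \<Lambda> u)"
    "min (dim1 u) (dim2 u) = min (log m (card \<Lambda> / eta m \<Lambda> u)) (log m (num_cols m \<Lambda>)) + log n (eta m \<Lambda> u)"
    unfolding d1 dimA_def by (simp_all add: max_def min_def)
  show ?thesis
    by (intro conjI mass_dim_orbit beurling_dim_orbit assouad_dim_orbit discrete_hausdorff_dims_orbit
        lower_entropy_index_orbit[of u v, unfolded d] discrete_packing_dim_orbit[of u v, unfolded d])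
qed

end
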